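(* Let $r,d\in\mathbb{N}$, let $B\in\mathbb{R}^{d\times d}$ be a Frolov matrix, and let $U$ be a random vector uniformly distributed in $[1,2^{1/d}]^d$. There is a constant $c>0$ (which may depend on $r$, $d$ and $B$) such that for every natural number $n\geq 2$, every shift parameter $v\in\mathbb{R}^d$ and every $f\in \mathring{H}^{r,\mathrm{mix}}([0,1]^d)$ \[ \mathbb{E}\left|Q_{n^{1/d}\hat{U}B}^v(f)-I_d(f)\right| \leq c\, n^{-r-1/2}\, (\log n)^{\frac{d-1}{2}}\, \Vert f\Vert_{H^{r,\mathrm{mix}}([0,1]^d)}. \]
   Context: Notation: $\mathbb{N}=\{1,2,\dots\}$ and $I_d(f)=\int_{\mathbb{R}^d} f(x)\,dx$. For an invertible matrix $S\in\mathbb{R}^{d\times d}$ and $v\in\mathbb{R}^d$, the quadrature rule $Q_S^v$ is \[Q_S^v(f)=\frac{1}{|\det S|}\sum_{m\in\mathbb{Z}^d} f\left(S^{-\top}(m+v)\right),\] where $S^{-\top}$ is the transpose of the inverse of $S$. For $u\in\mathbb{R}^d$, $\hat{u}=\mathrm{diag}(u_1,\dots,u_d)$; thus $\hat U$ is the random diagonal matrix with diagonal $U$. The expectation is with respect to $U$. A matrix $B\in\mathbb{R}^{d\times d}$ is a Frolov matrix if: (a) $B$ is invertible; (b) $\left|\prod_{j=1}^d (Bm)_j\right|\geq 1$ for every $m\in\mathbb{Z}^d\setminus\{0\}$; (c) for all $x,y\in\mathbb{R}^d$ the box $[x,y]=\{z\in\mathbb{R}^d : z_j \text{ lies between } x_j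 \text{ and } y_j \text{ (inclusive) for } j=1,\dots,d\}$ with volume $V=\prod_{j=1}^d|x_j-y_j|$ contains at most $V+1$ lattice points $Bm$, $m\in\mathbb{Z}^d$. $H^{r,\mathrm{mix}}(\mathbb{R}^d)$ is the space of real-valued $f\in L^2(\mathbb{R}^d)$ whose weak derivatives $D^\alpha f$ exist and lie in $L^2(\mathbb{R}^d)$ for all $\alpha\in\{0,\dots,r\}^d$; its elements are identified with their continuous representatives. $\mathring{H}^{r,\mathrm{mix}}([0,1]^d)$ is the subspace of those $f$ with support in $[0,1]^d$. The norm is $\Vert f\Vert_{H^{r,\mathrm{mix}}([0,1]^d)}=\left(\sum_{\alpha\in\{0,\dots,r\}^d}\Vert D^\alpha f\Vert_{L^2([0,1]^d)}^2\right)^{1/2}$. *)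

theory Defs
  imports "HOL-Probability.Probability"
begin

section \<open>Quadrature on shifted lattices\<close>

definition int_lattice :: "(real^'d) set"
  where "int_lattice = {m. \<forall>j. m $ j \<in> \<int>}"

definition diag_matrix :: "real^'d \<Rightarrow> real^'d^'d"
  where "diag_matrix u = (\<chi> i j. if i = j then u $ i else 0)"

definition quadrature :: "real^'d^'d \<Rightarrow> real^'d \<Rightarrow> (real^'d \<Rightarrow> real) \<Rightarrow> real"
  where "quadrature S v f =
    1 / \<bar>det S\<bar> * (\<Sum>\<^sub>\<infinity>m\<in>int_lattice. f (transpose (matrix_inv S) *v (m + v)))"

text \<open>The corners of a box may be given in any order, hence \<open>min\<close> and \<open>max\<close>.\<close>

definition box_between :: "real^'d \<Rightarrow> real^'d \<Rightarrow> (real^'d) set"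
  where "box_between x y = {z. \<forall>j. min (x $ j) (y $ j) \<le> z $ j \<and> z $ j \<le> max (x $ j) (y $ j)}"

text \<open>Finiteness is stated explicitly because the cardinality of an infinite set is \<open>0\<close>.\<close>

definition frolov_matrix :: "real^'d^'d \<Rightarrow> bool"
  where "frolov_matrix B \<longleftrightarrow>
    invertible B \<and>
    (\<forall>m\<in>int_lattice - {0}. 1 \<le> \<bar>\<Prod>j\<in>UNIV. (B *v m) $ j\<bar>) \<and>
    (\<forall>x y. finite ((*v) B ` int_lattice \<inter> box_between x y) \<and>
      real (card ((*v) B ` int_lattice \<inter> box_between x y)) \<le> (\<Prod>j\<in>UNIV. \<bar>x $ j - y $ j\<bar>) + 1)"


section \<open>Sobolev spaces of dominating mixed smoothness\<close>

definition partial_deriv :: "'d \<Rightarrow> (real^'d \<Rightarrow> real) \<Rightarrow> real^'d \<Rightarrow> real"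
  where "partial_deriv j \<phi> x = frechet_derivative \<phi> (at x) (axis j 1)"

fun iter_partial :: "'d list \<Rightarrow> (real^'d \<Rightarrow> real) \<Rightarrow> real^'d \<Rightarrow> real"
  where
    "iter_partial [] \<phi> = \<phi>"
  | "iter_partial (j # js) \<phi> = partial_deriv j (iter_partial js \<phi>)"

text \<open>A function is \<open>C\<^sup>\<infinity>\<close> iff all its iterated partial derivatives exist and
  are (Frechet) differentiable; their continuity is then automatic.\<close>

definition test_function :: "(real^'d \<Rightarrow> real) \<Rightarrow> bool"
  where "test_function \<phi> \<longleftrightarrow>
    (\<forall>js x. iter_partial js \<phi> differentiable (at x)) \<and> compact (closure {x. \<phi> x \<noteq> 0})"

text \<open>The order in which the partial derivatives are taken is left open: they commute on the
  test functions, to which this operator is applied.\<close>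

definition multi_deriv :: "('d \<Rightarrow> nat) \<Rightarrow> (real^'d \<Rightarrow> real) \<Rightarrow> real^'d \<Rightarrow> real"
  where "multi_deriv \<alpha> = iter_partial (SOME js. \<forall>j. count_list js j = \<alpha> j)"

definition square_integrable :: "(real^'d \<Rightarrow> real) \<Rightarrow> bool"
  where "square_integrable f \<longleftrightarrow> f \<in> borel_measurable lborel \<and> integrable lborel (\<lambda>x. (f x)\<^sup>2)"

text \<open>\<open>g\<close> is a representative of the weak derivative \<open>D\<^sup>\<alpha> f\<close> on the whole space, and both lie
  in \<open>L\<^sup>2\<close>.\<close>

definition has_weak_deriv :: "(real^'d \<Rightarrow> real) \<Rightarrow> ('d \<Rightarrow> nat) \<Rightarrow> (real^'d \<Rightarrow> real) \<Rightarrow> bool"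
  where "has_weak_deriv f \<alpha> g \<longleftrightarrow>
    square_integrable f \<and> square_integrable g \<and>
    (\<forall>\<phi>. test_function \<phi> \<longrightarrow>
      (\<integral>x. f x * multi_deriv \<alpha> \<phi> x \<partial>lborel) = (-1) ^ (\<Sum>j\<in>UNIV. \<alpha> j) * (\<integral>x. g x * \<phi> x \<partial>lborel))"

text \<open>Well defined up to null sets, since weak derivatives are unique almost everywhere.\<close>

definition weak_deriv :: "('d \<Rightarrow> nat) \<Rightarrow> (real^'d \<Rightarrow> real) \<Rightarrow> real^'d \<Rightarrow> real"
  where "weak_deriv \<alpha> f = (SOME g. has_weak_deriv f \<alpha> g)"

text \<open>Elements are the continuous representatives, not equivalence classes.\<close>

definition Hmix :: "nat \<Rightarrow> (real^'d \<Rightarrow> real) set"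
  where "Hmix r = {f. continuous_on UNIV f \<and> square_integrable f \<and>
    (\<forall>\<alpha>. (\<forall>j. \<alpha> j \<le> r) \<longrightarrow> (\<exists>g. has_weak_deriv f \<alpha> g))}"

definition unit_cube :: "(real^'d) set"
  where "unit_cube = cbox (\<chi> j. 0) (\<chi> j. 1)"

definition Hmix0 :: "nat \<Rightarrow> (real^'d \<Rightarrow> real) set"
  where "Hmix0 r = {f \<in> Hmix r. closure {x. f x \<noteq> 0} \<subseteq> unit_cube}"

definition Hmix_norm :: "nat \<Rightarrow> (real^'d \<Rightarrow> real) \<Rightarrow> real"
  where "Hmix_norm r f =
    sqrt (\<Sum>\<alpha> | \<forall>j. \<alpha> j \<le> r. \<integral>x\<in>unit_cube. (weak_deriv \<alpha> f x)\<^sup>2 \<partial>lborel)"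


section \<open>The random dilation\<close>

definition dilation_cube :: "(real^'d) set"
  where "dilation_cube = cbox (\<chi> j. 1) (\<chi> j. 2 powr (1 / real CARD('d)))"

definition uniform_dilation :: "'a measure \<Rightarrow> ('a \<Rightarrow> real^'d) \<Rightarrow> bool"
  where "uniform_dilation M U \<longleftrightarrow>
    U \<in> borel_measurable M \<and> distr M lborel U = uniform_measure lborel dilation_cube"

text \<open>The absolute error of the quadrature rule given by the matrix \<open>n\<^bsup>1/d\<^esup> diag(u) B\<close>.\<close>

definition quad_error :: "real^'d^'d \<Rightarrow> nat \<Rightarrow> real^'d \<Rightarrow> (real^'d \<Rightarrow> real) \<Rightarrow> real^'d \<Rightarrow> real"
  where "quad_error B n v f u =
    \<bar>quadrature ((real n powr (1 / real CARD('d))) *\<^sub>R (diag_matrix u ** B)) v f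
      - (\<integral>x. f x \<partial>lborel)\<bar>"

end

(* By Poisson summation the quadrature error with matrix S is at most the sum of |F(S m)| over nonzero
   integer vectors m, where F is the Fourier transform of the integrand. Averaged over the dilations,
   the point n^(1/d) diag(U) B m sweeps out a box; by the Frolov property these boxes cover each x at
   most 2 |x_1 ... x_d| / n times, and only if |x_1 ... x_d| >= n, so the expected error is at most a
   constant times 1/n times the integral of |F| over that hyperbolic region. Cauchy-Schwarz with the
   weight given by the mixed derivatives concludes.

   Only two facts of Fourier analysis on the whole space are needed, both for functions supported in
   the unit cube, and both come from Fourier series. The upper bound in Plancherel's theorem is Bessel's
   inequality for the frequencies k + t, k integer, integrated over t in a cube. The value at 0 of
   the periodization is recovered from its Fourier coefficients by testing with powers of a peaked
   trigonometric polynomial. *)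

theory Submission
  imports Defs
begin

section \<open>Linear changes of variables and the integer lattice\<close>

text \<open>Averaging pays because the sum over lattice points becomes an integral over frequencies,
  so that f enters through an L2 bound instead of pointwise bounds on its transform. For fixed m the
  substitution x = n^(1/d) U B m produces a density of at most 2 / |x_1 ... x_d|, which cancels
  against the covering number and leaves 4 / n. Cauchy-Schwarz adds n^(1/2 - r), whence the exponent
  -r - 1/2. The logarithm stems from moments of d - 1 coordinates, taken at distance 1 / (2 ln n)
  from the critical exponent; the square root halves its power d - 1.

  Two obstacles shape the Fourier part. Test functions are real and compactly supported, so
  exponentials reach the weak derivatives only as products of phase-shifted cosines with cutoffs.
  And Poisson summation is an inequality in [0, \<infinity>], so that nothing has to be known about
  the summability of F over an individual lattice. The shift v merely rotates the Fourier
  coefficients, hence the uniformity in v.\<close>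

lemma borel_measurable_vec_lambda:
  fixes f :: "'a \<Rightarrow> 'd::finite \<Rightarrow> real"
  assumes [measurable]: "\<And>j. (\<lambda>x. f x j) \<in> borel_measurable M"
  shows "(\<lambda>x. \<chi> j. f x j) \<in> borel_measurable M"
  by (subst borel_measurable_euclidean_space) (auto simp: Basis_vec_def inner_axis)

lemma borel_measurable_matrix_vector_mult [measurable]:
  "(*v) (S :: real^'n^'m) \<in> borel \<rightarrow>\<^sub>M borel"
  by (intro borel_measurable_continuous_onI linear_continuous_on linear_conv_bounded_linear[THEN iffD1] matrix_vector_mul_linear)

text \<open>Opens \<open>real^'d\<close> to the Fubini theorems for product measures; every
  integration over a single coordinate passes through this identity.\<close>

lemma lborel_vec_eq_PiM:
  "(lborel :: (real^'d) measure) = distr (\<Pi>\<^sub>M j\<in>UNIV. lborel) borel (\<lambda>g. \<chi> j. g j)"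
proof (rule lborel_eqI)
  interpret product_sigma_finite "\<lambda>_::'d. lborel :: real measure"
    by standard
  have meas: "(\<lambda>g. \<chi> j. g j) \<in> (\<Pi>\<^sub>M j\<in>(UNIV::'d set). (lborel :: real measure)) \<rightarrow>\<^sub>M borel"
    by (intro borel_measurable_vec_lambda) simp
  fix l u :: "real^'d" assume le: "\<And>b. b \<in> Basis \<Longrightarrow> l \<bullet> b \<le> u \<bullet> b"
  have le': "l $ j \<le> u $ j" for j
    using le[of "axis j 1"] by (simp add: inner_axis)
  have eq: "(\<lambda>g. \<chi> j. g j) -` box l u \<inter> space (\<Pi>\<^sub>M j\<in>(UNIV::'d set). (lborel :: real measure))
      = (\<Pi>\<^sub>E j\<in>UNIV. {l $ j <..< u $ j})"
    by (auto simp: mem_box_cart space_PiM PiE_def Pi_iff)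
  have "emeasure (distr (\<Pi>\<^sub>M j\<in>(UNIV::'d set). lborel) borel (\<lambda>g. \<chi> j. g j)) (box l u) =
      (\<Prod>j\<in>UNIV. ennreal (u $ j - l $ j))"
    using le' by (simp add: emeasure_distr[OF meas] eq emeasure_PiM)
  also have "\<dots> = ennreal (\<Prod>j\<in>UNIV. u $ j - l $ j)"
    using le' by (simp add: prod_ennreal)
  also have "(\<Prod>j\<in>UNIV. u $ j - l $ j) = (\<Prod>b\<in>Basis. (u - l) \<bullet> b)"
    by (simp add: Basis_vec_def cart_eq_inner_axis[symmetric] inner_axis UNION_singleton_eq_range
      prod.reindex axis_eq_axis inj_on_def)
  finally show "emeasure (distr (\<Pi>\<^sub>M j\<in>(UNIV::'d set). lborel) borel (\<lambda>g. \<chi> j. g j)) (box l u) =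
      ennreal (\<Prod>b\<in>Basis. (u - l) \<bullet> b)" .
qed simp

lemma integral_lborel_vec_prod:
  fixes f :: "'d::finite \<Rightarrow> real \<Rightarrow> 'b :: {real_normed_field,banach,second_countable_topology}"
  assumes "\<And>j. integrable lborel (f j)"
  shows "(\<integral>x. (\<Prod>j\<in>UNIV. f j (x $ j)) \<partial>(lborel :: (real^'d) measure)) = (\<Prod>j\<in>UNIV. \<integral>t. f j t \<partial>lborel)"
proof -
  interpret product_sigma_finite "\<lambda>_::'d. lborel :: real measure"
    by standard
  have meas: "(\<lambda>g. \<chi> j. g j) \<in> (\<Pi>\<^sub>M j\<in>(UNIV::'d set). (lborel :: real measure)) \<rightarrow>\<^sub>M borel"
    by (intro borel_measurable_vec_lambda) simp
  have [measurable]: "f j \<in> borel_measurable borel" for j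
    using borel_measurable_integrable[OF assms[of j]] by simp
  show ?thesis
    unfolding lborel_vec_eq_PiM
    by (subst integral_distr[OF meas]) (use assms in \<open>auto simp: product_integral_prod\<close>)
qed

lemma prod_Basis_vec:
  fixes x :: "real^'d"
  shows "(\<Prod>b\<in>Basis. x \<bullet> b) = (\<Prod>j\<in>UNIV. x $ j)"
  by (simp add: Basis_vec_def cart_eq_inner_axis[symmetric] inner_axis UNION_singleton_eq_range
      prod.reindex axis_eq_axis inj_on_def)

lemma distr_lborel_permute:
  fixes p :: "'d::finite \<Rightarrow> 'd"
  assumes p: "bij p"
  shows "distr lborel borel (\<lambda>x :: real^'d. \<chi> i. x $ p i) = lborel"
proof (rule lborel_eqI[symmetric])
  have [measurable]: "(\<lambda>x :: real^'d. \<chi> i. x $ p i) \<in> borel \<rightarrow>\<^sub>M borel"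
    by (intro borel_measurable_continuous_onI continuous_intros)
  define q where "q = inv p"
  have pq: "p (q i) = i" "q (p i) = i" for i
    using p by (simp_all add: q_def bij_is_surj surj_f_inv_f bij_is_inj)
  have q: "bij q"
    unfolding q_def using p by (rule bij_imp_bij_inv)
  fix l u :: "real^'d" assume le: "\<And>b. b \<in> Basis \<Longrightarrow> l \<bullet> b \<le> u \<bullet> b"
  have le': "l $ j \<le> u $ j" for j
    using le[of "axis j 1"] by (simp add: inner_axis)
  have "(\<lambda>x. \<chi> i. x $ p i) -` box l u = box (\<chi> i. l $ q i) (\<chi> i. u $ q i)"
    by (auto simp: mem_box_cart) (metis pq)+
  then have "emeasure (distr lborel borel (\<lambda>x :: real^'d. \<chi> i. x $ p i)) (box l u)
      = ennreal (\<Prod>b\<in>Basis. ((\<chi> i. u $ q i) - (\<chi> i. l $ q i)) \<bullet> b)"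
    using le' by (simp add: emeasure_distr, subst emeasure_lborel_box)
      (auto simp: Basis_vec_def inner_axis)
  also have "\<dots> = (\<Prod>b\<in>Basis. (u - l) \<bullet> b)"
    unfolding prod_Basis_vec using prod.reindex_bij_betw[OF q, of "\<lambda>i. u $ i - l $ i"] by simp
  finally show "emeasure (distr lborel borel (\<lambda>x :: real^'d. \<chi> i. x $ p i)) (box l u) = (\<Prod>b\<in>Basis. (u - l) \<bullet> b)" .
qed simp

text \<open>By Fubini in coordinate \<open>m\<close>: once the other coordinates are fixed, the
  shear is a translation of the line by the \<open>n\<close>-th coordinate.\<close>

lemma distr_lborel_shear:
  fixes m n :: "'d::finite"
  assumes mn: "m \<noteq> n"
  shows "distr lborel borel (\<lambda>x :: real^'d. \<chi> i. if i = m then x $ m + x $ n else x $ i) = lborel"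
    (is "distr lborel borel ?h = lborel")
proof (rule measure_eqI)
  interpret product_sigma_finite "\<lambda>_::'d. lborel :: real measure"
    by standard
  have [measurable]: "?h \<in> borel \<rightarrow>\<^sub>M borel"
    by (intro borel_measurable_vec_lambda) auto
  let ?P = "\<Pi>\<^sub>M j\<in>(UNIV::'d set). (lborel :: real measure)"
  have meas [measurable]: "vec_lambda \<in> ?P \<rightarrow>\<^sub>M (borel :: (real^'d) measure)"
    using borel_measurable_vec_lambda[of "\<lambda>g. g" ?P] by simp
  have ins: "insert m (UNIV - {m}) = UNIV" by auto
  fix A assume "A \<in> sets (distr lborel borel ?h)"
  then have [measurable]: "A \<in> sets borel" by simp
  have I: "(\<integral>\<^sup>+x. F x \<partial>lborel) = (\<integral>\<^sup>+g. (\<integral>\<^sup>+t. F (vec_lambda (g(m := t))) \<partial>lborel) \<partial>(\<Pi>\<^sub>M j\<in>UNIV - {m}. lborel))"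
    if [measurable]: "F \<in> borel_measurable borel" for F :: "real^'d \<Rightarrow> ennreal"
    unfolding lborel_vec_eq_PiM
    using product_nn_integral_insert[of "UNIV - {m}" m "\<lambda>g. F (vec_lambda g)"]
    by (subst nn_integral_distr) (simp_all add: ins)
  have "(\<integral>\<^sup>+x. indicator A (?h x) \<partial>lborel) = (\<integral>\<^sup>+x. indicator A x \<partial>lborel)"
  proof (subst (1 2) I, simp, simp, rule nn_integral_cong)
    fix g assume g: "g \<in> space (\<Pi>\<^sub>M j\<in>UNIV - {m}. (lborel :: real measure))"
    have "(\<lambda>t. g(m := t)) \<in> lborel \<rightarrow>\<^sub>M (\<Pi>\<^sub>M j\<in>insert m (UNIV - {m}). (lborel :: real measure))"
      using measurable_component_update[of g "UNIV - {m}" "\<lambda>_. lborel" m] g by simp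
    then have [measurable]: "(\<lambda>t. vec_lambda (g(m := t)) :: real^'d) \<in> borel \<rightarrow>\<^sub>M borel"
      unfolding ins using measurable_compose[OF _ meas] by (simp cong: measurable_cong_sets)
    have "?h (vec_lambda (g(m := t))) = vec_lambda (g(m := g n + 1 * t))" for t
      using mn by (auto simp: vec_eq_iff)
    then show "(\<integral>\<^sup>+t. indicator A (?h (vec_lambda (g(m := t)))) \<partial>lborel) = (\<integral>\<^sup>+t. indicator A (vec_lambda (g(m := t))) \<partial>lborel)"
      by (subst (2) nn_integral_real_affine[of _ 1 "g n"]) simp_all
  qed
  then show "emeasure (distr lborel borel ?h) A = emeasure lborel A"
    by (simp add: emeasure_distr nn_integral_distr flip: nn_integral_indicator)
qed simp

text \<open>Every matrix is a product of permutations, shears, diagonal matrices and matrices with a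
  zero row. The property is multiplicative because the determinant is, and each generator is checked
  separately.\<close>

lemma lborel_eq_density_linear:
  fixes S :: "real^'d^'d"
  assumes "invertible S"
  shows "(lborel :: (real^'d) measure) = density (distr lborel borel ((*v) S)) (\<lambda>_. \<bar>det S\<bar>)"
proof -
  \<comment> \<open>The implication makes the claim vacuous for singular matrices, which the
    induction also visits.\<close>
  define P where "P = (\<lambda>S :: real^'d^'d. det S \<noteq> 0 \<longrightarrow> lborel = density (distr lborel borel ((*v) S)) (\<lambda>_. \<bar>det S\<bar>))"
  have "P S"
  proof (rule induct_matrix_elementary_alt)
    fix A B :: "real^'d^'d"
    assume A: "P A" and B: "P B"
    show "P (A ** B)"
      unfolding P_def
    proof
      assume "det (A ** B) \<noteq> 0"
      then have "det A \<noteq> 0" "det B \<noteq> 0"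
        by (auto simp: det_mul)
      then have A: "lborel = density (distr lborel borel ((*v) A)) (\<lambda>_. \<bar>det A\<bar>)"
        and B: "lborel = density (distr lborel borel ((*v) B)) (\<lambda>_. \<bar>det B\<bar>)"
        using A B by (auto simp: P_def)
      have "lborel = density (distr (density (distr lborel borel ((*v) B)) (\<lambda>_. \<bar>det B\<bar>)) borel ((*v) A)) (\<lambda>_. \<bar>det A\<bar>)"
        using A B by simp
      also have "\<dots> = density (density (distr (distr lborel borel ((*v) B)) borel ((*v) A)) (\<lambda>_. \<bar>det B\<bar>)) (\<lambda>_. \<bar>det A\<bar>)"
        by (subst density_distr) auto
      also have "\<dots> = density (distr lborel borel ((*v) (A ** B))) (\<lambda>_. \<bar>det (A ** B)\<bar>)"
        by (subst density_density_eq)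
          (auto simp: distr_distr o_def matrix_vector_mul_assoc det_mul abs_mult mult.commute ennreal_mult)
      finally show "lborel = density (distr lborel borel ((*v) (A ** B))) (\<lambda>_. \<bar>det (A ** B)\<bar>)" .
    qed
  next
    fix A :: "real^'d^'d" and i
    assume "row i A = 0"
    then show "P A"
      by (simp add: P_def det_zero_row)
  next
    fix A :: "real^'d^'d"
    assume diag: "\<And>i j. i \<noteq> j \<Longrightarrow> A $ i $ j = 0"
    have det: "det A = (\<Prod>i\<in>UNIV. A $ i $ i)"
      by (rule det_diagonal) (use diag in auto)
    define c where "c = (\<lambda>b. (A *v b) \<bullet> b)"
    have c: "c (axis i 1) = A $ i $ i" for i
      by (simp add: c_def inner_axis matrix_vector_mul_component)
    have "(*v) A = (\<lambda>x. 0 + (\<Sum>b\<in>Basis. (c b * (x \<bullet> b)) *\<^sub>R b))"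
    proof
      fix x
      have "(A *v x) $ i = A $ i $ i * x $ i" for i
        unfolding matrix_vector_mult_def using diag
        by (subst sum.remove[of _ i]) (auto intro!: sum.neutral)
      moreover have "(\<Sum>b\<in>Basis. (c b * (x \<bullet> b)) *\<^sub>R b) $ i = A $ i $ i * x $ i" for i
        by (simp add: Basis_vec_def UNION_singleton_eq_range sum.reindex inj_on_def axis_eq_axis c inner_axis)
          (simp add: axis_def if_distrib[of "\<lambda>t. _ * t"] cong: if_cong)
      ultimately show "A *v x = 0 + (\<Sum>b\<in>Basis. (c b * (x \<bullet> b)) *\<^sub>R b)"
        by (simp add: vec_eq_iff)
    qed
    moreover have "(\<Prod>b\<in>Basis. \<bar>c b\<bar>) = \<bar>det A\<bar>"
      unfolding det abs_prod
      by (simp add: Basis_vec_def UNION_singleton_eq_range prod.reindex inj_on_def axis_eq_axis c)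
    moreover have "det A \<noteq> 0 \<Longrightarrow> b \<in> Basis \<Longrightarrow> c b \<noteq> 0" for b
      by (auto simp: Basis_vec_def c det)
    ultimately show "P A"
      unfolding P_def using lborel_affine_euclidean[of c 0] by simp
  next
    fix m n :: 'd
    assume mn: "m \<noteq> n"
    let ?A = "\<chi> i j. mat 1 $ i $ Transposition.transpose m n j :: real^'d^'d"
    have "?A *v x = (\<chi> i. x $ Transposition.transpose m n i)" for x
    proof -
      have "mat 1 $ i $ Transposition.transpose m n j * x $ j = (if j = Transposition.transpose m n i then x $ j else 0)" for i j
        by (auto simp: mat_def Transposition.transpose_def)
      then show ?thesis
        by (simp add: matrix_vector_mult_def vec_eq_iff)
    qed
    then have "(*v) ?A = (\<lambda>x. \<chi> i. x $ Transposition.transpose m n i)"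
      by (rule ext)
    moreover have "\<bar>det ?A\<bar> = 1"
      by (simp add: det_permute_columns permutes_swap_id sign_swap_id abs_mult)
    ultimately show "P ?A"
      unfolding P_def using distr_lborel_permute[of "Transposition.transpose m n"]
      by (simp add: density_1)
  next
    fix m n :: 'd
    assume mn: "m \<noteq> n"
    let ?A = "\<chi> i j. of_bool (i = m \<and> j = n \<or> i = j) :: real^'d^'d"
    have "?A *v x = (\<chi> i. if i = m then x $ m + x $ n else x $ i)" for x
    proof -
      have "x $ m + x $ n = (\<Sum>j\<in>UNIV. of_bool (j = n \<or> m = j) * x $ j)"
        using mn by (auto simp: of_bool_def if_distrib [of "\<lambda>x. x * y" for y] sum.remove cong: if_cong)
      then show ?thesis
        unfolding matrix_vector_mult_def of_bool_def
        by (auto simp: vec_eq_iff if_distrib [of "\<lambda>x. x * y" for y] cong: if_cong)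
    qed
    then have "(*v) ?A = (\<lambda>x. \<chi> i. if i = m then x $ m + x $ n else x $ i)"
      by (rule ext)
    moreover have "?A = (\<chi> k. if k = m then row m (mat 1) + 1 *s row n (mat 1) else row k (mat 1))"
      using mn by (auto simp: vec_eq_iff row_def mat_def)
    then have "det ?A = 1"
      using det_row_operation[OF mn, of "mat 1 :: real^'d^'d" 1] by simp
    ultimately show "P ?A"
      unfolding P_def using distr_lborel_shear[OF mn]
      by (simp add: density_1)
  qed
  then show ?thesis
    using assms by (simp add: P_def invertible_det_nz)
qed

lemma integral_lborel_linear:
  fixes S :: "real^'d^'d" and F :: "real^'d \<Rightarrow> 'b :: {banach,second_countable_topology}"
  assumes "invertible S" and [measurable]: "F \<in> borel_measurable borel"
  shows "(\<integral>x. F x \<partial>lborel) = \<bar>det S\<bar> *\<^sub>R (\<integral>x. F (S *v x) \<partial>lborel)"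
  by (subst lborel_eq_density_linear[OF assms(1)]) (auto simp: integral_density integral_distr)

lemma integral_lborel_translate:
  fixes F :: "real^'d \<Rightarrow> 'b :: {banach,second_countable_topology}"
  assumes [measurable]: "F \<in> borel_measurable borel"
  shows "(\<integral>x. F (a + x) \<partial>lborel) = (\<integral>x. F x \<partial>lborel)"
  by (subst (2) lborel_distr_plus[of a, symmetric]) (simp add: integral_distr)

lemma nn_integral_lborel_translate:
  fixes F :: "real^'d \<Rightarrow> ennreal"
  assumes [measurable]: "F \<in> borel_measurable borel"
  shows "(\<integral>\<^sup>+x. F (a + x) \<partial>lborel) = (\<integral>\<^sup>+x. F x \<partial>lborel)"
  by (subst (2) lborel_distr_plus[of a, symmetric]) (simp add: nn_integral_distr)


text \<open>Half-open, so that its lattice translates partition the space without exceptional null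
  sets; centred, so that 0 is an interior point when the peaked kernel concentrates there.\<close>

definition centred_cube :: "(real^'d) set"
  where "centred_cube = {y. \<forall>j. - (1/2) \<le> y $ j \<and> y $ j < 1/2}"

lemma centred_cube_sets [measurable]: "centred_cube \<in> sets borel"
  unfolding centred_cube_def by measurable

lemma countable_int_lattice: "countable (int_lattice :: (real^'d) set)"
proof -
  have "int_lattice \<subseteq> range (\<lambda>g :: 'd \<Rightarrow> int. (\<chi> j. of_int (g j)) :: real^'d)"
  proof
    fix m :: "real^'d" assume "m \<in> int_lattice"
    then have "m = (\<chi> j. of_int \<lfloor>m $ j\<rfloor>)"
      by (auto simp: int_lattice_def vec_eq_iff Ints_def)
    then show "m \<in> range (\<lambda>g :: 'd \<Rightarrow> int. (\<chi> j. of_int (g j)) :: real^'d)"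
      by (metis rangeI)
  qed
  then show ?thesis
    by (rule countable_subset) simp
qed

lemma lattice_tiling:
  fixes x :: "real^'d"
  obtains k where "k \<in> int_lattice" "\<And>m. m \<in> int_lattice \<Longrightarrow> x - m \<in> centred_cube \<longleftrightarrow> m = k"
proof
  \<comment> \<open>Coordinatewise nearest integer; ties round up, in agreement with the closed left
    end of the cell.\<close>
  define k :: "real^'d" where "k = (\<chi> j. of_int \<lfloor>x $ j + 1/2\<rfloor>)"
  show "k \<in> int_lattice"
    by (simp add: k_def int_lattice_def)
  fix m :: "real^'d" assume m: "m \<in> int_lattice"
  show "x - m \<in> centred_cube \<longleftrightarrow> m = k"
  proof
    assume "x - m \<in> centred_cube"
    have "m $ j = of_int \<lfloor>x $ j + 1/2\<rfloor>" for j
    proof -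
      obtain z :: int where z: "m $ j = of_int z"
        using m by (auto simp: int_lattice_def elim: Ints_cases)
      have "- (1/2) \<le> x $ j - m $ j" "x $ j - m $ j < 1/2"
        using \<open>x - m \<in> centred_cube\<close> by (simp_all add: centred_cube_def)
      then have "\<lfloor>x $ j + 1/2\<rfloor> = z"
        unfolding z by (intro floor_unique) linarith+
      then show ?thesis
        by (simp add: z)
    qed
    then show "m = k"
      by (simp add: k_def vec_eq_iff)
  qed (auto simp: k_def centred_cube_def, linarith+)
qed

text \<open>The indicators of the translated cells sum to 1. Inserting this sum, exchanging it with
  the integral and translating each cell back to the origin gives the formula, with no summability
  assumption because \<open>F\<close> is nonnegative.\<close>

lemma nn_integral_unfold:
  fixes F :: "real^'d \<Rightarrow> ennreal"
  assumes [measurable]: "F \<in> borel_measurable borel"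
  shows "(\<integral>\<^sup>+x. F x \<partial>lborel) =
    (\<integral>\<^sup>+y. (\<integral>\<^sup>+k. F (k + y) \<partial>count_space int_lattice) * indicator centred_cube y \<partial>lborel)"
proof -
  have "F x = (\<integral>\<^sup>+k. F x * indicator centred_cube (x - k) \<partial>count_space int_lattice)" for x
  proof -
    obtain k where k: "k \<in> int_lattice" "\<And>m. m \<in> int_lattice \<Longrightarrow> x - m \<in> centred_cube \<longleftrightarrow> m = k"
      using lattice_tiling by blast
    show ?thesis
      by (subst nn_integral_count_space'[of "{k}"]) (use k in auto)
  qed
  then have "(\<integral>\<^sup>+x. F x \<partial>lborel) =
      (\<integral>\<^sup>+x. (\<integral>\<^sup>+k. F x * indicator centred_cube (x - k) \<partial>count_space int_lattice) \<partial>lborel)"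
    by simp
  also have "\<dots> = (\<integral>\<^sup>+k. (\<integral>\<^sup>+x. F x * indicator centred_cube (x - k) \<partial>lborel) \<partial>count_space int_lattice)"
    by (rule nn_integral_count_space_nn_integral) (auto simp: countable_int_lattice)
  also have "\<dots> = (\<integral>\<^sup>+k. (\<integral>\<^sup>+y. F (k + y) * indicator centred_cube y \<partial>lborel) \<partial>count_space int_lattice)"
  proof (rule nn_integral_cong)
    fix k :: "real^'d"
    show "(\<integral>\<^sup>+x. F x * indicator centred_cube (x - k) \<partial>lborel) = (\<integral>\<^sup>+y. F (k + y) * indicator centred_cube y \<partial>lborel)"
      using nn_integral_lborel_translate[of "\<lambda>x. F x * indicator centred_cube (x - k)" k] by simp
  qed
  also have "\<dots> = (\<integral>\<^sup>+y. (\<integral>\<^sup>+k. F (k + y) * indicator centred_cube y \<partial>count_space int_lattice) \<partial>lborel)"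
    by (rule nn_integral_count_space_nn_integral[symmetric]) (auto simp: countable_int_lattice)
  finally show ?thesis
    by (simp add: nn_integral_multc)
qed


section \<open>Bessel's inequality and the Plancherel bound\<close>

text \<open>The set \<open>I\<close> may be any interval with end points \<open>a\<close> and
  \<open>a + 1\<close>, so that the closed unit cube (Bessel) and the half-open cell (Poisson) are
  treated at once. For k \<noteq> 0 the antiderivative takes equal values at both ends by
  periodicity.\<close>

lemma integral_cis_unit_interval:
  fixes I :: "real set" and k :: real
  assumes I: "I \<in> sets borel" "{a<..<a + 1} \<subseteq> I" "I \<subseteq> {a..a + 1}" and k: "k \<in> \<int>"
  shows "integrable lborel (\<lambda>t. indicator I t *\<^sub>R cis (2 * pi * (k * t)))"
    and "(\<integral>t. indicator I t *\<^sub>R cis (2 * pi * (k * t)) \<partial>lborel) = (if k = 0 then 1 else 0)"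
proof -
  have [measurable]: "I \<in> sets borel" by fact
  have cont: "continuous_on A (\<lambda>t. cis (2 * pi * (k * t)))" for A
    by (intro continuous_intros)
  have [measurable]: "(\<lambda>t. cis (2 * pi * (k * t))) \<in> borel_measurable borel"
    by (intro borel_measurable_continuous_onI cont)
  have eq: "AE t in lborel. indicator {a..a + 1} t *\<^sub>R cis (2 * pi * (k * t)) = indicator I t *\<^sub>R cis (2 * pi * (k * t))"
    using AE_lborel_singleton[of a] AE_lborel_singleton[of "a + 1"]
  proof eventually_elim
    case (elim t)
    then have "t \<in> {a..a + 1} \<longleftrightarrow> t \<in> I"
      using I(2,3) by (cases "a < t"; cases "t < a + 1") auto
    then show ?case by (simp add: indicator_def)
  qed
  have int: "integrable lborel (\<lambda>t. indicator {a..a + 1} t *\<^sub>R cis (2 * pi * (k * t)))"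
    by (rule borel_integrable_compact) (auto intro: cont)
  show "integrable lborel (\<lambda>t. indicator I t *\<^sub>R cis (2 * pi * (k * t)))"
    by (subst integrable_cong_AE[OF _ _ eq, symmetric]) (use int in auto)
  have "(\<integral>t. indicator I t *\<^sub>R cis (2 * pi * (k * t)) \<partial>lborel)
      = (\<integral>t. indicator {a..a + 1} t *\<^sub>R cis (2 * pi * (k * t)) \<partial>lborel)"
    by (rule integral_cong_AE[symmetric]) (use eq in auto)
  also have "\<dots> = (if k = 0 then 1 else 0)"
  proof (cases "k = 0")
    case False
    have "(\<integral>t. indicator {a..a + 1} t *\<^sub>R cis (2 * pi * (k * t)) \<partial>lborel)
      = cis (2 * pi * (k * (a + 1))) / (2 * pi * k * \<i>) - cis (2 * pi * (k * a)) / (2 * pi * k * \<i>)"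
    proof (rule integral_FTC_Icc)
      fix x :: real
      have "((\<lambda>z. exp (\<i> * (2 * pi * (k * z))) / (2 * pi * k * \<i>)) has_field_derivative
          exp (\<i> * (2 * pi * (k * x)))) (at (complex_of_real x))"
        using False by (auto intro!: derivative_eq_intros)
      from has_vector_derivative_real_field[OF this, of "{a..a + 1}"]
      show "((\<lambda>t. cis (2 * pi * (k * t)) / (2 * pi * k * \<i>)) has_vector_derivative
          cis (2 * pi * (k * x))) (at x within {a..a + 1})"
        by (simp add: cis_conv_exp)
    qed (auto intro: cont)
    also have "cis (2 * pi * (k * (a + 1))) = cis (2 * pi * (k * a))"
      using k by (simp add: distrib_left cis_mult[symmetric] cis_multiple_2pi)
    finally show ?thesis using False by simp
  qed simp
  finally show "(\<integral>t. indicator I t *\<^sub>R cis (2 * pi * (k * t)) \<partial>lborel) = (if k = 0 then 1 else 0)" .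
qed

lemma cis_inner_prod:
  fixes x y :: "real^'d"
  shows "cis (2 * pi * (x \<bullet> y)) = (\<Prod>j\<in>UNIV. cis (2 * pi * (x $ j * y $ j)))"
proof -
  have "cis (\<Sum>j\<in>A. f j) = (\<Prod>j\<in>A. cis (f j))" if "finite A" for A :: "'d set" and f
    using that by induction (auto simp: cis_mult[symmetric])
  then show ?thesis
    by (simp add: inner_vec_def sum_distrib_left)
qed

lemma integral_cis_cube:
  fixes k :: "real^'d"
  assumes I: "I \<in> sets borel" "{a<..<a + 1} \<subseteq> I" "I \<subseteq> {a..a + 1}" and k: "k \<in> int_lattice"
  shows "(\<integral>y. indicator {y. \<forall>j. y $ j \<in> I} y *\<^sub>R cis (2 * pi * (k \<bullet> y)) \<partial>lborel) = (if k = 0 then 1 else 0)"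
proof -
  have "indicator {y. \<forall>j. y $ j \<in> I} y *\<^sub>R cis (2 * pi * (k \<bullet> y)) =
      (\<Prod>j\<in>UNIV. indicator I (y $ j) *\<^sub>R cis (2 * pi * (k $ j * y $ j)))" for y :: "real^'d"
  proof (cases "\<forall>j. y $ j \<in> I")
    case False
    then obtain j where "y $ j \<notin> I" by blast
    then have "(\<Prod>j\<in>UNIV. indicator I (y $ j) *\<^sub>R cis (2 * pi * (k $ j * y $ j))) = 0"
      by (intro prod_zero bexI[of _ j]) auto
    with False show ?thesis by simp
  qed (simp add: cis_inner_prod)
  then have "(\<integral>y. indicator {y. \<forall>j. y $ j \<in> I} y *\<^sub>R cis (2 * pi * (k \<bullet> y)) \<partial>lborel) =
      (\<Prod>j\<in>UNIV. \<integral>t. indicator I t *\<^sub>R cis (2 * pi * (k $ j * t)) \<partial>lborel)"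
    by (simp only:) (intro integral_lborel_vec_prod integral_cis_unit_interval(1)[OF I],
       use k in \<open>simp add: int_lattice_def\<close>)
  also have "\<dots> = (\<Prod>j\<in>UNIV. if k $ j = 0 then 1 else 0)"
    using k by (intro prod.cong refl integral_cis_unit_interval(2)[OF I]) (simp add: int_lattice_def)
  also have "\<dots> = (if k = 0 then 1 else 0)"
    by (auto simp: vec_eq_iff intro!: prod.neutral)
  finally show ?thesis .
qed

lemma unit_cube_alt: "unit_cube = {y. \<forall>j. y $ j \<in> {0..1}}"
  by (auto simp: unit_cube_def mem_box_cart)

lemma centred_cube_alt: "centred_cube = {y. \<forall>j. y $ j \<in> {-(1/2)..<1/2}}"
  by (auto simp: centred_cube_def)

lemma integral_cis_unit_cube:
  fixes k :: "real^'d"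
  assumes "k \<in> int_lattice"
  shows "(\<integral>y. indicator unit_cube y *\<^sub>R cis (2 * pi * (k \<bullet> y)) \<partial>lborel) = (if k = 0 then 1 else 0)"
  unfolding unit_cube_alt by (rule integral_cis_cube[of _ 0]) (use assms in auto)

lemma integral_cis_centred_cube:
  fixes k :: "real^'d"
  assumes "k \<in> int_lattice"
  shows "(\<integral>y. indicator centred_cube y *\<^sub>R cis (2 * pi * (k \<bullet> y)) \<partial>lborel) = (if k = 0 then 1 else 0)"
  unfolding centred_cube_alt by (rule integral_cis_cube[of _ "-(1/2)"]) (use assms in auto)

lemma unit_cube_sets [measurable]: "unit_cube \<in> sets borel"
  by (simp add: unit_cube_def)

lemma emeasure_unit_cube: "emeasure lborel (unit_cube :: (real^'d) set) < \<infinity>"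
  unfolding unit_cube_def by (rule emeasure_lborel_cbox_finite)

lemma int_lattice_diff: "k \<in> int_lattice \<Longrightarrow> l \<in> int_lattice \<Longrightarrow> k - l \<in> int_lattice"
  and int_lattice_add: "k \<in> int_lattice \<Longrightarrow> l \<in> int_lattice \<Longrightarrow> k + l \<in> int_lattice"
  and int_lattice_0: "0 \<in> int_lattice"
  by (auto simp: int_lattice_def)

text \<open>With 2 pi in the exponent the integer frequencies are orthonormal on a unit cell, and no
  constant appears in Bessel's inequality or in Poisson summation.\<close>

definition fourier :: "(real^'d \<Rightarrow> real) \<Rightarrow> real^'d \<Rightarrow> complex"
  where "fourier g x = (\<integral>y. g y *\<^sub>R cis (- (2 * pi * (x \<bullet> y))) \<partial>lborel)"

lemma cis_inner_measurable [measurable]: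
  "(\<lambda>p :: (real^'d) \<times> (real^'d). cis (- (2 * pi * (fst p \<bullet> snd p)))) \<in> borel_measurable borel"
  "(\<lambda>p :: (real^'d). cis (- (2 * pi * (x \<bullet> p)))) \<in> borel_measurable borel"
  "(\<lambda>p :: (real^'d). cis (2 * pi * (x \<bullet> p))) \<in> borel_measurable borel"
  by (intro borel_measurable_continuous_onI continuous_intros)+

lemma fourier_measurable [measurable]:
  assumes [measurable]: "g \<in> borel_measurable borel"
  shows "fourier g \<in> borel_measurable borel"
proof -
  have [measurable]: "(\<lambda>p. cis (- (2 * pi * (fst p \<bullet> snd p)))) \<in> borel_measurable ((borel :: (real^'d) measure) \<Otimes>\<^sub>M lborel)"
    using cis_inner_measurable(1) by (simp add: borel_prod[symmetric] cong: measurable_cong_sets)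
  have "(\<lambda>p. g (snd p) *\<^sub>R cis (- (2 * pi * (fst p \<bullet> snd p)))) \<in> borel_measurable (borel \<Otimes>\<^sub>M lborel)"
    by measurable
  then show ?thesis
    unfolding fourier_def[abs_def] by (intro lborel.borel_measurable_lebesgue_integral) (simp add: case_prod_beta)
qed

lemma square_integrable_on_cube:
  fixes g :: "real^'d \<Rightarrow> real"
  assumes [measurable]: "g \<in> borel_measurable borel" and g2: "integrable lborel (\<lambda>y. (g y)\<^sup>2)"
    and supp: "\<And>y. y \<notin> unit_cube \<Longrightarrow> g y = 0"
  shows "integrable lborel g"
proof (rule Bochner_Integration.integrable_bound)
  show "integrable lborel (\<lambda>y. indicator (unit_cube :: (real^'d) set) y + (g y)\<^sup>2)"
    using g2 emeasure_unit_cube by (intro Bochner_Integration.integrable_add integrable_real_indicator) auto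
  have "\<bar>t\<bar> \<le> 1 + t\<^sup>2" for t :: real
    using zero_le_power2[of "\<bar>t\<bar> - 1"] by (simp add: power2_diff)
  then show "AE y in lborel. norm (g y) \<le> norm (indicator (unit_cube :: (real^'d) set) y + (g y)\<^sup>2)"
    using supp by (intro AE_I2) (auto simp: indicator_def)
qed simp

text \<open>Orthonormality survives the shift of all frequencies by \<theta>, since inner products
  only see the differences k - l. The inequality is the nonnegativity of the squared L2 distance
  from \<open>g\<close> to its projection \<open>h\<close>.\<close>

lemma bessel_unit_cube:
  fixes g :: "real^'d \<Rightarrow> real"
  assumes [measurable]: "g \<in> borel_measurable borel" and g2: "integrable lborel (\<lambda>y. (g y)\<^sup>2)"
    and supp: "\<And>y. y \<notin> unit_cube \<Longrightarrow> g y = 0"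
    and K: "finite K" "K \<subseteq> int_lattice"
  shows "(\<Sum>k\<in>K. (cmod (fourier g (k + \<theta>)))\<^sup>2) \<le> (\<integral>y. (g y)\<^sup>2 \<partial>lborel)"
proof -
  define c where "c k = fourier g (k + \<theta>)" for k
  \<comment> \<open>The indicator makes the exponentials integrable over the whole space; it does
    not affect the coefficients of \<open>g\<close>, which vanishes outside the cube.\<close>
  define e where "e k y = indicat_real unit_cube y *\<^sub>R cis (2 * pi * ((k + \<theta>) \<bullet> y))" for k y
  define h where "h y = (\<Sum>k\<in>K. c k * e k y)" for y
  have g1: "integrable lborel g"
    by (rule square_integrable_on_cube) (use g2 supp in auto)
  have [measurable]: "e k \<in> borel_measurable borel" for k
    unfolding e_def[abs_def] by measurable
  have [measurable]: "(\<lambda>y. cnj (e k y)) \<in> borel_measurable borel" for k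
    by (rule measurable_compose[OF _ borel_measurable_continuous_onI]) (auto intro!: continuous_intros)
  have ge: "integrable lborel (\<lambda>y. g y *\<^sub>R cnj (e k y))" for k
    by (rule Bochner_Integration.integrable_bound[OF g1], measurable) (auto simp: e_def indicator_def)
  have eg: "integrable lborel (\<lambda>y. g y *\<^sub>R e k y)" for k
    by (rule Bochner_Integration.integrable_bound[OF g1]) (auto simp: e_def indicator_def)
  have c: "(\<integral>y. g y *\<^sub>R cnj (e k y) \<partial>lborel) = c k" for k
    unfolding c_def fourier_def
    by (intro Bochner_Integration.integral_cong) (use supp in \<open>auto simp: e_def cis_cnj indicator_def\<close>)
  have c': "(\<integral>y. g y *\<^sub>R e k y \<partial>lborel) = cnj (c k)" for k
    unfolding c[symmetric] using Bochner_Integration.integral_cnj[of lborel "\<lambda>y. g y *\<^sub>R cnj (e k y)"]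
    by (simp add: scaleR_conv_of_real)
  have ee_eq: "e k y * cnj (e l y) = indicat_real unit_cube y *\<^sub>R cis (2 * pi * ((k - l) \<bullet> y))" for k l y
    by (simp add: e_def cis_cnj cis_mult indicator_def inner_diff_left inner_add_left algebra_simps)
  have ee: "integrable lborel (\<lambda>y. e k y * cnj (e l y))" for k l
    by (rule Bochner_Integration.integrable_bound[OF integrable_real_indicator[of unit_cube lborel]])
      (use emeasure_unit_cube in \<open>auto simp: ee_eq indicator_def\<close>)
  have oe: "(\<integral>y. e k y * cnj (e l y) \<partial>lborel) = (if k = l then 1 else 0)" if "k \<in> K" "l \<in> K" for k l
    unfolding ee_eq using that K by (subst integral_cis_unit_cube) (auto intro: int_lattice_diff)
  have hh: "h y * cnj (h y) = (\<Sum>k\<in>K. \<Sum>l\<in>K. c k * cnj (c l) * (e k y * cnj (e l y)))" for y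
    by (simp add: h_def sum_product cnj_sum mult_ac)
  have "(\<integral>y. h y * cnj (h y) \<partial>lborel) = (\<Sum>k\<in>K. \<Sum>l\<in>K. c k * cnj (c l) * (if k = l then 1 else 0))"
    unfolding hh using ee oe
    by (subst Bochner_Integration.integral_sum | subst integral_mult_right
        | intro Bochner_Integration.integrable_sum integrable_mult_right sum.cong refl | simp)+
  also have "\<dots> = (\<Sum>k\<in>K. c k * cnj (c k))"
    using K by (simp add: if_distrib[of "\<lambda>x. _ * x"] cong: if_cong)
  finally have I1: "(\<integral>y. h y * cnj (h y) \<partial>lborel) = (\<Sum>k\<in>K. c k * cnj (c k))" .
  have i1: "integrable lborel (\<lambda>y. h y * cnj (h y))"
    unfolding hh by (intro Bochner_Integration.integrable_sum integrable_mult_right ee)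
  have gh: "g y * cnj (h y) = (\<Sum>k\<in>K. cnj (c k) * (g y *\<^sub>R cnj (e k y)))" for y
    by (simp add: h_def sum_distrib_left scaleR_conv_of_real mult_ac)
  have hg: "h y * g y = (\<Sum>k\<in>K. c k * (g y *\<^sub>R e k y))" for y
    by (simp add: h_def sum_distrib_left scaleR_conv_of_real mult_ac)
  have i2: "integrable lborel (\<lambda>y. g y * cnj (h y))"
    unfolding gh by (intro Bochner_Integration.integrable_sum integrable_mult_right ge)
  have i3: "integrable lborel (\<lambda>y. h y * g y)"
    unfolding hg by (intro Bochner_Integration.integrable_sum integrable_mult_right eg)
  have I2: "(\<integral>y. g y * cnj (h y) \<partial>lborel) = (\<Sum>k\<in>K. c k * cnj (c k))"
    unfolding gh
    by (subst Bochner_Integration.integral_sum, rule integrable_mult_right, rule ge)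
      (simp only: integral_mult_right_zero c mult.commute)
  have I3: "(\<integral>y. h y * g y \<partial>lborel) = (\<Sum>k\<in>K. c k * cnj (c k))"
    unfolding hg
    by (subst Bochner_Integration.integral_sum, rule integrable_mult_right, rule eg)
      (simp only: integral_mult_right_zero c')
  have i4: "integrable lborel (\<lambda>y. complex_of_real ((g y)\<^sup>2))"
    using g2 by (rule integrable_of_real)
  have sq: "complex_of_real ((cmod (g y - h y))\<^sup>2) =
      complex_of_real ((g y)\<^sup>2) - g y * cnj (h y) - h y * g y + h y * cnj (h y)" for y
    by (subst complex_norm_square) (simp add: algebra_simps power2_eq_square)
  have "complex_of_real (\<integral>y. (cmod (g y - h y))\<^sup>2 \<partial>lborel) = (\<integral>y. complex_of_real ((cmod (g y - h y))\<^sup>2) \<partial>lborel)"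
    by (simp del: of_real_power)
  also have "\<dots> = (\<integral>y. complex_of_real ((g y)\<^sup>2) \<partial>lborel) - (\<Sum>k\<in>K. c k * cnj (c k))"
    unfolding sq using i1 i2 i3 i4 by (simp only: Bochner_Integration.integral_add Bochner_Integration.integral_diff Bochner_Integration.integrable_diff) (simp add: I1 I2 I3 del: of_real_power)
  also have "\<dots> = complex_of_real ((\<integral>y. (g y)\<^sup>2 \<partial>lborel) - (\<Sum>k\<in>K. (cmod (c k))\<^sup>2))"
    by (simp add: complex_norm_square[symmetric] del: of_real_power)
  finally have "(\<integral>y. (cmod (g y - h y))\<^sup>2 \<partial>lborel) = (\<integral>y. (g y)\<^sup>2 \<partial>lborel) - (\<Sum>k\<in>K. (cmod (c k))\<^sup>2)"
    by (simp only: of_real_eq_iff)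
  moreover have "(\<integral>y. (cmod (g y - h y))\<^sup>2 \<partial>lborel) \<ge> 0"
    by simp
  ultimately show ?thesis
    by (simp add: c_def)
qed

lemma nn_integral_count_space_le:
  assumes "countable A" and le: "\<And>K. finite K \<Longrightarrow> K \<subseteq> A \<Longrightarrow> sum f K \<le> c"
  shows "(\<integral>\<^sup>+x. f x \<partial>count_space A) \<le> (c :: ennreal)"
proof (cases "finite A")
  case True
  then show ?thesis using le[of A] by (simp add: nn_integral_count_space_finite)
next
  case False
  note bij = bij_betw_from_nat_into[OF assms(1) False]
  have "(\<integral>\<^sup>+x. f x \<partial>count_space A) = (\<Sum>n. f (from_nat_into A n))"
    by (simp add: nn_integral_bij_count_space[OF bij, symmetric] nn_integral_count_space_nat)
  also have "\<dots> \<le> c"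
  proof (rule suminf_le_const)
    fix n
    have "(\<Sum>i<n. f (from_nat_into A i)) = sum f (from_nat_into A ` {..<n})"
      using bij by (subst sum.reindex) (auto simp: bij_betw_def intro: inj_on_subset)
    also have "\<dots> \<le> c"
      using bij by (intro le) (auto simp: bij_betw_def)
    finally show "(\<Sum>i<n. f (from_nat_into A i)) \<le> c" .
  qed simp
  finally show ?thesis .
qed

text \<open>Bessel's inequality for each translate of the integer frequencies, averaged over the translates.\<close>

lemma plancherel_le:
  fixes g :: "real^'d \<Rightarrow> real"
  assumes [measurable]: "g \<in> borel_measurable borel" and g2: "integrable lborel (\<lambda>y. (g y)\<^sup>2)"
    and supp: "\<And>y. y \<notin> unit_cube \<Longrightarrow> g y = 0"
  shows "(\<integral>\<^sup>+x. ennreal ((cmod (fourier g x))\<^sup>2) \<partial>lborel) \<le> ennreal (\<integral>y. (g y)\<^sup>2 \<partial>lborel)"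
proof -
  have "(\<integral>\<^sup>+x. ennreal ((cmod (fourier g x))\<^sup>2) \<partial>lborel) =
    (\<integral>\<^sup>+y. (\<integral>\<^sup>+k. ennreal ((cmod (fourier g (k + y)))\<^sup>2) \<partial>count_space int_lattice) * indicator centred_cube y \<partial>lborel)"
    by (rule nn_integral_unfold) measurable
  also have "\<dots> \<le> (\<integral>\<^sup>+y. ennreal (\<integral>y. (g y)\<^sup>2 \<partial>lborel) * indicator (centred_cube :: (real^'d) set) y \<partial>lborel)"
    by (intro nn_integral_mono mult_right_mono nn_integral_count_space_le countable_int_lattice)
      (auto simp: sum_ennreal intro!: ennreal_leI bessel_unit_cube g2 supp)
  also have "\<dots> = ennreal (\<integral>y. (g y)\<^sup>2 \<partial>lborel) * emeasure lborel (centred_cube :: (real^'d) set)"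
    by (simp add: nn_integral_cmult)
  also have "\<dots> \<le> ennreal (\<integral>y. (g y)\<^sup>2 \<partial>lborel) * 1"
  proof (rule mult_left_mono)
    have "centred_cube \<subseteq> cbox (\<chi> j. -(1/2)) ((\<chi> j. 1/2) :: real^'d)"
      by (auto simp: centred_cube_def mem_box_cart) (metis less_imp_le)
    then have "emeasure lborel (centred_cube :: (real^'d) set) \<le> emeasure lborel (cbox (\<chi> j. -(1/2)) ((\<chi> j. 1/2) :: real^'d))"
      by (rule emeasure_mono) simp
    also have "\<dots> = ennreal (\<Prod>b\<in>Basis. ((\<chi> j. 1/2) - (\<chi> j. -(1/2)) :: real^'d) \<bullet> b)"
      by (rule emeasure_lborel_cbox) (auto simp: Basis_vec_def inner_axis)
    also have "\<dots> = 1"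
      unfolding prod_Basis_vec by simp
    finally show "emeasure lborel (centred_cube :: (real^'d) set) \<le> 1" .
  qed simp
  finally show ?thesis by simp
qed


section \<open>Smooth cutoffs and weak derivatives\<close>

text \<open>Quantifying the derivative existentially, instead of using \<open>deriv\<close>, lets
  each closure property exhibit its own derivative and be proved by induction on the order.\<close>

fun times_differentiable :: "nat \<Rightarrow> (real \<Rightarrow> real) \<Rightarrow> bool" where
  "times_differentiable 0 f \<longleftrightarrow> True"
| "times_differentiable (Suc n) f \<longleftrightarrow>
    (\<exists>f'. (\<forall>x. (f has_real_derivative f' x) (at x)) \<and> times_differentiable n f')"

definition smooth :: "(real \<Rightarrow> real) \<Rightarrow> bool"
  where "smooth f \<longleftrightarrow> (\<forall>n. times_differentiable n f)"

lemma times_differentiable_Suc_D: "times_differentiable (Suc n) f \<Longrightarrow> times_differentiable n f"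
proof (induction n arbitrary: f)
  case (Suc n)
  then obtain f' where "\<And>x. (f has_real_derivative f' x) (at x)" "times_differentiable (Suc n) f'"
    by (subst (asm) (2) times_differentiable.simps(2)) blast
  then show ?case
    using Suc.IH by auto
qed simp

lemma times_differentiable_SucI:
  "times_differentiable n f' \<Longrightarrow> (\<And>x. (f has_real_derivative f' x) (at x)) \<Longrightarrow> times_differentiable (Suc n) f"
  by auto

lemma times_differentiable_const: "times_differentiable n (\<lambda>x. c)"
proof (induction n arbitrary: c)
  case (Suc n)
  then show ?case
    using DERIV_const[of c] by (auto intro!: exI[of _ "\<lambda>_. 0"])
qed simp

lemma times_differentiable_add:
  "times_differentiable n f \<Longrightarrow> times_differentiable n g \<Longrightarrow> times_differentiable n (\<lambda>x. f x + g x)"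
proof (induction n arbitrary: f g)
  case (Suc n)
  then obtain f' g' where "\<And>x. (f has_real_derivative f' x) (at x)" "times_differentiable n f'"
    "\<And>x. (g has_real_derivative g' x) (at x)" "times_differentiable n g'"
    by auto
  then show ?case
    using Suc.IH[of f' g'] by (auto intro!: exI[of _ "\<lambda>x. f' x + g' x"] derivative_intros)
qed simp

lemma times_differentiable_mult:
  "times_differentiable n f \<Longrightarrow> times_differentiable n g \<Longrightarrow> times_differentiable n (\<lambda>x. f x * g x)"
proof (induction n arbitrary: f g)
  case (Suc n)
  then obtain f' g' where d: "\<And>x. (f has_real_derivative f' x) (at x)" "times_differentiable n f'"
    "\<And>x. (g has_real_derivative g' x) (at x)" "times_differentiable n g'"
    by auto
  have "times_differentiable n (\<lambda>x. f' x * g x + g' x * f x)"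
    by (intro times_differentiable_add Suc.IH d times_differentiable_Suc_D[OF Suc.prems(1)]
        times_differentiable_Suc_D[OF Suc.prems(2)])
  then show ?case
    by (rule times_differentiable_SucI) (intro DERIV_mult d)
qed simp

lemma times_differentiable_inverse:
  assumes "\<And>x. f x \<noteq> 0"
  shows "times_differentiable n f \<Longrightarrow> times_differentiable n (\<lambda>x. inverse (f x))"
proof (induction n)
  case (Suc n)
  then obtain f' where d: "\<And>x. (f has_real_derivative f' x) (at x)" "times_differentiable n f'"
    by auto
  have i: "times_differentiable n (\<lambda>x. inverse (f x))"
    by (rule Suc.IH[OF times_differentiable_Suc_D[OF Suc.prems]])
  have "times_differentiable n (\<lambda>x. (-1) * (inverse (f x) * f' x * inverse (f x)))"
    using d i by (intro times_differentiable_mult times_differentiable_const)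
  moreover have "((\<lambda>x. inverse (f x)) has_real_derivative (-1) * (inverse (f x) * f' x * inverse (f x))) (at x)" for x
    using DERIV_inverse'[OF d(1)[of x] assms[of x]] by (simp add: mult_ac)
  ultimately show ?case
    by (rule times_differentiable_SucI)
qed simp

lemma times_differentiable_affine:
  "times_differentiable n f \<Longrightarrow> times_differentiable n (\<lambda>x. f (a * x + b))"
proof (induction n arbitrary: f)
  case (Suc n)
  then obtain f' where d: "\<And>x. (f has_real_derivative f' x) (at x)" "times_differentiable n f'"
    by auto
  have "times_differentiable n (\<lambda>x. f' (a * x + b) * a)"
    using Suc.IH[OF d(2)] by (intro times_differentiable_mult times_differentiable_const)
  moreover have "((\<lambda>x. f (a * x + b)) has_real_derivative f' (a * x + b) * a) (at x)" for x
    by (rule DERIV_chain2[OF d(1)]) (auto intro!: derivative_eq_intros)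
  ultimately show ?case
    by (rule times_differentiable_SucI)
qed simp

lemma smooth_add: "smooth f \<Longrightarrow> smooth g \<Longrightarrow> smooth (\<lambda>x. f x + g x)"
  and smooth_mult: "smooth f \<Longrightarrow> smooth g \<Longrightarrow> smooth (\<lambda>x. f x * g x)"
  and smooth_inverse: "(\<And>x. f x \<noteq> 0) \<Longrightarrow> smooth f \<Longrightarrow> smooth (\<lambda>x. inverse (f x))"
  and smooth_affine: "smooth f \<Longrightarrow> smooth (\<lambda>x. f (a * x + b))"
  unfolding smooth_def
  by (auto intro: times_differentiable_add times_differentiable_mult
      times_differentiable_inverse times_differentiable_affine)

lemma smooth_has_derivative:
  assumes "smooth f"
  shows "(f has_real_derivative deriv f x) (at x)" and "smooth (deriv f)"
proof -
  have "\<exists>f'. (\<forall>x. (f has_real_derivative f' x) (at x)) \<and> times_differentiable n f'" for n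
    using assms unfolding smooth_def by (metis times_differentiable.simps(2))
  then have *: "(\<forall>x. (f has_real_derivative deriv f x) (at x)) \<and> times_differentiable n (deriv f)" for n
    by (metis DERIV_imp_deriv ext)
  show "(f has_real_derivative deriv f x) (at x)" "smooth (deriv f)"
    using * by (auto simp: smooth_def)
qed

lemma smooth_deriv_funpow: "smooth f \<Longrightarrow> smooth ((deriv ^^ k) f)"
  by (induction k) (auto intro: smooth_has_derivative)

text \<open>Differentiation multiplies the amplitude by \<open>a\<close> and advances the phase by
  pi / 2. The family of all such cosines is thus closed under differentiation, which is why
  amplitude and phase are generalised in the induction.\<close>

lemma times_differentiable_cos: "times_differentiable n (\<lambda>x. c * cos (a * x + b))"
proof (induction n arbitrary: c b)
  case (Suc n)
  have d: "((\<lambda>x. c * cos (a * x + b)) has_real_derivative c * a * cos (a * x + (b + pi / 2))) (at x)" for x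
    by (auto intro!: derivative_eq_intros simp: cos_add)
      (simp add: sin_add algebra_simps)
  then show ?case
    by (intro times_differentiable_SucI[OF Suc[of "c * a" "b + pi / 2"]])
qed simp

lemma smooth_cos: "smooth (\<lambda>x. cos (a * x + b))"
  unfolding smooth_def using times_differentiable_cos[of _ 1 a b] by simp

lemma deriv_funpow_cos: "(deriv ^^ k) (\<lambda>x :: real. cos (a * x + b)) = (\<lambda>x. a ^ k * cos (a * x + b + real k * (pi / 2)))"
proof (induction k)
  case (Suc k)
  have "deriv (\<lambda>x. a ^ k * cos (a * x + b + real k * (pi / 2))) x = a ^ Suc k * cos (a * x + b + real (Suc k) * (pi / 2))" for x
  proof -
    define y where "y = a * x + b + real k * (pi / 2)"
    have "((\<lambda>x. a ^ k * cos (a * x + b + real k * (pi / 2))) has_real_derivative - (a ^ Suc k * sin y)) (at x)"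
      by (auto intro!: derivative_eq_intros simp: y_def)
    moreover have "a * x + b + real (Suc k) * (pi / 2) = y + pi / 2"
      by (simp add: y_def algebra_simps)
    ultimately show ?thesis
      by (simp add: DERIV_imp_deriv cos_add)
  qed
  then show ?case
    by (simp add: Suc fun_eq_iff)
qed simp

text \<open>Derivatives are local. This removes a cutoff from under the derivative wherever the
  cutoff is identically 1.\<close>

lemma deriv_funpow_cong_open:
  fixes f g :: "real \<Rightarrow> real"
  assumes "open S" "\<And>x. x \<in> S \<Longrightarrow> f x = g x" "x \<in> S"
  shows "(deriv ^^ k) f x = (deriv ^^ k) g x"
  using assms(3)
proof (induction k arbitrary: x)
  case (Suc k)
  have "eventually (\<lambda>x. x \<in> S) (nhds x)"
    using assms(1) Suc.prems by (rule eventually_nhds_in_open)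
  then have "eventually (\<lambda>x. (deriv ^^ k) f x = (deriv ^^ k) g x) (nhds x)"
    by eventually_elim (rule Suc.IH)
  then show ?case
    by (simp add: deriv_cong_ev)
qed (simp add: assms(2))

text \<open>The constant polynomial 1 gives the classical flat function exp (-1/x), extended by 0;
  the polynomial factor closes the family under differentiation.\<close>

definition exp_inverse_poly :: "real poly \<Rightarrow> real \<Rightarrow> real"
  where "exp_inverse_poly p x = (if x > 0 then poly p (1 / x) * exp (- (1 / x)) else 0)"

lemma tendsto_poly_exp_at_top: "((\<lambda>y :: real. poly p y * exp (- y)) \<longlongrightarrow> 0) at_top"
proof -
  have "((\<lambda>y :: real. \<Sum>i\<le>degree p. coeff p i * (y ^ i / exp y)) \<longlongrightarrow> (\<Sum>i\<le>degree p. coeff p i * 0)) at_top"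
    by (intro tendsto_intros tendsto_power_div_exp_0)
  then show ?thesis
    by (simp add: poly_altdef sum_distrib_right sum_divide_distrib exp_minus field_simps)
qed

text \<open>With y = 1/x, the derivative of p(y) exp(-y) in x is y^2 (p - p')(y) exp(-y); the two
  \<open>pCons 0\<close> are the factor y^2. At 0 the right difference quotient is y p(y) exp(-y),
  which tends to 0 as y tends to infinity.\<close>

lemma exp_inverse_poly_derivative:
  "(exp_inverse_poly p has_real_derivative exp_inverse_poly (pCons 0 (pCons 0 (p - pderiv p))) x) (at x)"
proof -
  consider "x > 0" | "x < 0" | "x = 0" by linarith
  then show ?thesis
  proof cases
    case 1
    have "((\<lambda>x. poly p (1 / x) * exp (- (1 / x))) has_real_derivative
        exp_inverse_poly (pCons 0 (pCons 0 (p - pderiv p))) x) (at x)"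
      using 1 by (auto intro!: derivative_eq_intros poly_DERIV[THEN DERIV_chain2] simp: exp_inverse_poly_def)
        (simp add: field_simps power2_eq_square)
    then show ?thesis
      by (rule has_field_derivative_transform_within_open[of _ _ _ "{0<..}"])
        (use 1 in \<open>auto simp: exp_inverse_poly_def\<close>)
  next
    case 2
    have "((\<lambda>_. 0) has_real_derivative 0) (at x)"
      by simp
    then have "(exp_inverse_poly p has_real_derivative 0) (at x)"
      by (rule has_field_derivative_transform_within_open[of _ _ _ "{..<0}"])
        (use 2 in \<open>auto simp: exp_inverse_poly_def\<close>)
    then show ?thesis
      using 2 by (simp add: exp_inverse_poly_def)
  next
    case 3
    have R: "((\<lambda>h. exp_inverse_poly p h / h) \<longlongrightarrow> 0) (at_right 0)"
    proof -
      have "((\<lambda>h. poly (pCons 0 p) (inverse h) * exp (- inverse h)) \<longlongrightarrow> 0) (at_right (0::real))"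
        by (rule filterlim_compose[OF tendsto_poly_exp_at_top filterlim_inverse_at_top_right])
      moreover have "eventually (\<lambda>h. poly (pCons 0 p) (inverse h) * exp (- inverse h) = exp_inverse_poly p h / h) (at_right (0::real))"
        by (rule eventually_at_rightI[of _ 1]) (auto simp: exp_inverse_poly_def field_simps)
      ultimately show ?thesis
        by (rule Lim_transform_eventually)
    qed
    have L: "((\<lambda>h. exp_inverse_poly p h / h) \<longlongrightarrow> 0) (at_left 0)"
      by (rule Lim_transform_eventually[OF tendsto_const])
        (auto intro!: eventually_at_leftI[of "-1"] simp: exp_inverse_poly_def)
    show ?thesis
      using filterlim_split_at[OF L R] 3 by (simp add: DERIV_def exp_inverse_poly_def)
  qed
qed

lemma smooth_exp_inverse_poly: "smooth (exp_inverse_poly p)"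
proof -
  have "times_differentiable n (exp_inverse_poly p)" for n
    by (induction n arbitrary: p) (auto intro!: exI exp_inverse_poly_derivative)
  then show ?thesis by (simp add: smooth_def)
qed

lemma exists_smooth_step:
  obtains s :: "real \<Rightarrow> real" where "smooth s" "\<And>x. x \<le> 0 \<Longrightarrow> s x = 0" "\<And>x. x \<ge> 1 \<Longrightarrow> s x = 1"
    "\<And>x. 0 \<le> s x" "\<And>x. s x \<le> 1"
proof
  define e where "e = exp_inverse_poly [:1:]"
  \<comment> \<open>Never zero, since x > 0 or 1 - x > 0; so e / D is smooth and climbs from 0 to 1
    over the unit interval.\<close>
  define D where "D x = e x + e (1 - x)" for x
  have e: "e x \<ge> 0" "x \<le> 0 \<Longrightarrow> e x = 0" "x > 0 \<Longrightarrow> e x > 0" for x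
    by (auto simp: e_def exp_inverse_poly_def)
  have D: "D x > 0" for x
    unfolding D_def using e(1)[of x] e(1)[of "1 - x"] e(3)[of x] e(3)[of "1 - x"]
    by (cases "x > 0") (auto intro: add_pos_nonneg add_nonneg_pos)
  have se: "smooth e"
    unfolding e_def by (rule smooth_exp_inverse_poly)
  have "smooth D"
    unfolding D_def[abs_def] using smooth_affine[OF se, of "-1" 1] by (intro smooth_add se) simp
  then show "smooth (\<lambda>x. e x * inverse (D x))"
    using D by (intro smooth_mult smooth_inverse se) (auto simp: less_imp_neq[symmetric])
  show "e x * inverse (D x) = 0" if "x \<le> 0" for x
    using e(2)[OF that] by simp
  show "e x * inverse (D x) = 1" if "x \<ge> 1" for x
    using D[of x] e(2)[of "1 - x"] that by (simp add: D_def)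
  show "0 \<le> e x * inverse (D x)" for x
    using e(1)[of x] D[of x] by simp
  show "e x * inverse (D x) \<le> 1" for x
    using e(1)[of "1 - x"] D[of x] by (simp add: divide_simps D_def)
qed

text \<open>The plateau is an open neighbourhood of the unit interval, so multiplication by
  \<open>w\<close> changes no derivative at any point of [0, 1], end points included.\<close>

lemma exists_smooth_cutoff:
  fixes \<epsilon> :: real
  assumes "\<epsilon> > 0"
  obtains w :: "real \<Rightarrow> real" where "smooth w" "\<And>t. - \<epsilon> / 2 < t \<Longrightarrow> t < 1 + \<epsilon> / 2 \<Longrightarrow> w t = 1"
    "\<And>t. t \<notin> {- \<epsilon>..1 + \<epsilon>} \<Longrightarrow> w t = 0" "\<And>t. \<bar>w t\<bar> \<le> 1"
proof -
  obtain s :: "real \<Rightarrow> real" where s: "smooth s" "\<And>x. x \<le> 0 \<Longrightarrow> s x = 0" "\<And>x. x \<ge> 1 \<Longrightarrow> s x = 1"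
    "\<And>x. 0 \<le> s x" "\<And>x. s x \<le> 1"
    using exists_smooth_step by blast
  \<comment> \<open>The first factor rises between -\<epsilon> and -\<epsilon>/2, the second falls
    between 1 + \<epsilon>/2 and 1 + \<epsilon>.\<close>
  define w where "w t = s ((2 / \<epsilon>) * t + 2) * s ((- 2 / \<epsilon>) * t + (2 / \<epsilon> + 2))" for t
  show ?thesis
  proof (rule that[of w])
    show "smooth w"
      unfolding w_def[abs_def] by (intro smooth_mult smooth_affine s)
    show "w t = 1" if "- \<epsilon> / 2 < t" "t < 1 + \<epsilon> / 2" for t
    proof -
      have "(2 / \<epsilon>) * t + 2 = 2 * (t + \<epsilon>) / \<epsilon>" "(- 2 / \<epsilon>) * t + (2 / \<epsilon> + 2) = 2 * (1 + \<epsilon> - t) / \<epsilon>"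
        using assms by (simp_all add: field_simps)
      then have "(2 / \<epsilon>) * t + 2 \<ge> 1" "(- 2 / \<epsilon>) * t + (2 / \<epsilon> + 2) \<ge> 1"
        using that assms by (simp_all add: le_divide_eq)
      then show ?thesis
        unfolding w_def by (simp add: s(3))
    qed
    show "w t = 0" if "t \<notin> {- \<epsilon>..1 + \<epsilon>}" for t
    proof -
      have "(2 / \<epsilon>) * t + 2 = 2 * (t + \<epsilon>) / \<epsilon>" "(- 2 / \<epsilon>) * t + (2 / \<epsilon> + 2) = 2 * (1 + \<epsilon> - t) / \<epsilon>"
        using assms by (simp_all add: field_simps)
      then have "(2 / \<epsilon>) * t + 2 \<le> 0 \<or> (- 2 / \<epsilon>) * t + (2 / \<epsilon> + 2) \<le> 0"
        using that assms by (auto simp: divide_le_0_iff)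
      then show ?thesis
        unfolding w_def using s(2) by fastforce
    qed
    show "\<bar>w t\<bar> \<le> 1" for t
      unfolding w_def using s(4,5) by (simp add: abs_mult mult_le_one)
  qed
qed

section \<open>Tensor products as test functions\<close>

definition tensor :: "('d::finite \<Rightarrow> real \<Rightarrow> real) \<Rightarrow> real^'d \<Rightarrow> real"
  where "tensor \<phi> x = (\<Prod>j\<in>UNIV. \<phi> j (x $ j))"

lemma tensor_has_derivative:
  assumes "\<And>j. smooth (\<phi> j)"
  shows "(tensor \<phi> has_derivative (\<lambda>h. \<Sum>i\<in>UNIV. deriv (\<phi> i) (x $ i) * h $ i * (\<Prod>j\<in>UNIV - {i}. \<phi> j (x $ j)))) (at x)"
proof -
  have "((\<lambda>x. \<phi> j (x $ j)) has_derivative (\<lambda>h. deriv (\<phi> j) (x $ j) * h $ j)) (at x)" for j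
  proof -
    have "((\<lambda>x :: real^'a. x $ j) has_derivative (\<lambda>h. h $ j)) (at x)"
      by (rule bounded_linear_imp_has_derivative) (rule bounded_linear_vec_nth)
    from DERIV_compose_FDERIV[OF smooth_has_derivative(1)[OF assms[of j]] this]
    show ?thesis by (simp add: mult.commute)
  qed
  then show ?thesis
    unfolding tensor_def[abs_def] by (rule has_derivative_prod)
qed

lemma partial_deriv_tensor:
  assumes "\<And>j. smooth (\<phi> j)"
  shows "partial_deriv i (tensor \<phi>) = tensor (\<phi>(i := deriv (\<phi> i)))"
proof
  fix x
  have "partial_deriv i (tensor \<phi>) x =
      (\<Sum>k\<in>UNIV. deriv (\<phi> k) (x $ k) * axis i 1 $ k * (\<Prod>j\<in>UNIV - {k}. \<phi> j (x $ j)))"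
    unfolding partial_deriv_def frechet_derivative_at[OF tensor_has_derivative[OF assms], symmetric] ..
  also have "\<dots> = deriv (\<phi> i) (x $ i) * (\<Prod>j\<in>UNIV - {i}. \<phi> j (x $ j))"
    by (subst sum.remove[of _ i]) (auto intro!: sum.neutral simp: axis_def)
  also have "\<dots> = tensor (\<phi>(i := deriv (\<phi> i))) x"
    unfolding tensor_def by (subst (2) prod.remove[of _ i]) auto
  finally show "partial_deriv i (tensor \<phi>) x = tensor (\<phi>(i := deriv (\<phi> i))) x" .
qed

text \<open>Partial derivatives act on separate factors, so only the number of occurrences of each
  coordinate matters. This settles the unspecified order of differentiation in
  \<open>multi_deriv\<close>.\<close>

lemma iter_partial_tensor:
  assumes "\<And>j. smooth (\<phi> j)"
  shows "iter_partial js (tensor \<phi>) = tensor (\<lambda>j. (deriv ^^ count_list js j) (\<phi> j))"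
proof (induction js)
  case (Cons i js)
  have "(\<lambda>j. (deriv ^^ count_list js j) (\<phi> j))(i := deriv ((deriv ^^ count_list js i) (\<phi> i))) =
      (\<lambda>j. (deriv ^^ count_list (i # js) j) (\<phi> j))"
    by auto
  then show ?case
    using Cons partial_deriv_tensor[of "\<lambda>j. (deriv ^^ count_list js j) (\<phi> j)" i]
    by (simp add: smooth_deriv_funpow assms)
qed simp

lemma exists_list_count: "\<exists>js. \<forall>j. count_list js j = \<alpha> (j :: 'd::finite)"
proof -
  obtain xs where "mset xs = Abs_multiset \<alpha>"
    using ex_mset by blast
  then have "count (mset xs) j = \<alpha> j" for j
    by simp
  then show ?thesis
    by (auto simp: count_mset)
qed

lemma multi_deriv_tensor:
  assumes "\<And>j. smooth (\<phi> j)"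
  shows "multi_deriv \<alpha> (tensor \<phi>) = tensor (\<lambda>j. (deriv ^^ \<alpha> j) (\<phi> j))"
  using someI_ex[OF exists_list_count[of \<alpha>]]
  by (simp add: multi_deriv_def iter_partial_tensor[OF assms])

lemma test_function_tensor:
  fixes \<phi> :: "'d::finite \<Rightarrow> real \<Rightarrow> real"
  assumes "\<And>j. smooth (\<phi> j)" "\<And>j t. t \<notin> {a..b} \<Longrightarrow> \<phi> j t = 0"
  shows "test_function (tensor \<phi>)"
proof -
  have "tensor (\<lambda>j. (deriv ^^ count_list js j) (\<phi> j)) differentiable (at x)" for js x
    using tensor_has_derivative[of "\<lambda>j. (deriv ^^ count_list js j) (\<phi> j)" x]
    by (auto simp: differentiable_def smooth_deriv_funpow assms)
  moreover have "{x. tensor \<phi> x \<noteq> 0} \<subseteq> cbox (\<chi> j. a) (\<chi> j. b)"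
    using assms(2) by (force simp: tensor_def mem_box_cart)
  then have "bounded {x. tensor \<phi> x \<noteq> 0}"
    using bounded_cbox bounded_subset by blast
  ultimately show ?thesis
    by (simp add: test_function_def iter_partial_tensor[OF assms(1)])
qed


text \<open>On a set of finite measure |t| \<le> 1 + t^2 dominates. A weak derivative is only known
  to be square integrable, and restricting it to a bounded box gives the integrable majorant for
  dominated convergence.\<close>

lemma integrable_indicator_cbox_square_integrable:
  fixes g :: "real^'d \<Rightarrow> real"
  assumes "square_integrable g"
  shows "integrable lborel (\<lambda>y. indicator (cbox a b) y * g y)"
proof (rule Bochner_Integration.integrable_bound)
  have g: "g \<in> borel_measurable borel" "integrable lborel (\<lambda>y. (g y)\<^sup>2)"
    using assms by (simp_all add: square_integrable_def)
  show "integrable lborel (\<lambda>y. indicator (cbox a b) y + (g y)\<^sup>2)"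
    using g emeasure_lborel_cbox_finite[of a b]
    by (intro Bochner_Integration.integrable_add integrable_real_indicator) auto
  have "\<bar>t\<bar> \<le> 1 + t\<^sup>2" for t :: real
    using zero_le_power2[of "\<bar>t\<bar> - 1"] by (simp add: power2_diff)
  then show "AE y in lborel. norm (indicator (cbox a b) y * g y) \<le> norm (indicator (cbox a b) y + (g y)\<^sup>2)"
    by (intro AE_I2) (auto simp: indicator_def)
  show "(\<lambda>y. indicator (cbox a b) y * g y) \<in> borel_measurable lborel"
    using g by simp
qed

text \<open>Since a weak derivative \<open>g\<close> of a function supported in the cube is not yet known to vanish
  outside the cube, the trigonometric function is tested with cutoffs shrinking to the cube.\<close>

lemma weak_deriv_cos:
  fixes f g :: "real^'d \<Rightarrow> real"
  assumes w: "has_weak_deriv f \<alpha> g" and supp: "\<And>y. y \<notin> unit_cube \<Longrightarrow> f y = 0"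
  shows "(\<integral>y. f y * (\<Prod>j\<in>UNIV. a j ^ \<alpha> j * cos (a j * y $ j + b j + real (\<alpha> j) * (pi / 2))) \<partial>lborel) =
    (-1) ^ (\<Sum>j\<in>UNIV. \<alpha> j) * (\<integral>y. indicator unit_cube y * g y * (\<Prod>j\<in>UNIV. cos (a j * y $ j + b j)) \<partial>lborel)"
    (is "?L = ?s * ?R")
proof -
  \<comment> \<open>Widths at most 1 keep all cutoffs supported in the fixed box [-1, 2]^d, on which
    the majorant lives.\<close>
  define \<epsilon> where "\<epsilon> n = 1 / real (Suc n)" for n
  have eps: "0 < \<epsilon> n" "\<epsilon> n \<le> 1" for n
    by (auto simp: \<epsilon>_def)
  define good where "good n w \<longleftrightarrow> smooth w \<and> (\<forall>t. - \<epsilon> n / 2 < t \<longrightarrow> t < 1 + \<epsilon> n / 2 \<longrightarrow> w t = 1) \<and>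
      (\<forall>t. t \<notin> {- \<epsilon> n..1 + \<epsilon> n} \<longrightarrow> w t = 0) \<and> (\<forall>t. \<bar>w t\<bar> \<le> 1)" for n and w :: "real \<Rightarrow> real"
  have "\<exists>w. good n w" for n
    using exists_smooth_cutoff[OF eps(1)[of n]] unfolding good_def by metis
  then obtain w where "\<And>n. good n (w n)"
    by metis
  then have w: "smooth (w n)" "- \<epsilon> n / 2 < t \<Longrightarrow> t < 1 + \<epsilon> n / 2 \<Longrightarrow> w n t = 1"
      "t \<notin> {- \<epsilon> n..1 + \<epsilon> n} \<Longrightarrow> w n t = 0" "\<bar>w n t\<bar> \<le> 1" for n t
    unfolding good_def by blast+
  define \<phi> where "\<phi> n j t = w n t * cos (a j * t + b j)" for n j t
  have sm: "smooth (\<phi> n j)" for n j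
    unfolding \<phi>_def[abs_def] by (intro smooth_mult w smooth_cos)
  have test: "test_function (tensor (\<phi> n))" for n
    by (rule test_function_tensor[of _ "- \<epsilon> n" "1 + \<epsilon> n"]) (simp_all add: sm \<phi>_def w)
  have [measurable]: "tensor (\<phi> n) \<in> borel_measurable borel" for n
    by (intro borel_measurable_continuous_onI continuous_at_imp_continuous_on ballI
        has_derivative_continuous[OF tensor_has_derivative] sm)
  have gm [measurable]: "g \<in> borel_measurable borel"
    and sg: "square_integrable g"
    using assms(1) by (auto simp: has_weak_deriv_def square_integrable_def)
  \<comment> \<open>Independent of \<open>n\<close>: off the cube \<open>f\<close> vanishes, and on
    the cube the cutoff is locally constant 1, so the derivatives are those of the uncut cosines.
    Only the other side of the weak identity has to be passed to the limit.\<close>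
  have eq: "f y * multi_deriv \<alpha> (tensor (\<phi> n)) y =
      f y * (\<Prod>j\<in>UNIV. a j ^ \<alpha> j * cos (a j * y $ j + b j + real (\<alpha> j) * (pi / 2)))" for n y
  proof (cases "y \<in> unit_cube")
    case True
    have "(deriv ^^ \<alpha> j) (\<phi> n j) (y $ j) = a j ^ \<alpha> j * cos (a j * y $ j + b j + real (\<alpha> j) * (pi / 2))" for j
    proof -
      have y: "0 \<le> y $ j" "y $ j \<le> 1"
        using True by (auto simp: unit_cube_alt)
      have "(deriv ^^ \<alpha> j) (\<phi> n j) (y $ j) = (deriv ^^ \<alpha> j) (\<lambda>t. cos (a j * t + b j)) (y $ j)"
        by (rule deriv_funpow_cong_open[of "{- \<epsilon> n / 2<..<1 + \<epsilon> n / 2}"])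
          (use y eps[of n] w(2) in \<open>auto simp: \<phi>_def\<close>)
      then show ?thesis
        by (simp add: deriv_funpow_cos)
    qed
    then show ?thesis
      by (simp add: multi_deriv_tensor[OF sm] tensor_def)
  qed (simp add: supp)
  have L: "?L = ?s * (\<integral>y. g y * tensor (\<phi> n) y \<partial>lborel)" for n
    unfolding eq[of _ n, symmetric] using assms(1) test[of n] unfolding has_weak_deriv_def by blast
  have "(\<lambda>n. \<integral>y. g y * tensor (\<phi> n) y \<partial>lborel) \<longlonglongrightarrow> ?R"
  proof (rule integral_dominated_convergence)
    let ?K = "cbox (\<chi> j. - 1) (\<chi> j. 2) :: (real^'d) set"
    show "integrable lborel (\<lambda>y. \<bar>indicator ?K y * g y\<bar>)"
      by (intro integrable_abs integrable_indicator_cbox_square_integrable sg)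
    show "(\<lambda>y. indicator unit_cube y * g y * (\<Prod>j\<in>UNIV. cos (a j * y $ j + b j))) \<in> borel_measurable lborel"
      by measurable
    show "(\<lambda>y. g y * tensor (\<phi> n) y) \<in> borel_measurable lborel" for n
      by measurable
    show "AE y in lborel. norm (g y * tensor (\<phi> n) y) \<le> \<bar>indicator ?K y * g y\<bar>" for n
    proof (rule AE_I2)
      fix y
      show "norm (g y * tensor (\<phi> n) y) \<le> \<bar>indicator ?K y * g y\<bar>"
      proof (cases "y \<in> ?K")
        case True
        have "\<bar>tensor (\<phi> n) y\<bar> \<le> 1"
          unfolding tensor_def \<phi>_def abs_prod abs_mult
          by (intro prod_le_1 conjI mult_le_one w mult_nonneg_nonneg) auto
        then show ?thesis
          using True by (simp add: abs_mult mult_left_le)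
      next
        case False
        then obtain j where "y $ j \<notin> {-1..2}"
          by (auto simp: mem_box_cart)
        then have "y $ j \<notin> {- \<epsilon> n..1 + \<epsilon> n}"
          using eps[of n] by auto
        then have "tensor (\<phi> n) y = 0"
          unfolding tensor_def by (intro prod_zero bexI[of _ j]) (auto simp: \<phi>_def w)
        then show ?thesis by simp
      qed
    qed
    show "AE y in lborel. (\<lambda>n. g y * tensor (\<phi> n) y) \<longlonglongrightarrow> indicator unit_cube y * g y * (\<Prod>j\<in>UNIV. cos (a j * y $ j + b j))"
    proof (rule AE_I2)
      fix y :: "real^'d"
      show "(\<lambda>n. g y * tensor (\<phi> n) y) \<longlonglongrightarrow> indicator unit_cube y * g y * (\<Prod>j\<in>UNIV. cos (a j * y $ j + b j))"
      proof (cases "y \<in> unit_cube")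
        case True
        have "w n (y $ j) = 1" for n j
        proof (rule w(2))
          have "0 \<le> y $ j" "y $ j \<le> 1"
            using True by (auto simp: unit_cube_alt)
          then show "- \<epsilon> n / 2 < y $ j" "y $ j < 1 + \<epsilon> n / 2"
            using eps[of n] by linarith+
        qed
        then show ?thesis
          using True by (simp add: tensor_def \<phi>_def)
      next
        case False
        then obtain j where j: "y $ j < 0 \<or> 1 < y $ j"
          by (auto simp: unit_cube_alt not_le)
        have "\<epsilon> \<longlonglongrightarrow> 0"
          unfolding \<epsilon>_def[abs_def] by (rule LIMSEQ_Suc) (rule lim_1_over_n)
        \<comment> \<open>The distance of this coordinate from [0, 1]; once \<epsilon> is smaller,
          the cutoff vanishes at \<open>y\<close>.\<close>
        moreover have "max (- y $ j) (y $ j - 1) > 0"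
          using j by auto
        ultimately have "eventually (\<lambda>n. \<epsilon> n < max (- y $ j) (y $ j - 1)) sequentially"
          by (rule order_tendstoD)
        then have "eventually (\<lambda>n. g y * tensor (\<phi> n) y = 0) sequentially"
        proof eventually_elim
          case (elim n)
          then have "w n (y $ j) = 0"
            using j eps[of n] by (intro w(3)) auto
          then show ?case
            unfolding tensor_def by (auto simp: \<phi>_def intro!: prod_zero)
        qed
        then show ?thesis
          using False by (simp add: tendsto_eventually)
      qed
    qed
  qed
  then have "(\<lambda>n. ?s * (\<integral>y. g y * tensor (\<phi> n) y \<partial>lborel)) \<longlonglongrightarrow> ?s * ?R"
    by (intro tendsto_intros)
  then show ?thesis
    unfolding L[symmetric] by (simp add: LIMSEQ_const_iff)
qed

text \<open>Weak derivatives are tested against real functions, hence this expansion of the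
  exponential into real products: cis(-\<theta>) = cos \<theta> + i cos(\<theta> + pi/2), and
  \<open>J\<close> records the factors from which the second term is taken.\<close>

lemma cis_uminus_sum_cos:
  fixes \<theta> :: "'d::finite \<Rightarrow> real"
  shows "(\<Prod>j\<in>UNIV. cis (- \<theta> j)) =
    (\<Sum>J\<in>Pow UNIV. \<i> ^ card J * complex_of_real (\<Prod>j\<in>UNIV. cos (\<theta> j + (if j \<in> J then pi / 2 else 0))))"
proof -
  have "(\<Prod>j\<in>UNIV. cis (- \<theta> j)) = (\<Prod>j\<in>UNIV. \<i> * cos (\<theta> j + pi / 2) + cos (\<theta> j))"
    by (intro prod.cong refl) (simp add: complex_eq_iff cos_add)
  also have "\<dots> = (\<Sum>J\<in>Pow UNIV. (\<Prod>j\<in>J. \<i> * cos (\<theta> j + pi / 2)) * (\<Prod>j\<in>UNIV - J. complex_of_real (cos (\<theta> j))))"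
    by (rule prod_add) simp
  also have "\<dots> = (\<Sum>J\<in>Pow UNIV. \<i> ^ card J * complex_of_real (\<Prod>j\<in>UNIV. cos (\<theta> j + (if j \<in> J then pi / 2 else 0))))"
  proof (rule sum.cong)
    fix J :: "'d set"
    have "(\<Prod>j\<in>UNIV. cos (\<theta> j + (if j \<in> J then pi / 2 else 0))) =
        (\<Prod>j\<in>J. cos (\<theta> j + (if j \<in> J then pi / 2 else 0))) * (\<Prod>j\<in>UNIV - J. cos (\<theta> j + (if j \<in> J then pi / 2 else 0)))"
      using prod.subset_diff[of J UNIV "\<lambda>j. cos (\<theta> j + (if j \<in> J then pi / 2 else 0))"] by simp
    also have "\<dots> = (\<Prod>j\<in>J. cos (\<theta> j + pi / 2)) * (\<Prod>j\<in>UNIV - J. cos (\<theta> j))"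
      by simp
    finally show "(\<Prod>j\<in>J. \<i> * cos (\<theta> j + pi / 2)) * (\<Prod>j\<in>UNIV - J. complex_of_real (cos (\<theta> j))) =
        \<i> ^ card J * complex_of_real (\<Prod>j\<in>UNIV. cos (\<theta> j + (if j \<in> J then pi / 2 else 0)))"
      by (simp add: prod.distrib)
  qed simp
  finally show ?thesis .
qed

text \<open>The classical rule would multiply the transform by (2 pi i x)^\<alpha>. Moduli suffice
  here and absorb both the sign of the weak derivative and the phases created by differentiating
  cosines.\<close>

lemma norm_fourier_weak_deriv:
  fixes f g :: "real^'d \<Rightarrow> real"
  assumes w: "has_weak_deriv f \<alpha> g" and supp: "\<And>y. y \<notin> unit_cube \<Longrightarrow> f y = 0"
  shows "cmod (fourier (\<lambda>y. indicator unit_cube y * g y) x) =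
    (\<Prod>j\<in>UNIV. \<bar>2 * pi * x $ j\<bar> ^ \<alpha> j) * cmod (fourier f x)"
proof -
  define a where "a j = 2 * pi * x $ j" for j
  define p where "p J j = (if j \<in> J then pi / 2 else 0)" for J :: "'d set" and j
  let ?s = "(-1) ^ (\<Sum>j\<in>UNIV. \<alpha> j) :: real"
  have sf: "square_integrable f" and sg: "square_integrable g"
    using w by (auto simp: has_weak_deriv_def)
  have meas [measurable]: "f \<in> borel_measurable borel" "g \<in> borel_measurable borel"
    using sf sg by (auto simp: square_integrable_def)
  have ig: "integrable lborel (\<lambda>y. indicator unit_cube y * g y)"
    unfolding unit_cube_def by (rule integrable_indicator_cbox_square_integrable[OF sg])
  have "(\<lambda>y. indicator unit_cube y * f y) = f"
    using supp by (force simp: indicator_def)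
  then have "integrable lborel f"
    using integrable_indicator_cbox_square_integrable[OF sf] by (metis unit_cube_def)
  have int: "integrable lborel (\<lambda>y. h y * (\<Prod>j\<in>UNIV. c j * cos (a j * y $ j + b j)))"
    if "integrable lborel h" for h :: "real^'d \<Rightarrow> real" and b c
  proof (rule Bochner_Integration.integrable_bound[of _ "\<lambda>y. (\<Prod>j\<in>UNIV. \<bar>c j\<bar>) * h y"])
    have "\<bar>\<Prod>j\<in>UNIV. c j * cos (a j * y $ j + b j)\<bar> \<le> (\<Prod>j\<in>UNIV. \<bar>c j\<bar>)" for y
      unfolding abs_prod by (intro prod_mono) (auto simp: abs_mult mult_left_le)
    then show "AE y in lborel. norm (h y * (\<Prod>j\<in>UNIV. c j * cos (a j * y $ j + b j))) \<le> norm ((\<Prod>j\<in>UNIV. \<bar>c j\<bar>) * h y)"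
      by (intro AE_I2) (simp add: abs_mult prod_nonneg mult.commute mult_left_mono)
  qed (use that in auto)
  have prod_cis: "cis (- (2 * pi * (x \<bullet> y))) = (\<Prod>j\<in>UNIV. cis (- (a j * y $ j)))" for y
    using cis_inner_prod[of "- x" y] by (simp add: a_def mult.assoc)
  have expand: "fourier h x = (\<Sum>J\<in>Pow UNIV. \<i> ^ card J * complex_of_real (\<integral>y. h y * (\<Prod>j\<in>UNIV. cos (a j * y $ j + p J j)) \<partial>lborel))"
    if h: "integrable lborel h" for h
  proof -
    have i: "integrable lborel (\<lambda>y. h y * (\<Prod>j\<in>UNIV. cos (a j * y $ j + p J j)))" for J
      using int[OF h, of "\<lambda>_. 1" "p J"] by simp
    have "fourier h x = (\<integral>y. (\<Sum>J\<in>Pow UNIV. \<i> ^ card J * complex_of_real (h y * (\<Prod>j\<in>UNIV. cos (a j * y $ j + p J j)))) \<partial>lborel)"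
      unfolding fourier_def prod_cis cis_uminus_sum_cos p_def
      by (simp add: scaleR_conv_of_real sum_distrib_left mult_ac)
    also have "\<dots> = (\<Sum>J\<in>Pow UNIV. \<i> ^ card J * complex_of_real (\<integral>y. h y * (\<Prod>j\<in>UNIV. cos (a j * y $ j + p J j)) \<partial>lborel))"
      by (subst Bochner_Integration.integral_sum, rule integrable_mult_right, rule integrable_of_real, rule i)
        (simp only: integral_mult_right_zero integral_complex_of_real)
    finally show ?thesis .
  qed
  \<comment> \<open>Advancing the phase of factor j by \<alpha>_j pi/2 multiplies its exponential by
    the unimodular constant cis(-\<alpha>_j pi/2), which leaves the integral. The result is the same
    expansion over \<open>J\<close>, with the cosines differentiated.\<close>
  have shift: "(\<Prod>j\<in>UNIV. complex_of_real (a j ^ \<alpha> j) * cis (- (real (\<alpha> j) * (pi / 2)))) * fourier f x =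
      (\<Sum>J\<in>Pow UNIV. \<i> ^ card J * complex_of_real (\<integral>y. f y * (\<Prod>j\<in>UNIV. a j ^ \<alpha> j * cos (a j * y $ j + p J j + real (\<alpha> j) * (pi / 2))) \<partial>lborel))"
  proof -
    have i: "integrable lborel (\<lambda>y. f y * (\<Prod>j\<in>UNIV. a j ^ \<alpha> j * cos (a j * y $ j + p J j + real (\<alpha> j) * (pi / 2))))" for J
      using int[OF \<open>integrable lborel f\<close>, of "\<lambda>j. a j ^ \<alpha> j" "\<lambda>j. p J j + real (\<alpha> j) * (pi / 2)"] by (simp add: add.assoc)
    have e: "(\<Prod>j\<in>UNIV. complex_of_real (a j ^ \<alpha> j) * cis (- (real (\<alpha> j) * (pi / 2)))) * (\<Prod>j\<in>UNIV. cis (- (a j * y $ j)))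
      = (\<Sum>J\<in>Pow UNIV. \<i> ^ card J * complex_of_real (\<Prod>j\<in>UNIV. a j ^ \<alpha> j * cos (a j * y $ j + p J j + real (\<alpha> j) * (pi / 2))))" for y :: "real^'d"
    proof -
      have "(\<Prod>j\<in>UNIV. complex_of_real (a j ^ \<alpha> j) * cis (- (real (\<alpha> j) * (pi / 2)))) * (\<Prod>j\<in>UNIV. cis (- (a j * y $ j)))
        = complex_of_real (\<Prod>j\<in>UNIV. a j ^ \<alpha> j) * (\<Prod>j\<in>UNIV. cis (- (a j * y $ j + real (\<alpha> j) * (pi / 2))))"
        by (simp add: prod.distrib[symmetric] cis_mult mult.assoc add.commute)
      also have "\<dots> = (\<Sum>J\<in>Pow UNIV. \<i> ^ card J * complex_of_real ((\<Prod>j\<in>UNIV. a j ^ \<alpha> j) * (\<Prod>j\<in>UNIV. cos (a j * y $ j + p J j + real (\<alpha> j) * (pi / 2)))))"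
        unfolding cis_uminus_sum_cos p_def by (simp add: sum_distrib_left mult_ac add_ac)
      finally show ?thesis
        by (simp only: prod.distrib)
    qed
    have "(\<Prod>j\<in>UNIV. complex_of_real (a j ^ \<alpha> j) * cis (- (real (\<alpha> j) * (pi / 2)))) * fourier f x =
      (\<integral>y. complex_of_real (f y) * ((\<Prod>j\<in>UNIV. complex_of_real (a j ^ \<alpha> j) * cis (- (real (\<alpha> j) * (pi / 2)))) * (\<Prod>j\<in>UNIV. cis (- (a j * y $ j)))) \<partial>lborel)"
      unfolding fourier_def prod_cis integral_mult_right_zero[symmetric] by (simp only: scaleR_conv_of_real mult_ac)
    also have "\<dots> = (\<integral>y. (\<Sum>J\<in>Pow UNIV. \<i> ^ card J * complex_of_real (f y * (\<Prod>j\<in>UNIV. a j ^ \<alpha> j * cos (a j * y $ j + p J j + real (\<alpha> j) * (pi / 2))))) \<partial>lborel)"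
      unfolding e by (simp only: sum_distrib_left of_real_mult mult.left_commute)
    also have "\<dots> = (\<Sum>J\<in>Pow UNIV. \<i> ^ card J * complex_of_real (\<integral>y. f y * (\<Prod>j\<in>UNIV. a j ^ \<alpha> j * cos (a j * y $ j + p J j + real (\<alpha> j) * (pi / 2))) \<partial>lborel))"
      by (subst Bochner_Integration.integral_sum, rule integrable_mult_right, rule integrable_of_real, rule i)
        (simp only: integral_mult_right_zero integral_complex_of_real)
    finally show ?thesis .
  qed
  also have "\<dots> = complex_of_real ?s * fourier (\<lambda>y. indicator unit_cube y * g y) x"
    unfolding expand[OF ig] sum_distrib_left
  proof (rule sum.cong)
    fix J :: "'d set"
    show "\<i> ^ card J * complex_of_real (\<integral>y. f y * (\<Prod>j\<in>UNIV. a j ^ \<alpha> j * cos (a j * y $ j + p J j + real (\<alpha> j) * (pi / 2))) \<partial>lborel) =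
      complex_of_real ?s * (\<i> ^ card J * complex_of_real (\<integral>y. indicator unit_cube y * g y * (\<Prod>j\<in>UNIV. cos (a j * y $ j + p J j)) \<partial>lborel))"
      by (subst weak_deriv_cos[OF w supp]) (simp_all only: of_real_mult mult.left_commute not_False_eq_True)
  qed simp
  finally have "cmod (complex_of_real ?s * fourier (\<lambda>y. indicator unit_cube y * g y) x) =
      cmod ((\<Prod>j\<in>UNIV. complex_of_real (a j ^ \<alpha> j) * cis (- (real (\<alpha> j) * (pi / 2)))) * fourier f x)"
    by simp
  then show ?thesis
    by (simp add: norm_mult norm_power a_def abs_mult flip: prod_norm)
qed


section \<open>Poisson summation\<close>

lemma emeasure_centred_cube: "emeasure lborel (centred_cube :: (real^'d) set) < \<infinity>"
  and centred_cube_subset: "centred_cube \<subseteq> cbox (\<chi> j. -(1/2)) ((\<chi> j. 1/2) :: real^'d)"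
proof -
  show *: "centred_cube \<subseteq> cbox (\<chi> j. -(1/2)) ((\<chi> j. 1/2) :: real^'d)"
    by (auto simp: centred_cube_def mem_box_cart) (metis less_imp_le)
  show "emeasure lborel (centred_cube :: (real^'d) set) < \<infinity>"
    by (rule emeasure_bounded_finite) (meson * bounded_cbox bounded_subset)
qed

lemma integrable_centred_cube:
  fixes h :: "real^'d \<Rightarrow> 'b :: {banach, second_countable_topology}"
  assumes "continuous_on UNIV h"
  shows "integrable lborel (\<lambda>y. indicator centred_cube y *\<^sub>R h y)"
proof -
  have [measurable]: "h \<in> borel_measurable borel"
    using assms by (rule borel_measurable_continuous_onI)
  have "integrable lborel (\<lambda>y. indicator (cbox (\<chi> j. -(1/2)) ((\<chi> j. 1/2) :: real^'d)) y *\<^sub>R h y)"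
    using assms by (intro borel_integrable_compact) (auto intro: continuous_on_subset)
  then show ?thesis
    by (rule Bochner_Integration.integrable_bound)
      (use centred_cube_subset in \<open>auto simp: indicator_def intro!: AE_I2\<close>)
qed

text \<open>If G(0) > 0, the mass of \<open>G * K ^ N\<close> near the peak is at least \<eta> p^N
  |W|, while the region where G may be small or negative contributes at least -M q^N |Q| with q < p,
  Q being the cell. For large N the moment would be positive.\<close>

lemma zero_of_peaked_moments:
  fixes G K :: "real^'d \<Rightarrow> real"
  assumes G: "continuous_on UNIV G" and K: "continuous_on UNIV K"
    and K0: "K 0 > 0" "\<And>x. K x \<ge> 0"
    and peak: "\<And>x. x \<in> cbox (\<chi> j. -(1/2)) (\<chi> j. 1/2) \<Longrightarrow> x \<noteq> 0 \<Longrightarrow> K x < K 0"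
    and mom: "\<And>N. (\<integral>y. indicator centred_cube y * (G y * K y ^ N) \<partial>lborel) = 0"
  shows "\<not> G 0 > 0"
proof
  assume pos: "G 0 > 0"
  define C where "C = cbox (\<chi> j. -(1/2)) ((\<chi> j. 1/2) :: real^'d)"
  define \<eta> where "\<eta> = G 0 / 2"
  define U where "U = {x. \<eta> < G x}"
  have \<eta>: "\<eta> > 0" using pos by (simp add: \<eta>_def)
  have "open U"
    unfolding U_def by (intro open_Collect_less continuous_on_const G)
  have "0 \<in> U" using pos by (simp add: U_def \<eta>_def)
  have "compact (C - U)"
    using \<open>open U\<close> by (simp add: C_def compact_diff)
  \<comment> \<open>The maximum of \<open>K\<close> over the compact part of the closed cell outside
    \<open>U\<close>; it stays below the peak because 0 lies in \<open>U\<close>.\<close>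
  obtain q where q: "0 \<le> q" "q < K 0" "\<And>x. x \<in> C - U \<Longrightarrow> K x \<le> q"
  proof (cases "C - U = {}")
    case True
    then show ?thesis using that[of 0] K0 by auto
  next
    case False
    obtain x where "x \<in> C - U" "\<And>y. y \<in> C - U \<Longrightarrow> K y \<le> K x"
      using continuous_attains_sup[OF \<open>compact (C - U)\<close> False continuous_on_subset[OF K]] by auto
    then show ?thesis
      using that[of "K x"] K0 peak[of x] \<open>0 \<in> U\<close> by (auto simp: C_def)
  qed
  define p where "p = (q + K 0) / 2"
  have p: "q < p" "p < K 0" "p > 0" using q by (auto simp: p_def)
  define W where "W = {x. p < K x} \<inter> U \<inter> box (\<chi> j. -(1/2)) (\<chi> j. 1/2)"
  have "open W"
    unfolding W_def by (intro open_Int \<open>open U\<close> open_box open_Collect_less continuous_on_const K)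
  have "0 \<in> W"
    using \<open>0 \<in> U\<close> p by (simp add: W_def mem_box_cart)
  have WQ: "W \<subseteq> centred_cube"
    by (auto simp: W_def mem_box_cart centred_cube_def less_imp_le)
  have [measurable]: "W \<in> sets borel"
    using \<open>open W\<close> by simp
  have Wfin: "emeasure lborel W < \<infinity>"
    by (rule le_less_trans[OF emeasure_mono[OF WQ] emeasure_centred_cube]) simp
  have W: "measure lborel W > 0"
  proof (rule ccontr)
    assume "\<not> measure lborel W > 0"
    then have "measure lborel W = 0"
      using measure_nonneg[of lborel W] by linarith
    then have "emeasure lborel W = 0"
      using Wfin by (simp add: emeasure_eq_ennreal_measure)
    then have "W \<in> null_sets lborel"
      by (simp add: null_sets_def)
    then have "negligible W"
      by (simp add: negligible_iff_null_sets null_sets_completionI)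
    then show False
      using open_not_negligible[OF \<open>open W\<close>] \<open>0 \<in> W\<close> by blast
  qed
  have "bounded (G ` C)"
    by (intro compact_imp_bounded compact_continuous_image continuous_on_subset[OF G]) (auto simp: C_def)
  then obtain M where M: "M > 0" "\<And>x. x \<in> C \<Longrightarrow> \<bar>G x\<bar> \<le> M"
    by (auto simp: bounded_pos)
  let ?Q = "centred_cube :: (real^'d) set"
  have ineq: "\<eta> * measure lborel W \<le> M * measure lborel ?Q * (q / p) ^ N" for N
  proof -
    have "(\<integral>y. \<eta> * p ^ N * indicator W y - M * q ^ N * indicator ?Q y \<partial>lborel) \<le> (\<integral>y. indicator ?Q y * (G y * K y ^ N) \<partial>lborel)"
    proof (rule integral_mono)
      show "integrable lborel (\<lambda>y. \<eta> * p ^ N * indicator W y - M * q ^ N * indicator ?Q y)"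
        using Wfin emeasure_centred_cube by (intro Bochner_Integration.integrable_diff integrable_mult_right integrable_real_indicator) auto
      show "integrable lborel (\<lambda>y. indicator ?Q y * (G y * K y ^ N))"
        using integrable_centred_cube[of "\<lambda>y. G y * K y ^ N"] G K by (simp add: continuous_intros)
      fix y
      have Mq: "0 \<le> M * q ^ N" using M q by simp
      consider "y \<notin> ?Q" | "y \<in> W" | "y \<in> ?Q" "y \<notin> W" "y \<in> U" | "y \<in> ?Q" "y \<notin> U"
        by blast
      then show "\<eta> * p ^ N * indicator W y - M * q ^ N * indicator ?Q y \<le> indicator ?Q y * (G y * K y ^ N)"
      proof cases
        case 1
        then show ?thesis using WQ by (auto simp: indicator_def)
      next
        case 2
        then have "\<eta> \<le> G y" "p ^ N \<le> K y ^ N"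
          using p by (auto simp: W_def U_def intro!: power_mono)
        then have "\<eta> * p ^ N \<le> G y * K y ^ N"
          using \<eta> p by (intro mult_mono) auto
        then show ?thesis
          using 2 WQ Mq by (auto simp: indicator_def)
      next
        case 3
        then have "0 \<le> G y * K y ^ N"
          using \<eta> K0 by (auto simp: U_def)
        then show ?thesis
          using 3 Mq by (auto simp: indicator_def)
      next
        case 4
        then have "y \<in> C - U"
          using centred_cube_subset by (auto simp: C_def)
        then have "\<bar>G y\<bar> * K y ^ N \<le> M * q ^ N"
          using M q K0 by (intro mult_mono power_mono) auto
        then have "- (M * q ^ N) \<le> G y * K y ^ N"
          using abs_le_D2[of "G y * K y ^ N" "M * q ^ N"] K0(2)[of y] by (simp add: abs_mult)
        moreover have "y \<notin> W" using 4 by (auto simp: W_def)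
        ultimately show ?thesis
          using 4 by (auto simp: indicator_def)
      qed
    qed
    then have "\<eta> * p ^ N * measure lborel W - M * q ^ N * measure lborel ?Q \<le> 0"
      using Wfin emeasure_centred_cube mom[of N]
      by (subst (asm) Bochner_Integration.integral_diff) (auto intro!: integrable_mult_right integrable_real_indicator)
    then show ?thesis
      using p by (simp add: power_divide field_simps)
  qed
  have "(\<lambda>N. M * measure lborel ?Q * (q / p) ^ N) \<longlonglongrightarrow> M * measure lborel ?Q * 0"
    using q p by (intro tendsto_intros LIMSEQ_realpow_zero) auto
  then have "\<eta> * measure lborel W \<le> 0"
    using ineq by (intro LIMSEQ_le_const[of _ 0 "\<eta> * measure lborel W"]) auto
  then show False
    using \<eta> W by (simp add: mult_le_0_iff)
qed

lemma finite_int_lattice_bounded: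
  assumes "bounded A"
  shows "finite (int_lattice \<inter> (A :: (real^'d) set))"
proof -
  obtain b where b: "\<And>x. x \<in> A \<Longrightarrow> norm x \<le> b"
    using assms by (auto simp: bounded_iff)
  have "int_lattice \<inter> A \<subseteq> (\<lambda>g :: 'd \<Rightarrow> int. (\<chi> j. of_int (g j))) ` (\<Pi>\<^sub>E j\<in>UNIV. {- \<lceil>b\<rceil>..\<lceil>b\<rceil>})"
  proof
    fix m assume m: "m \<in> int_lattice \<inter> A"
    have "\<lfloor>m $ j\<rfloor> \<in> {- \<lceil>b\<rceil>..\<lceil>b\<rceil>}" for j
      using component_le_norm_cart[of m j] b[of m] m by (simp add: abs_le_iff) linarith
    moreover have "m = (\<chi> j. of_int \<lfloor>m $ j\<rfloor>)"
      using m by (auto simp: int_lattice_def vec_eq_iff Ints_def)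
    ultimately show "m \<in> (\<lambda>g :: 'd \<Rightarrow> int. (\<chi> j. of_int (g j))) ` (\<Pi>\<^sub>E j\<in>UNIV. {- \<lceil>b\<rceil>..\<lceil>b\<rceil>})"
      by (intro image_eqI[of _ _ "\<lambda>j. \<lfloor>m $ j\<rfloor>"]) auto
  qed
  then show ?thesis
    by (rule finite_subset) (intro finite_imageI finite_PiE, auto)
qed

lemma cis_lattice_periodic:
  assumes "k \<in> int_lattice" "m \<in> int_lattice"
  shows "cis (- (2 * pi * (k \<bullet> (m + y)))) = cis (- (2 * pi * (k \<bullet> y)))"
proof -
  have "k \<bullet> m \<in> \<int>"
    using assms unfolding inner_vec_def by (intro Ints_sum) (simp add: int_lattice_def)
  then have "cis (2 * pi * (- (k \<bullet> m))) = 1"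
    by (intro cis_multiple_2pi) simp
  moreover have "- (2 * pi * (k \<bullet> (m + y))) = 2 * pi * (- (k \<bullet> m)) + - (2 * pi * (k \<bullet> y))"
    by (simp add: inner_add_right algebra_simps)
  ultimately show ?thesis
    by (simp only: cis_mult[symmetric]) simp
qed

text \<open>The character of an integer frequency is lattice periodic, so integrating it against the
  periodization over one cell is integrating against \<open>T\<close> over the space. On the cell
  the periodization is the finite sum over \<open>M\<close>.\<close>

lemma unfold_fourier_coefficient:
  fixes T :: "real^'d \<Rightarrow> real"
  assumes T: "continuous_on UNIV T" and M: "finite M" "M \<subseteq> int_lattice"
    and supp: "\<And>m y. m \<in> int_lattice \<Longrightarrow> y \<in> centred_cube \<Longrightarrow> T (m + y) \<noteq> 0 \<Longrightarrow> m \<in> M"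
    and k: "k \<in> int_lattice"
  shows "(\<integral>y. indicator centred_cube y *\<^sub>R (complex_of_real (\<Sum>m\<in>M. T (m + y)) * cis (- (2 * pi * (k \<bullet> y)))) \<partial>lborel) = fourier T k"
proof -
  define H where "H y = T y *\<^sub>R cis (- (2 * pi * (k \<bullet> y)))" for y
  have H: "continuous_on UNIV H"
    unfolding H_def[abs_def] by (intro continuous_intros T)
  have [measurable]: "H \<in> borel_measurable borel"
    using H by (rule borel_measurable_continuous_onI)
  have Hm: "continuous_on UNIV (\<lambda>y. H (m + y))" for m
    by (rule continuous_on_compose2[OF H]) (auto intro!: continuous_intros)
  have "indicator centred_cube y *\<^sub>R (complex_of_real (\<Sum>m\<in>M. T (m + y)) * cis (- (2 * pi * (k \<bullet> y)))) =
      (\<Sum>m\<in>M. indicator centred_cube y *\<^sub>R H (m + y))" for y :: "real^'d"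
  proof -
    have "H (m + y) = T (m + y) *\<^sub>R cis (- (2 * pi * (k \<bullet> y)))" if "m \<in> M" for m
      unfolding H_def using cis_lattice_periodic[OF k, of m y] that M by auto
    then show ?thesis
      by (simp add: scaleR_conv_of_real sum_distrib_left sum_distrib_right mult.assoc)
  qed
  then have "(\<integral>y. indicator centred_cube y *\<^sub>R (complex_of_real (\<Sum>m\<in>M. T (m + y)) * cis (- (2 * pi * (k \<bullet> y)))) \<partial>lborel) =
      (\<Sum>m\<in>M. \<integral>y. indicator centred_cube y *\<^sub>R H (m + y) \<partial>lborel)"
    by (simp add: integrable_centred_cube[OF Hm])
  also have "\<dots> = (\<Sum>m\<in>M. \<integral>y. indicator centred_cube (y - m) *\<^sub>R H y \<partial>lborel)"
  proof (rule sum.cong)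
    fix m
    show "(\<integral>y. indicator centred_cube y *\<^sub>R H (m + y) \<partial>lborel) = (\<integral>y. indicator centred_cube (y - m) *\<^sub>R H y \<partial>lborel)"
      using integral_lborel_translate[of "\<lambda>y. indicator centred_cube (y - m) *\<^sub>R H y" m] by simp
  qed simp
  also have "\<dots> = (\<integral>y. (\<Sum>m\<in>M. indicator centred_cube (y - m) *\<^sub>R H y) \<partial>lborel)"
  proof (rule Bochner_Integration.integral_sum[symmetric])
    fix m
    have "integrable (distr lborel borel ((+) m)) (\<lambda>y. indicator centred_cube (y - m) *\<^sub>R H y)"
      using integrable_centred_cube[OF Hm[of m]] by (subst integrable_distr_eq) simp_all
    then show "integrable lborel (\<lambda>y. indicator centred_cube (y - m) *\<^sub>R H y)"
      by (simp add: lborel_distr_plus)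
  qed
  also have "\<dots> = (\<integral>y. H y \<partial>lborel)"
  proof (rule Bochner_Integration.integral_cong)
    fix y :: "real^'d"
    obtain l where l: "l \<in> int_lattice" "\<And>m. m \<in> int_lattice \<Longrightarrow> y - m \<in> centred_cube \<longleftrightarrow> m = l"
      using lattice_tiling by blast
    show "(\<Sum>m\<in>M. indicator centred_cube (y - m) *\<^sub>R H y) = H y"
    proof (cases "l \<in> M")
      case True
      have "(\<Sum>m\<in>M. indicator centred_cube (y - m) *\<^sub>R H y) = (\<Sum>m\<in>M. if m = l then H y else 0)"
        using l M by (intro sum.cong) (auto simp: indicator_def)
      then show ?thesis using True M by simp
    next
      case False
      then have "T (l + (y - l)) = 0"
        using supp[of l "y - l"] l by blast
      then show ?thesis by (simp add: H_def)
    qed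
  qed simp
  finally show ?thesis
    by (simp add: H_def fourier_def)
qed


lemma infinite_int_lattice_minus_0: "infinite (int_lattice - {0} :: (real^'d) set)"
proof -
  obtain j :: 'd where True by simp
  have "inj (\<lambda>n :: nat. axis j (real (Suc n)) :: real^'d)"
    by (auto simp: inj_on_def axis_eq_axis)
  moreover have "range (\<lambda>n :: nat. axis j (real (Suc n)) :: real^'d) \<subseteq> int_lattice - {0}"
    by (auto simp: axis_eq_0_iff) (simp add: int_lattice_def axis_def)
  ultimately show ?thesis
    using finite_subset range_inj_infinite by blast
qed

text \<open>Being a trigonometric polynomial of degree one in each variable, it only couples
  neighbouring frequencies, so that vanishing Fourier coefficients remain zero after multiplication
  by its powers.\<close>

definition peak_kernel :: "real^'d \<Rightarrow> real"
  where "peak_kernel y = (\<Sum>j\<in>UNIV. 1 + cos (2 * pi * y $ j))"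

lemma peak_kernel_nonneg: "peak_kernel y \<ge> 0"
  unfolding peak_kernel_def by (intro sum_nonneg) (metis cos_ge_minus_one add.commute neg_le_iff_le le_add_iff1 add_left_mono add.right_inverse)

lemma peak_kernel_less:
  fixes y :: "real^'d"
  assumes "y \<in> cbox (\<chi> j. -(1/2)) (\<chi> j. 1/2)" "y \<noteq> 0"
  shows "peak_kernel y < peak_kernel (0 :: real^'d)"
proof -
  obtain j where j: "y $ j \<noteq> 0"
    using assms(2) by (auto simp: vec_eq_iff)
  have "- (1 / 2) \<le> y $ j" "y $ j \<le> 1 / 2"
    using assms(1) by (auto simp: mem_box_cart)
  then have "\<bar>y $ j\<bar> \<le> 1 / 2"
    by linarith
  then have "cos (2 * pi * \<bar>y $ j\<bar>) < cos 0"
    using j by (intro cos_monotone_0_pi) (auto simp: field_simps)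
  then have "cos (2 * pi * y $ j) < 1"
    by (cases "y $ j \<ge> 0") auto
  then have "\<exists>i\<in>UNIV. 1 + cos (2 * pi * y $ i) < 1 + cos (2 * pi * (0 :: real^'d) $ i)"
    by (intro bexI[of _ j]) simp_all
  then show ?thesis
    unfolding peak_kernel_def by (rule sum_strict_mono_ex1[rotated 2]) simp_all
qed

text \<open>Uniqueness of Fourier coefficients in the form needed: only the value at \<open>0\<close> matters.\<close>

lemma zero_of_fourier_coefficients_zero:
  fixes G :: "real^'d \<Rightarrow> complex"
  assumes G: "continuous_on UNIV G"
    and zero: "\<And>k. k \<in> int_lattice \<Longrightarrow>
      (\<integral>y. indicator centred_cube y *\<^sub>R (G y * cis (- (2 * pi * (k \<bullet> y)))) \<partial>lborel) = 0"
  shows "Re (G 0) = 0"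
proof -
  have K: "continuous_on UNIV (peak_kernel :: real^'d \<Rightarrow> real)"
    unfolding peak_kernel_def[abs_def] by (intro continuous_intros)
  have int: "integrable lborel (\<lambda>y. indicator centred_cube y *\<^sub>R (G y * peak_kernel y ^ N * cis (- (2 * pi * (k \<bullet> y)))))" for N k
    by (intro integrable_centred_cube continuous_intros G K)
  have mom: "(\<integral>y. indicator centred_cube y *\<^sub>R (G y * peak_kernel y ^ N * cis (- (2 * pi * (k \<bullet> y)))) \<partial>lborel) = 0"
    if "k \<in> int_lattice" for N k
    using that
  proof (induction N arbitrary: k)
    case 0
    then show ?case using zero by simp
  next
    case (Suc N)
    define I where "I k y = indicator centred_cube y *\<^sub>R (G y * peak_kernel y ^ N * cis (- (2 * pi * (k \<bullet> y))))" for k y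
    let ?a = "\<lambda>j. axis j 1 :: real^'d"
    have a: "?a j \<in> int_lattice" for j
      by (auto simp: int_lattice_def axis_def)
    \<comment> \<open>Multiplication by the kernel replaces the frequency \<open>k\<close> by a
      combination of \<open>k\<close> and its neighbours \<open>k + ?a j\<close>,
      \<open>k - ?a j\<close>; hence the induction on \<open>N\<close> is for all lattice
      frequencies at once.\<close>
    have "peak_kernel y * cis (- (2 * pi * (k \<bullet> y))) =
        (\<Sum>j\<in>UNIV. cis (- (2 * pi * (k \<bullet> y))) + (cis (- (2 * pi * ((k + ?a j) \<bullet> y))) + cis (- (2 * pi * ((k - ?a j) \<bullet> y)))) / 2)" for y :: "real^'d"
    proof -
      have "complex_of_real (1 + cos (2 * pi * y $ j)) * cis (- (2 * pi * (k \<bullet> y))) =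
        cis (- (2 * pi * (k \<bullet> y))) + (cis (- (2 * pi * ((k + ?a j) \<bullet> y))) + cis (- (2 * pi * ((k - ?a j) \<bullet> y)))) / 2" for j
      proof -
        have "cis (- (2 * pi * ((k + ?a j) \<bullet> y))) + cis (- (2 * pi * ((k - ?a j) \<bullet> y))) =
          cis (- (2 * pi * (k \<bullet> y))) * (cis (- (2 * pi * y $ j)) + cis (2 * pi * y $ j))"
          by (simp add: inner_add_left inner_diff_left inner_axis' distrib_left cis_mult algebra_simps)
        also have "cis (- (2 * pi * y $ j)) + cis (2 * pi * y $ j) = 2 * complex_of_real (cos (2 * pi * y $ j))"
          by (simp add: complex_eq_iff)
        finally show ?thesis by (simp add: algebra_simps)
      qed
      then show ?thesis
        by (simp add: peak_kernel_def sum_distrib_right)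
    qed
    then have eq: "indicator centred_cube y *\<^sub>R (G y * peak_kernel y ^ Suc N * cis (- (2 * pi * (k \<bullet> y)))) =
        (\<Sum>j\<in>UNIV. I k y + (I (k + ?a j) y + I (k - ?a j) y) / 2)" for y :: "real^'d"
      unfolding I_def by (simp add: mult.assoc power_Suc2 scaleR_conv_of_real sum_distrib_left distrib_left add_divide_distrib del: power_Suc)
    have int_I: "integrable lborel (I k)" for k
      unfolding I_def[abs_def] by (rule int)
    have "(\<integral>y. I k y \<partial>lborel) = 0" if "k \<in> int_lattice" for k
      unfolding I_def using Suc.IH[OF that] by simp
    then have "(\<integral>y. (\<Sum>j\<in>UNIV. I k y + (I (k + ?a j) y + I (k - ?a j) y) / 2) \<partial>lborel) = 0"
      using Suc.prems a int_I by (simp add: int_lattice_add int_lattice_diff)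
    then show ?case
      unfolding eq .
  qed
  have ReG: "continuous_on UNIV (\<lambda>y. Re (G y))"
    by (intro continuous_intros G)
  have momR: "(\<integral>y. indicator centred_cube y * (Re (G y) * peak_kernel y ^ N) \<partial>lborel) = 0" for N
  proof -
    have "(\<integral>y. indicator centred_cube y * (Re (G y) * peak_kernel y ^ N) \<partial>lborel) =
      (\<integral>y. Re (indicator centred_cube y *\<^sub>R (G y * peak_kernel y ^ N * cis (- (2 * pi * (0 \<bullet> y))))) \<partial>lborel)"
      by (intro Bochner_Integration.integral_cong) (simp_all flip: of_real_power)
    also have "\<dots> = 0"
      using mom[of 0 N] int[of N 0] by (subst integral_Re) (simp_all add: int_lattice_0)
    finally show ?thesis .
  qed
  have K0: "peak_kernel (0 :: real^'d) > 0"
    by (simp add: peak_kernel_def)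
  have "\<not> Re (G 0) > 0"
    by (rule zero_of_peaked_moments[OF ReG K K0 peak_kernel_nonneg peak_kernel_less]) (use momR in auto)
  moreover have "\<not> - Re (G 0) > 0"
    by (rule zero_of_peaked_moments[OF continuous_on_minus[OF ReG] K K0 peak_kernel_nonneg peak_kernel_less]) (use momR in auto)
  ultimately show ?thesis by linarith
qed


lemma nn_integral_lattice_eq_suminf:
  fixes g :: "real^'d \<Rightarrow> real"
  assumes e: "bij_betw e UNIV (int_lattice - {0} :: (real^'d) set)"
    and fin: "(\<integral>\<^sup>+k. ennreal (g k) \<partial>count_space (int_lattice - {0})) < \<infinity>" and nonneg: "\<And>k. g k \<ge> 0"
  shows "summable (\<lambda>n. g (e n))"
    and "(\<integral>\<^sup>+k. ennreal (g k) \<partial>count_space (int_lattice - {0})) = ennreal (\<Sum>n. g (e n))"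
proof -
  have eq: "(\<integral>\<^sup>+k. ennreal (g k) \<partial>count_space (int_lattice - {0})) = (\<Sum>n. ennreal (g (e n)))"
    by (simp add: nn_integral_bij_count_space[OF e, symmetric] nn_integral_count_space_nat)
  show "summable (\<lambda>n. g (e n))"
    using fin unfolding eq by (intro summable_suminf_not_top nonneg) simp
  then show "(\<integral>\<^sup>+k. ennreal (g k) \<partial>count_space (int_lattice - {0})) = ennreal (\<Sum>n. g (e n))"
    unfolding eq by (intro suminf_ennreal2 nonneg)
qed

text \<open>Either the right side is infinite, or the Fourier series of the periodization converges
  uniformly to a continuous function with the same coefficients, and both agree at 0. The frequency
  0 accounts for the subtracted term.\<close>

lemma periodization_at_0:
  fixes T :: "real^'d \<Rightarrow> real"
  assumes T: "continuous_on UNIV T" and M: "finite M" "M \<subseteq> int_lattice"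
    and supp: "\<And>m y. m \<in> int_lattice \<Longrightarrow> y \<in> centred_cube \<Longrightarrow> T (m + y) \<noteq> 0 \<Longrightarrow> m \<in> M"
  shows "ennreal \<bar>(\<Sum>m\<in>M. T m) - Re (fourier T 0)\<bar> \<le>
    (\<integral>\<^sup>+k. ennreal (cmod (fourier T k)) \<partial>count_space (int_lattice - {0}))" (is "_ \<le> ?X")
proof (cases "?X < \<infinity>")
  case True
  define e where "e = from_nat_into (int_lattice - {0} :: (real^'d) set)"
  have e: "bij_betw e UNIV (int_lattice - {0} :: (real^'d) set)"
    unfolding e_def by (intro bij_betw_from_nat_into infinite_int_lattice_minus_0 countable_Diff countable_int_lattice)
  have eL: "e n \<in> int_lattice" "e n \<noteq> 0" for n
    using e by (auto simp: bij_betw_def)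
  define c where "c = fourier T"
  have sumc: "summable (\<lambda>n. cmod (c (e n)))" and X: "?X = ennreal (\<Sum>n. cmod (c (e n)))"
    using nn_integral_lattice_eq_suminf[OF e True] by (simp_all add: c_def)
  define E where "E k y = cis (2 * pi * (k \<bullet> y))" for k y :: "real^'d"
  define A where "A y = (\<Sum>n. c (e n) * E (e n) y)" for y
  have contE: "continuous_on UNIV (E k)" for k
    unfolding E_def[abs_def] by (intro continuous_intros)
  have sumA: "summable (\<lambda>n. cmod (c (e n) * E (e n) y))" for y
    using sumc by (simp add: norm_mult E_def)
  have A: "continuous_on UNIV A"
  proof (rule uniform_limit_theorem)
    show "uniform_limit UNIV (\<lambda>n y. \<Sum>i<n. c (e i) * E (e i) y) A sequentially"
      unfolding A_def[abs_def] by (rule Weierstrass_m_test[OF _ sumc]) (simp add: norm_mult E_def)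
    show "eventually (\<lambda>n. continuous_on UNIV (\<lambda>y. \<Sum>i<n. c (e i) * E (e i) y)) sequentially"
      by (intro always_eventually allI continuous_intros contE)
  qed simp
  \<comment> \<open>Periodization minus Fourier series. With the sum restricted to \<open>M\<close>
    the first term is the full periodization only on the centred cell, which is where the
    coefficients and the value at 0 are taken.\<close>
  define G where "G y = complex_of_real (\<Sum>m\<in>M. T (m + y)) - (c 0 + A y)" for y
  have Tm: "continuous_on UNIV (\<lambda>y. T (m + y))" for m
    by (rule continuous_on_compose2[OF T]) (auto intro!: continuous_intros)
  have "Re (G 0) = 0"
  proof (rule zero_of_fourier_coefficients_zero)
    show "continuous_on UNIV G"
      unfolding G_def[abs_def] by (intro continuous_intros A Tm)
    fix l :: "real^'d" assume l: "l \<in> int_lattice"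
    define F where "F y = cis (- (2 * pi * (l \<bullet> y)))" for y
    have contF: "continuous_on UNIV F"
      unfolding F_def[abs_def] by (intro continuous_intros)
    have EF: "(\<integral>y. indicator centred_cube y *\<^sub>R (E k y * F y) \<partial>lborel) = (if k = l then 1 else 0)" if "k \<in> int_lattice" for k
      using integral_cis_centred_cube[OF int_lattice_diff[OF that l]]
      by (simp add: E_def F_def cis_mult inner_diff_left right_diff_distrib)
    define a where "a n y = indicator centred_cube y *\<^sub>R (c (e n) * E (e n) y * F y)" for n y
    have a: "integrable lborel (a n)" for n
      unfolding a_def[abs_def] by (intro integrable_centred_cube continuous_intros contE contF)
    have norm_a: "norm (a n y) = cmod (c (e n)) * indicator centred_cube y" for n y
      by (simp add: a_def norm_mult E_def F_def)
    have "summable (\<lambda>n. \<integral>y. norm (a n y) \<partial>lborel)"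
      unfolding norm_a using sumc by (simp add: summable_mult2)
    moreover have "summable (\<lambda>n. norm (a n y))" for y
      unfolding norm_a using sumc by (simp add: summable_mult2)
    ultimately have "(\<lambda>n. \<integral>y. a n y \<partial>lborel) sums (\<integral>y. (\<Sum>n. a n y) \<partial>lborel)"
      by (intro sums_integral a) auto
    also have "(\<lambda>n. \<integral>y. a n y \<partial>lborel) = (\<lambda>n. if e n = l then c l else 0)"
    proof
      fix n
      have "(\<integral>y. a n y \<partial>lborel) = (\<integral>y. c (e n) * (indicator centred_cube y *\<^sub>R (E (e n) y * F y)) \<partial>lborel)"
        by (simp add: a_def scaleR_conv_of_real mult_ac)
      also have "\<dots> = c (e n) * (if e n = l then 1 else 0)"
        unfolding integral_mult_right_zero EF[OF eL(1)] ..
      also have "\<dots> = (if e n = l then c l else 0)"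
        by simp
      finally show "(\<integral>y. a n y \<partial>lborel) = (if e n = l then c l else 0)" .
    qed
    also have "(\<lambda>y. \<Sum>n. a n y) = (\<lambda>y. indicator centred_cube y *\<^sub>R (A y * F y))"
    proof
      fix y
      have "(\<Sum>n. a n y) = (\<Sum>n. c (e n) * E (e n) y * (indicator centred_cube y *\<^sub>R F y))"
        by (simp add: a_def)
      also have "\<dots> = A y * (indicator centred_cube y *\<^sub>R F y)"
        unfolding A_def by (rule suminf_mult2[OF summable_norm_cancel[OF sumA[of y]], symmetric])
      finally show "(\<Sum>n. a n y) = indicator centred_cube y *\<^sub>R (A y * F y)"
        by simp
    qed
    finally have sums1: "(\<lambda>n. if e n = l then c l else 0) sums (\<integral>y. indicator centred_cube y *\<^sub>R (A y * F y) \<partial>lborel)" .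
    have IA: "(\<integral>y. indicator centred_cube y *\<^sub>R (A y * F y) \<partial>lborel) = (if l = 0 then 0 else c l)"
    proof (cases "l = 0")
      case True
      then show ?thesis using sums1 eL by (simp add: sums_iff)
    next
      case False
      then have "l \<in> range e"
        using e l by (simp add: bij_betw_def)
      then obtain n where n: "e n = l"
        by auto
      have "e m = l \<longleftrightarrow> m = n" for m
        using n e by (auto simp: bij_betw_def inj_on_def)
      then have "(\<lambda>m. if e m = l then c l else 0) = (\<lambda>m. if m = n then c l else 0)"
        by simp
      then have "(\<lambda>m. if e m = l then c l else 0) sums c l"
        using sums_single[of n "\<lambda>_. c l"] by simp
      then show ?thesis
        using sums_unique2[OF sums1] False by simp
    qed
    have I0: "(\<integral>y. indicator centred_cube y *\<^sub>R (c 0 * F y) \<partial>lborel) = (if l = 0 then c 0 else 0)"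
    proof -
      have "(\<integral>y. indicator centred_cube y *\<^sub>R (c 0 * F y) \<partial>lborel) = (\<integral>y. c 0 * (indicator centred_cube y *\<^sub>R (E 0 y * F y)) \<partial>lborel)"
        by (simp add: E_def scaleR_conv_of_real mult_ac)
      also have "\<dots> = c 0 * (if 0 = l then 1 else 0)"
        unfolding integral_mult_right_zero EF[OF int_lattice_0] ..
      finally show ?thesis by auto
    qed
    have IF: "(\<integral>y. indicator centred_cube y *\<^sub>R (complex_of_real (\<Sum>m\<in>M. T (m + y)) * F y) \<partial>lborel) = c l"
      unfolding F_def c_def by (rule unfold_fourier_coefficient[OF T M supp l])
    have "(\<integral>y. indicator centred_cube y *\<^sub>R (G y * F y) \<partial>lborel) =
      (\<integral>y. indicator centred_cube y *\<^sub>R (complex_of_real (\<Sum>m\<in>M. T (m + y)) * F y)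
         - (indicator centred_cube y *\<^sub>R (c 0 * F y) + indicator centred_cube y *\<^sub>R (A y * F y)) \<partial>lborel)"
      by (intro Bochner_Integration.integral_cong) (simp_all add: G_def algebra_simps)
    also have "\<dots> = c l - ((if l = 0 then c 0 else 0) + (if l = 0 then 0 else c l))"
    proof -
      have i: "integrable lborel (\<lambda>y. indicator centred_cube y *\<^sub>R (complex_of_real (\<Sum>m\<in>M. T (m + y)) * F y))"
        "integrable lborel (\<lambda>y. indicator centred_cube y *\<^sub>R (c 0 * F y))"
        "integrable lborel (\<lambda>y. indicator centred_cube y *\<^sub>R (A y * F y))"
        by (intro integrable_centred_cube continuous_intros A Tm contF)+
      show ?thesis
        by (simp only: Bochner_Integration.integral_diff[OF i(1) Bochner_Integration.integrable_add[OF i(2,3)]]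
            Bochner_Integration.integral_add[OF i(2,3)] IF I0 IA)
    qed
    finally show "(\<integral>y. indicator centred_cube y *\<^sub>R (G y * cis (- (2 * pi * (l \<bullet> y)))) \<partial>lborel) = 0"
      by (simp add: F_def)
  qed
  then have "(\<Sum>m\<in>M. T m) - Re (c 0) = Re (A 0)"
    by (simp add: G_def)
  also have "\<bar>\<dots>\<bar> \<le> cmod (A 0)"
    by (rule abs_Re_le_cmod)
  also have "\<dots> \<le> (\<Sum>n. cmod (c (e n)))"
    using summable_norm[OF sumA[of 0]] by (simp add: A_def norm_mult E_def)
  finally show ?thesis
    unfolding X by (simp add: c_def[symmetric] ennreal_leI)
qed (simp add: not_less top_unique)

section \<open>From the integer lattice to the lattice of the quadrature rule\<close>

lemma matrix_inv_mult:
  fixes S :: "real^'d^'d"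
  assumes "invertible S"
  shows "S ** matrix_inv S = mat 1" "matrix_inv S ** S = mat 1"
proof -
  have "\<exists>A. S ** A = mat 1 \<and> A ** S = mat 1"
    using assms by (simp add: invertible_def)
  from someI_ex[OF this] show "S ** matrix_inv S = mat 1" "matrix_inv S ** S = mat 1"
    by (simp_all add: matrix_inv_def)
qed

lemma transpose_matrix_inv_mult:
  fixes S :: "real^'d^'d"
  assumes "invertible S"
  shows "transpose S *v (transpose (matrix_inv S) *v y) = y"
    and "transpose (matrix_inv S) *v (transpose S *v y) = y"
proof -
  have "transpose S ** transpose (matrix_inv S) = mat 1" "transpose (matrix_inv S) ** transpose S = mat 1"
    using matrix_inv_mult[OF assms] by (metis matrix_transpose_mul transpose_mat)+
  then show "transpose S *v (transpose (matrix_inv S) *v y) = y"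
    "transpose (matrix_inv S) *v (transpose S *v y) = y"
    by (simp_all only: matrix_vector_mul_assoc matrix_vector_mul_lid)
qed

text \<open>Such an \<open>m\<close> lies in the image of the compact set
  \<open>unit_cube \<times> ?C\<close> under a continuous map. The offset \<open>y\<close> is needed
  because the periodization is used on the whole cell, not only at 0.\<close>

lemma lattice_sum_finite_support:
  fixes S :: "real^'d^'d"
  assumes "invertible S"
  shows "finite {m \<in> int_lattice. \<exists>y\<in>centred_cube. transpose (matrix_inv S) *v (v + (m + y)) \<in> unit_cube}"
proof -
  let ?C = "cbox (\<chi> j. -(1/2)) ((\<chi> j. 1/2) :: real^'d)"
  let ?A = "(\<lambda>(x, y). transpose S *v x - v - y) ` (unit_cube \<times> ?C)"
  have "continuous_on (unit_cube \<times> ?C) (\<lambda>(x, y). transpose S *v x - v - y)"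
    unfolding case_prod_beta
    by (intro continuous_intros linear_continuous_on_compose[OF _ matrix_vector_mul_linear] continuous_on_fst continuous_on_snd continuous_on_id)
  then have "bounded ?A"
    by (intro compact_imp_bounded compact_continuous_image compact_Times) (auto simp: unit_cube_def)
  then have "finite (int_lattice \<inter> ?A)"
    by (rule finite_int_lattice_bounded)
  moreover have "{m \<in> int_lattice. \<exists>y\<in>centred_cube. transpose (matrix_inv S) *v (v + (m + y)) \<in> unit_cube} \<subseteq> int_lattice \<inter> ?A"
  proof safe
    fix m y :: "real^'d" assume y: "y \<in> centred_cube" "transpose (matrix_inv S) *v (v + (m + y)) \<in> unit_cube"
    have "m = transpose S *v (transpose (matrix_inv S) *v (v + (m + y))) - v - y"
      unfolding transpose_matrix_inv_mult[OF assms] by simp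
    then show "m \<in> ?A"
      using y centred_cube_subset by (intro image_eqI[of _ _ "(transpose (matrix_inv S) *v (v + (m + y)), y)"]) auto
  qed
  ultimately show ?thesis
    by (rule finite_subset[rotated])
qed

text \<open>The quadrature sum is |det S|^(-1) times the periodization at 0 of \<open>T\<close>,
  that is, of f after an affine change of variables. The transform of \<open>T\<close> at k is |det
  S| times a phase times that of f at S k; only the phase depends on \<open>v\<close>.\<close>

lemma quadrature_error_le_fourier:
  fixes S :: "real^'d^'d" and f :: "real^'d \<Rightarrow> real"
  assumes S: "invertible S" and f: "continuous_on UNIV f" and supp: "\<And>y. y \<notin> unit_cube \<Longrightarrow> f y = 0"
  shows "ennreal \<bar>quadrature S v f - (\<integral>x. f x \<partial>lborel)\<bar> \<le>
    (\<integral>\<^sup>+k. ennreal (cmod (fourier f (S *v k))) \<partial>count_space (int_lattice - {0}))"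
proof -
  define R where "R = transpose (matrix_inv S)"
  define T where "T y = f (R *v (v + y))" for y
  define M where "M = {m \<in> int_lattice. \<exists>y\<in>centred_cube. R *v (v + (m + y)) \<in> unit_cube}"
  have finM: "finite M"
    unfolding M_def R_def by (rule lattice_sum_finite_support[OF S])
  have T: "continuous_on UNIV T"
    unfolding T_def[abs_def]
    by (intro continuous_on_compose2[OF f] linear_continuous_on_compose[OF _ matrix_vector_mul_linear] continuous_intros) auto
  have [measurable]: "f \<in> borel_measurable borel"
    using f by (rule borel_measurable_continuous_onI)
  have suppT: "m \<in> M" if "m \<in> int_lattice" "y \<in> centred_cube" "T (m + y) \<noteq> 0" for m y
    using that supp by (auto simp: M_def T_def)
  have invR: "invertible R"
    unfolding R_def using matrix_inv_mult[OF S] by (intro transpose_invertible) (auto simp: invertible_def)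
  have "det S * det R = 1"
    using matrix_inv_mult(1)[OF S] unfolding R_def by (metis det_I det_mul det_transpose)
  then have detR: "\<bar>det S\<bar> * \<bar>det R\<bar> = 1"
    by (simp flip: abs_mult)
  have four: "fourier T k = complex_of_real \<bar>det S\<bar> * cis (2 * pi * (k \<bullet> v)) * fourier f (S *v k)" for k
  proof -
    define H where "H x = f x *\<^sub>R cis (- (2 * pi * (k \<bullet> (transpose S *v x - v))))" for x
    have [measurable]: "H \<in> borel_measurable borel"
      unfolding H_def[abs_def] by (intro borel_measurable_scaleR borel_measurable_continuous_onI continuous_intros linear_continuous_on_compose[OF _ matrix_vector_mul_linear] f)
    have "fourier T k = (\<integral>y. H (R *v (v + y)) \<partial>lborel)"
      unfolding fourier_def T_def H_def R_def transpose_matrix_inv_mult[OF S] by simp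
    also have "\<dots> = (\<integral>y. H (R *v y) \<partial>lborel)"
      using integral_lborel_translate[of "\<lambda>y. H (R *v y)" v] by simp
    also have "\<dots> = \<bar>det S\<bar> *\<^sub>R (\<integral>x. H x \<partial>lborel)"
      by (subst integral_lborel_linear[OF invR, of H]) (simp_all add: detR)
    also have "(\<integral>x. H x \<partial>lborel) = (\<integral>x. cis (2 * pi * (k \<bullet> v)) * (f x *\<^sub>R cis (- (2 * pi * ((S *v k) \<bullet> x)))) \<partial>lborel)"
    proof (rule Bochner_Integration.integral_cong)
      fix x
      have "k \<bullet> (transpose S *v x) = (S *v k) \<bullet> x"
        by (metis dot_lmul_matrix inner_commute transpose_matrix_vector)
      then show "H x = cis (2 * pi * (k \<bullet> v)) * (f x *\<^sub>R cis (- (2 * pi * ((S *v k) \<bullet> x))))"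
        by (simp add: H_def inner_diff_right cis_mult right_diff_distrib)
    qed simp
    finally show ?thesis
      by (simp add: fourier_def scaleR_conv_of_real)
  qed
  have "(\<Sum>\<^sub>\<infinity>m\<in>int_lattice. f (R *v (m + v))) = (\<Sum>\<^sub>\<infinity>m\<in>M. T m)"
  proof (rule infsum_cong_neutral)
    fix m assume "m \<in> int_lattice - M"
    then show "f (R *v (m + v)) = 0"
      using suppT[of m 0] by (auto simp: T_def centred_cube_def add.commute)
  qed (auto simp: M_def T_def add.commute)
  then have Q: "quadrature S v f = (\<Sum>m\<in>M. T m) / \<bar>det S\<bar>"
    by (simp add: quadrature_def finM flip: R_def)
  have detS: "\<bar>det S\<bar> > 0"
    using S by (simp add: invertible_det_nz)
  have "fourier f 0 = complex_of_real (\<integral>x. f x \<partial>lborel)"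
    by (simp add: fourier_def scaleR_conv_of_real)
  then have "Re (fourier T 0) = \<bar>det S\<bar> * (\<integral>x. f x \<partial>lborel)"
    by (simp add: four)
  then have "\<bar>det S\<bar> * \<bar>quadrature S v f - (\<integral>x. f x \<partial>lborel)\<bar> = \<bar>(\<Sum>m\<in>M. T m) - Re (fourier T 0)\<bar>"
    using detS by (simp add: Q field_simps flip: abs_mult)
  then have "ennreal \<bar>det S\<bar> * ennreal \<bar>quadrature S v f - (\<integral>x. f x \<partial>lborel)\<bar> = ennreal \<bar>(\<Sum>m\<in>M. T m) - Re (fourier T 0)\<bar>"
    by (simp flip: ennreal_mult)
  also have "\<dots> \<le> (\<integral>\<^sup>+k. ennreal (cmod (fourier T k)) \<partial>count_space (int_lattice - {0}))"
    by (rule periodization_at_0[OF T finM]) (use suppT in \<open>auto simp: M_def\<close>)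
  also have "\<dots> = ennreal \<bar>det S\<bar> * (\<integral>\<^sup>+k. ennreal (cmod (fourier f (S *v k))) \<partial>count_space (int_lattice - {0}))"
    by (simp add: four norm_mult ennreal_mult nn_integral_cmult)
  finally show ?thesis
    using detS by (simp add: ennreal_mult_le_mult_iff)
qed


section \<open>The hyperbolic tail\<close>

lemma nn_integral_powr_tail:
  fixes a \<delta> :: real
  assumes "a > 0" "\<delta> > 0"
  shows "(\<integral>\<^sup>+t. ennreal (t powr (- 1 - \<delta>)) * indicator {a..} t \<partial>lborel) = ennreal (a powr (- \<delta>) / \<delta>)"
proof -
  have "(\<integral>\<^sup>+t. ennreal (t powr (- 1 - \<delta>)) * indicator {a..} t \<partial>lborel) = ennreal (0 - (- (a powr (- \<delta>)) / \<delta>))"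
  proof (rule nn_integral_FTC_atLeast)
    fix t assume "a \<le> t"
    then have "((\<lambda>t. - (t powr (- \<delta>)) / \<delta>) has_real_derivative t powr (- \<delta> - 1)) (at t)"
      using assms by (auto intro!: derivative_eq_intros)
    moreover have "- \<delta> - 1 = - 1 - \<delta>" by simp
    ultimately show "((\<lambda>t. - (t powr (- \<delta>)) / \<delta>) has_real_derivative t powr (- 1 - \<delta>)) (at t)"
      by metis
  next
    have "((\<lambda>t :: real. - (t powr (- \<delta>)) / \<delta>) \<longlongrightarrow> - 0 / \<delta>) at_top"
      using assms by (intro tendsto_intros tendsto_neg_powr filterlim_ident) auto
    then show "((\<lambda>t :: real. - (t powr (- \<delta>)) / \<delta>) \<longlongrightarrow> 0) at_top"
      by simp
  qed auto
  then show ?thesis by simp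
qed

lemma nn_integral_abs_powr_tail:
  fixes a \<delta> :: real
  assumes "a > 0" "\<delta> > 0"
  shows "(\<integral>\<^sup>+t. ennreal (\<bar>t\<bar> powr (- 1 - \<delta>)) * indicator {t. a \<le> \<bar>t\<bar>} t \<partial>lborel) = ennreal (2 * a powr (- \<delta>) / \<delta>)"
proof -
  let ?h = "\<lambda>t. ennreal (t powr (- 1 - \<delta>)) * indicator {a..} t"
  have "(\<integral>\<^sup>+t. ennreal (\<bar>t\<bar> powr (- 1 - \<delta>)) * indicator {t. a \<le> \<bar>t\<bar>} t \<partial>lborel) = (\<integral>\<^sup>+t. ?h t + ?h (- t) \<partial>lborel)"
    using assms by (intro nn_integral_cong) (auto simp: indicator_def abs_if)
  also have "\<dots> = (\<integral>\<^sup>+t. ?h t \<partial>lborel) + (\<integral>\<^sup>+t. ?h (- t) \<partial>lborel)"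
    by (rule nn_integral_add) auto
  also have "(\<integral>\<^sup>+t. ?h (- t) \<partial>lborel) = (\<integral>\<^sup>+t. ?h t \<partial>lborel)"
    using nn_integral_real_affine[of ?h "-1" 0] by simp
  finally show ?thesis
    unfolding nn_integral_powr_tail[OF assms] using assms by (simp flip: ennreal_plus)
qed

text \<open>Reciprocal of the weight which the mixed norm puts on one frequency coordinate:
  derivatives of order r are used where |t| \<ge> 1 and of order 0 where |t| < 1.\<close>

definition decay_weight :: "nat \<Rightarrow> real \<Rightarrow> real"
  where "decay_weight r t = 1 / (max 1 \<bar>t\<bar>) ^ (2 * r)"

lemma decay_weight_measurable [measurable]: "decay_weight r \<in> borel_measurable borel"
  unfolding decay_weight_def[abs_def] by measurable

lemma decay_weight_pos: "decay_weight r t > 0" and decay_weight_le_1: "decay_weight r t \<le> 1"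
  by (auto simp: decay_weight_def intro!: zero_less_power one_le_power)

lemma decay_weight_powr:
  assumes "\<bar>t\<bar> \<ge> 1"
  shows "decay_weight r t = \<bar>t\<bar> powr (- real (2 * r))"
  using assms by (simp add: decay_weight_def max_def powr_minus_divide flip: powr_realpow)

text \<open>The moments stay below the critical exponent \<open>2 r - 1\<close>; \<open>\<delta>\<close> is the distance to it.\<close>

lemma decay_weight_moment:
  assumes "\<delta> > 0" "\<delta> \<le> real (2 * r) - 1"
  shows "(\<integral>\<^sup>+t. ennreal (\<bar>t\<bar> powr (real (2 * r) - 1 - \<delta>) * decay_weight r t) \<partial>lborel) \<le> ennreal (2 + 2 / \<delta>)"
proof -
  have "(\<integral>\<^sup>+t. ennreal (\<bar>t\<bar> powr (real (2 * r) - 1 - \<delta>) * decay_weight r t) \<partial>lborel) \<le>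
    (\<integral>\<^sup>+t. indicator {-1..1} t + ennreal (\<bar>t\<bar> powr (- 1 - \<delta>)) * indicator {t. 1 \<le> \<bar>t\<bar>} t \<partial>lborel)"
  proof (rule nn_integral_mono)
    fix t :: real
    show "ennreal (\<bar>t\<bar> powr (real (2 * r) - 1 - \<delta>) * decay_weight r t) \<le>
        indicator {-1..1} t + ennreal (\<bar>t\<bar> powr (- 1 - \<delta>)) * indicator {t. 1 \<le> \<bar>t\<bar>} t"
    proof (cases "1 \<le> \<bar>t\<bar>")
      case True
      then have "\<bar>t\<bar> powr (real (2 * r) - 1 - \<delta>) * decay_weight r t = \<bar>t\<bar> powr (- 1 - \<delta>)"
        by (simp add: decay_weight_powr flip: powr_add)
      then show ?thesis
        using True by (simp add: add_increasing)
    next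
      case False
      have "\<bar>t\<bar> powr (real (2 * r) - 1 - \<delta>) \<le> 1"
        using False assms by (intro powr_le1) auto
      then have "\<bar>t\<bar> powr (real (2 * r) - 1 - \<delta>) * decay_weight r t \<le> 1"
        using decay_weight_le_1[of r t] decay_weight_pos[of r t] by (intro mult_le_one) auto
      then show ?thesis
        using False by (auto simp: indicator_def)
    qed
  qed
  \<comment> \<open>The 2 in the bound is the length of [-1, 1], and 2 / \<delta> collects the two
    tails.\<close>
  also have "\<dots> = emeasure lborel {-1..1 :: real} + ennreal (2 / \<delta>)"
    using nn_integral_abs_powr_tail[of 1 \<delta>] assms
    by (subst nn_integral_add) auto
  also have "\<dots> = ennreal (2 + 2 / \<delta>)"
    using assms ennreal_plus[of 2 "2 / \<delta>"] by simp
  finally show ?thesis .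
qed

text \<open>For a \<ge> 1 the exact decay exponent 2r - 1 is at least \<open>s\<close>; for a < 1
  the whole integral is at most 4 \<le> 4 a^(-s). The exponent is left free to match that of the
  remaining coordinates.\<close>

lemma decay_weight_tail:
  fixes a s :: real
  assumes "r \<ge> 1" "a > 0" "0 \<le> s" "s \<le> real (2 * r) - 1"
  shows "(\<integral>\<^sup>+t. ennreal (decay_weight r t) * indicator {t. a \<le> \<bar>t\<bar>} t \<partial>lborel) \<le> ennreal (4 * a powr (- s))"
proof -
  define \<delta> where "\<delta> = real (2 * r) - 1"
  have \<delta>: "\<delta> \<ge> 1" using assms by (simp add: \<delta>_def)
  show ?thesis
  proof (cases "a \<ge> 1")
    case True
    have "(\<integral>\<^sup>+t. ennreal (decay_weight r t) * indicator {t. a \<le> \<bar>t\<bar>} t \<partial>lborel) =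
        (\<integral>\<^sup>+t. ennreal (\<bar>t\<bar> powr (- 1 - \<delta>)) * indicator {t. a \<le> \<bar>t\<bar>} t \<partial>lborel)"
      using True by (intro nn_integral_cong) (auto simp: indicator_def decay_weight_powr \<delta>_def algebra_simps)
    also have "\<dots> = ennreal (2 * a powr (- \<delta>) / \<delta>)"
      using assms \<delta> by (intro nn_integral_abs_powr_tail) auto
    also have "\<dots> \<le> ennreal (4 * a powr (- s))"
    proof (rule ennreal_leI)
      have "2 * a powr (- \<delta>) / \<delta> \<le> 2 * a powr (- \<delta>) / 1"
        using \<delta> by (intro divide_left_mono) auto
      also have "\<dots> \<le> 4 * a powr (- s)"
      proof -
        have "a powr (- \<delta>) \<le> a powr (- s)"
          using True assms by (intro powr_mono) (auto simp: \<delta>_def)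
        moreover have "0 \<le> a powr (- s)" by simp
        ultimately show ?thesis by linarith
      qed
      finally show "2 * a powr (- \<delta>) / \<delta> \<le> 4 * a powr (- s)" .
    qed
    finally show ?thesis .
  next
    case False
    have "(\<integral>\<^sup>+t. ennreal (decay_weight r t) * indicator {t. a \<le> \<bar>t\<bar>} t \<partial>lborel) \<le>
      (\<integral>\<^sup>+t. indicator {-1..1} t + ennreal (\<bar>t\<bar> powr (- 1 - \<delta>)) * indicator {t. 1 \<le> \<bar>t\<bar>} t \<partial>lborel)"
    proof (rule nn_integral_mono)
      fix t :: real
      show "ennreal (decay_weight r t) * indicator {t. a \<le> \<bar>t\<bar>} t \<le>
        indicator {-1..1} t + ennreal (\<bar>t\<bar> powr (- 1 - \<delta>)) * indicator {t. 1 \<le> \<bar>t\<bar>} t"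
      proof (cases "1 \<le> \<bar>t\<bar>")
        case True
        then have "ennreal (decay_weight r t) = ennreal (\<bar>t\<bar> powr (- 1 - \<delta>))"
          by (simp add: decay_weight_powr \<delta>_def algebra_simps)
        then show ?thesis
          using True by (auto simp: indicator_def add_increasing)
      next
        case False
        then show ?thesis
          using decay_weight_le_1[of r t] by (auto simp: indicator_def)
      qed
    qed
    also have "\<dots> = emeasure lborel {-1..1 :: real} + ennreal (2 / \<delta>)"
      using nn_integral_abs_powr_tail[of 1 \<delta>] \<delta>
      by (subst nn_integral_add) auto
    also have "\<dots> = ennreal (2 + 2 / \<delta>)"
      using \<delta> ennreal_plus[of 2 "2 / \<delta>"] by simp
    also have "\<dots> \<le> ennreal (4 * a powr (- s))"
    proof (rule ennreal_leI)
      have "2 / \<delta> \<le> 2 / 1" using \<delta> by (intro divide_left_mono) auto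
      moreover have "1 \<le> a powr (- s)"
        using False assms powr_le1[of s a] by (simp add: powr_minus one_le_inverse)
      ultimately show "2 + 2 / \<delta> \<le> 4 * a powr (- s)" by simp
    qed
    finally show ?thesis .
  qed
qed

text \<open>One coordinate is integrated exactly, which saves one logarithm. On the others the indicator
  is bounded by the power \<open>s\<close> of the product (Rankin's trick).\<close>

lemma hyperbolic_tail_rankin:
  fixes T \<delta> :: real
  assumes r: "r \<ge> 1" and T: "T > 0" and \<delta>: "\<delta> > 0" "\<delta> \<le> real (2 * r) - 1"
  shows "(\<integral>\<^sup>+x. ennreal (\<Prod>j\<in>UNIV. decay_weight r (x $ j)) * indicator {x. T \<le> (\<Prod>j\<in>UNIV. \<bar>x $ j\<bar>)} x \<partial>(lborel :: (real^'d) measure))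
    \<le> ennreal (4 * T powr (\<delta> + 1 - real (2 * r)) * (2 + 2 / \<delta>) ^ (CARD('d) - 1))"
proof -
  interpret product_sigma_finite "\<lambda>_::'d. lborel :: real measure"
    by standard
  obtain i :: 'd where True by simp
  define I where "I = UNIV - {i}"
  have I: "finite I" "i \<notin> I" "insert i I = UNIV" "card I = CARD('d) - 1"
    by (auto simp: I_def)
  \<comment> \<open>Short of the critical exponent by \<delta>, so that each of the other d - 1
    coordinates has a finite moment, at most 2 + 2 / \<delta>.\<close>
  define s where "s = real (2 * r) - 1 - \<delta>"
  have s: "0 \<le> s" "s \<le> real (2 * r) - 1" using \<delta> by (auto simp: s_def)
  let ?P = "\<Pi>\<^sub>M j\<in>(UNIV::'d set). (lborel :: real measure)"
  have meas [measurable]: "vec_lambda \<in> ?P \<rightarrow>\<^sub>M (borel :: (real^'d) measure)"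
    using borel_measurable_vec_lambda[of "\<lambda>g. g" ?P] by simp
  define F :: "real^'d \<Rightarrow> ennreal" where
    "F x = ennreal (\<Prod>j\<in>UNIV. decay_weight r (x $ j)) * indicator {x. T \<le> (\<Prod>j\<in>UNIV. \<bar>x $ j\<bar>)} x" for x
  have [measurable]: "F \<in> borel_measurable borel"
    unfolding F_def[abs_def] by measurable
  have "(\<integral>\<^sup>+x. F x \<partial>lborel) = (\<integral>\<^sup>+g. (\<integral>\<^sup>+t. F (vec_lambda (g(i := t))) \<partial>lborel) \<partial>(\<Pi>\<^sub>M j\<in>I. lborel))"
    unfolding lborel_vec_eq_PiM
    using product_nn_integral_insert[of I i "\<lambda>g. F (vec_lambda g)"] I
    by (subst nn_integral_distr) simp_all
  also have "\<dots> \<le> (\<integral>\<^sup>+g. ennreal (4 * T powr (- s)) * (\<Prod>j\<in>I. ennreal (\<bar>g j\<bar> powr s * decay_weight r (g j))) \<partial>(\<Pi>\<^sub>M j\<in>I. lborel))"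
  proof (rule nn_integral_mono)
    fix g :: "'d \<Rightarrow> real"
    define p where "p = (\<Prod>j\<in>I. \<bar>g j\<bar>)"
    define D where "D = (\<Prod>j\<in>I. decay_weight r (g j))"
    have D: "D \<ge> 0"
      unfolding D_def by (intro prod_nonneg) (auto intro: less_imp_le decay_weight_pos)
    have split: "(\<Prod>j\<in>UNIV. h ((g(i := t)) j)) = h t * (\<Prod>j\<in>I. h (g j))" for h :: "real \<Rightarrow> real" and t
      unfolding I(3)[symmetric] using I(1,2) by (subst prod.insert) (auto intro!: prod.cong)
    have F: "F (vec_lambda (g(i := t))) = ennreal D * (ennreal (decay_weight r t) * indicator {t. T \<le> \<bar>t\<bar> * p} t)" for t
    proof -
      have "(\<Prod>j\<in>UNIV. decay_weight r (vec_lambda (g(i := t)) $ j)) = decay_weight r t * D"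
        unfolding D_def using split[of "decay_weight r" t] by simp
      moreover have "(\<Prod>j\<in>UNIV. \<bar>vec_lambda (g(i := t)) $ j\<bar>) = \<bar>t\<bar> * p"
        unfolding p_def using split[of abs t] by simp
      ultimately show ?thesis
        using D decay_weight_pos[of r t] by (simp add: F_def indicator_def ennreal_mult mult.commute)
    qed
    have pD: "(\<Prod>j\<in>I. ennreal (\<bar>g j\<bar> powr s * decay_weight r (g j))) = ennreal (p powr s * D)"
      unfolding p_def D_def
      by (subst prod_ennreal) (auto simp: prod.distrib prod_powr_distrib decay_weight_pos[THEN less_imp_le])
    show "(\<integral>\<^sup>+t. F (vec_lambda (g(i := t))) \<partial>lborel) \<le>
        ennreal (4 * T powr (- s)) * (\<Prod>j\<in>I. ennreal (\<bar>g j\<bar> powr s * decay_weight r (g j)))"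
    proof (cases "p = 0")
      case True
      then show ?thesis using T by (simp add: F)
    next
      case False
      then have p: "p > 0"
        unfolding p_def by (simp add: prod_nonneg less_le)
      \<comment> \<open>With the other coordinates fixed, the hyperbolic condition reads |t| \<ge> T
        / p. The tail bound then yields p^s, which factors over these coordinates.\<close>
      have "(\<integral>\<^sup>+t. F (vec_lambda (g(i := t))) \<partial>lborel) =
          ennreal D * (\<integral>\<^sup>+t. ennreal (decay_weight r t) * indicator {t. T / p \<le> \<bar>t\<bar>} t \<partial>lborel)"
        unfolding F using p by (subst nn_integral_cmult) (auto simp: divide_le_eq)
      also have "\<dots> \<le> ennreal D * ennreal (4 * (T / p) powr (- s))"
        using r T p s by (intro mult_left_mono decay_weight_tail) auto
      also have "\<dots> = ennreal (4 * T powr (- s)) * ennreal (p powr s * D)"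
        using D T p by (simp add: powr_divide powr_minus_divide field_simps flip: ennreal_mult)
      finally show ?thesis
        unfolding pD .
    qed
  qed
  also have "\<dots> = ennreal (4 * T powr (- s)) * (\<Prod>j\<in>I. \<integral>\<^sup>+t. ennreal (\<bar>t\<bar> powr s * decay_weight r t) \<partial>lborel)"
    using I(1) product_nn_integral_prod[of I "\<lambda>_ t. ennreal (\<bar>t\<bar> powr s * decay_weight r t)"]
    by (subst nn_integral_cmult) simp_all
  also have "\<dots> \<le> ennreal (4 * T powr (- s)) * (\<Prod>j\<in>I. ennreal (2 + 2 / \<delta>))"
    unfolding s_def using \<delta> by (intro mult_left_mono prod_mono_ennreal decay_weight_moment) auto
  also have "\<dots> = ennreal (4 * T powr (\<delta> + 1 - real (2 * r)) * (2 + 2 / \<delta>) ^ (CARD('d) - 1))"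
  proof -
    have "(\<Prod>j\<in>I. ennreal (2 + 2 / \<delta>)) = ennreal ((2 + 2 / \<delta>) ^ (CARD('d) - 1))"
      unfolding prod_constant I(4) using \<delta> by (intro ennreal_power) auto
    moreover have "- s = \<delta> + 1 - real (2 * r)"
      by (simp add: s_def)
    ultimately show ?thesis
      using \<delta> by (simp only:) (intro ennreal_mult[symmetric], auto)
  qed
  finally show ?thesis
    by (simp add: F_def)
qed

text \<open>The choice \<delta> = 1 / (2 ln T) keeps the loss T^\<delta> = e^(1/2) below 2 and gives
  2 + 2 / \<delta> \<le> 8 ln T, since ln T \<ge> 1/2. The constant is 4 * 2 * 8^(d-1) =
  8^d.\<close>

lemma hyperbolic_tail:
  fixes T :: real
  assumes r: "r \<ge> 1" and T: "T \<ge> 2"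
  shows "(\<integral>\<^sup>+x. ennreal (\<Prod>j\<in>UNIV. decay_weight r (x $ j)) * indicator {x. T \<le> (\<Prod>j\<in>UNIV. \<bar>x $ j\<bar>)} x \<partial>(lborel :: (real^'d) measure))
    \<le> ennreal (8 ^ CARD('d) * T powr (1 - 2 * real r) * ln T ^ (CARD('d) - 1))"
proof -
  have "ln T \<ge> 1 / 2"
  proof -
    have "exp (1 / 2) \<le> T"
      using T exp_half_le2 by linarith
    then show ?thesis
      using T by (subst ln_ge_iff) auto
  qed
  define \<delta> where "\<delta> = 1 / (2 * ln T)"
  have \<delta>: "\<delta> > 0" "\<delta> \<le> 1" "2 / \<delta> = 4 * ln T"
    using \<open>ln T \<ge> 1 / 2\<close> by (auto simp: \<delta>_def)
  have "\<delta> \<le> real (2 * r) - 1" using \<delta> r by simp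
  have "T powr \<delta> = exp (1 / 2)"
    using T \<open>ln T \<ge> 1 / 2\<close> by (simp add: powr_def \<delta>_def)
  have "4 * T powr (\<delta> + 1 - real (2 * r)) * (2 + 2 / \<delta>) ^ (CARD('d) - 1)
      = 4 * (T powr \<delta> * T powr (1 - 2 * real r)) * (2 + 2 / \<delta>) ^ (CARD('d) - 1)"
    unfolding powr_add[symmetric] by (simp add: algebra_simps)
  also have "\<dots> \<le> 4 * (2 * T powr (1 - 2 * real r)) * (8 * ln T) ^ (CARD('d) - 1)"
    unfolding \<open>T powr \<delta> = exp (1 / 2)\<close>
    using \<delta> \<open>ln T \<ge> 1 / 2\<close> by (intro mult_mono power_mono exp_half_le2) auto
  also have "\<dots> = 8 ^ Suc (CARD('d) - 1) * T powr (1 - 2 * real r) * ln T ^ (CARD('d) - 1)"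
    unfolding power_mult_distrib power_Suc by simp
  also have "Suc (CARD('d) - 1) = CARD('d)"
    by simp
  finally show ?thesis
    using T by (intro order_trans[OF hyperbolic_tail_rankin[OF r _ \<open>\<delta> > 0\<close> \<open>\<delta> \<le> real (2 * r) - 1\<close>]] ennreal_leI) auto
qed


section \<open>Fourier transforms of functions of mixed smoothness\<close>

lemma Hmix0_D:
  assumes "f \<in> Hmix0 r"
  shows "continuous_on UNIV f" "\<And>y. y \<notin> unit_cube \<Longrightarrow> f y = 0"
    "(\<And>j. \<alpha> j \<le> r) \<Longrightarrow> has_weak_deriv f \<alpha> (weak_deriv \<alpha> f)"
proof -
  show "continuous_on UNIV f"
    using assms by (simp add: Hmix0_def Hmix_def)
  have "closure {y. f y \<noteq> 0} \<subseteq> unit_cube"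
    using assms by (simp add: Hmix0_def)
  then have "{y. f y \<noteq> 0} \<subseteq> unit_cube"
    using closure_subset by (rule order_trans[rotated])
  then show "f y = 0" if "y \<notin> unit_cube" for y
    using that by auto
  show "has_weak_deriv f \<alpha> (weak_deriv \<alpha> f)" if "\<And>j. \<alpha> j \<le> r"
  proof -
    have "\<exists>g. has_weak_deriv f \<alpha> g"
      using assms that by (simp add: Hmix0_def Hmix_def)
    then show ?thesis
      unfolding weak_deriv_def by (rule someI_ex)
  qed
qed

lemma finite_multiindices: "finite {\<alpha> :: 'd::finite \<Rightarrow> nat. \<forall>j. \<alpha> j \<le> r}"
proof -
  have "{\<alpha> :: 'd \<Rightarrow> nat. \<forall>j. \<alpha> j \<le> r} = (\<Pi>\<^sub>E j\<in>UNIV. {..r})"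
    by (auto simp: PiE_def Pi_def)
  then show ?thesis
    by (simp add: finite_PiE)
qed

lemma prod_decay_weight_pos: "(\<Prod>j\<in>A. decay_weight r (x j)) > 0"
  by (intro prod_pos decay_weight_pos)

text \<open>At each frequency a single mixed derivative already dominates the weight: order r in the
  coordinates with |x_j| \<ge> 1, order 0 in the others. Summing over all multi-indices makes the
  bound independent of this choice.\<close>

lemma weighted_plancherel:
  fixes f :: "real^'d \<Rightarrow> real"
  assumes f: "f \<in> Hmix0 r"
  shows "(\<integral>\<^sup>+x. ennreal ((cmod (fourier f x))\<^sup>2 / (\<Prod>j\<in>UNIV. decay_weight r (x $ j))) \<partial>lborel)
    \<le> ennreal ((Hmix_norm r f)\<^sup>2)"
proof -
  let ?A = "{\<alpha> :: 'd \<Rightarrow> nat. \<forall>j. \<alpha> j \<le> r}"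
  define g where "g \<alpha> y = indicator unit_cube y * weak_deriv \<alpha> f y" for \<alpha> y
  note fD = Hmix0_D[OF f]
  have sq: "square_integrable (weak_deriv \<alpha> f)" if "\<alpha> \<in> ?A" for \<alpha>
    using fD(3)[of \<alpha>] that by (auto simp: has_weak_deriv_def)
  have gm: "g \<alpha> \<in> borel_measurable borel" if "\<alpha> \<in> ?A" for \<alpha>
  proof -
    have [measurable]: "weak_deriv \<alpha> f \<in> borel_measurable borel"
      using sq[OF that] by (simp add: square_integrable_def)
    show ?thesis
      unfolding g_def[abs_def] by measurable
  qed
  have g2: "(g \<alpha> y)\<^sup>2 = indicator unit_cube y *\<^sub>R (weak_deriv \<alpha> f y)\<^sup>2" for \<alpha> y
    by (simp add: g_def indicator_def)
  have gi: "integrable lborel (\<lambda>y. (g \<alpha> y)\<^sup>2)" if "\<alpha> \<in> ?A" for \<alpha>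
    unfolding g2 using sq[OF that] by (intro integrable_mult_indicator) (auto simp: square_integrable_def)
  have pw: "(cmod (fourier f x))\<^sup>2 / (\<Prod>j\<in>UNIV. decay_weight r (x $ j)) \<le> (\<Sum>\<alpha>\<in>?A. (cmod (fourier (g \<alpha>) x))\<^sup>2)" for x
  proof -
    define \<alpha> where "\<alpha> j = (if \<bar>x $ j\<bar> \<ge> 1 then r else 0)" for j
    have \<alpha>: "\<alpha> \<in> ?A" by (simp add: \<alpha>_def)
    have le: "1 / decay_weight r (x $ j) \<le> (\<bar>2 * pi * x $ j\<bar> ^ \<alpha> j)\<^sup>2" for j
    proof (cases "\<bar>x $ j\<bar> \<ge> 1")
      case True
      have "1 / decay_weight r (x $ j) = \<bar>x $ j\<bar> ^ (2 * r)"
        using True by (simp add: decay_weight_def max_def)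
      also have "\<dots> \<le> \<bar>2 * pi * x $ j\<bar> ^ (2 * r)"
        using pi_gt3 by (intro power_mono) (auto simp: abs_mult intro!: mult_right_mono[of 1 "2 * pi", simplified])
      also have "\<dots> = (\<bar>2 * pi * x $ j\<bar> ^ \<alpha> j)\<^sup>2"
        using True by (simp add: \<alpha>_def mult.commute flip: power_mult)
      finally show ?thesis .
    next
      case False
      then show ?thesis
        by (simp add: \<alpha>_def decay_weight_def max_def)
    qed
    have "(cmod (fourier f x))\<^sup>2 / (\<Prod>j\<in>UNIV. decay_weight r (x $ j)) = (\<Prod>j\<in>UNIV. 1 / decay_weight r (x $ j)) * (cmod (fourier f x))\<^sup>2"
      by (simp add: prod_dividef)
    also have "\<dots> \<le> (\<Prod>j\<in>UNIV. (\<bar>2 * pi * x $ j\<bar> ^ \<alpha> j)\<^sup>2) * (cmod (fourier f x))\<^sup>2"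
      by (intro mult_right_mono prod_mono conjI le) (auto intro: less_imp_le decay_weight_pos)
    also have "\<dots> = (cmod (fourier (g \<alpha>) x))\<^sup>2"
    proof -
      have "cmod (fourier (g \<alpha>) x) = (\<Prod>j\<in>UNIV. \<bar>2 * pi * x $ j\<bar> ^ \<alpha> j) * cmod (fourier f x)"
        unfolding g_def[abs_def] by (rule norm_fourier_weak_deriv[OF fD(3) fD(2)]) (use \<alpha> in auto)
      then show ?thesis
        by (simp only: power_mult_distrib prod_power_distrib)
    qed
    also have "\<dots> \<le> (\<Sum>\<alpha>\<in>?A. (cmod (fourier (g \<alpha>) x))\<^sup>2)"
      using \<alpha> by (intro member_le_sum finite_multiindices) auto
    finally show ?thesis .
  qed
  have [measurable]: "fourier (g \<alpha>) \<in> borel_measurable borel" if "\<alpha> \<in> ?A" for \<alpha>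
    by (rule fourier_measurable[OF gm[OF that]])
  have "(\<integral>\<^sup>+x. ennreal ((cmod (fourier f x))\<^sup>2 / (\<Prod>j\<in>UNIV. decay_weight r (x $ j))) \<partial>lborel)
      \<le> (\<integral>\<^sup>+x. (\<Sum>\<alpha>\<in>?A. ennreal ((cmod (fourier (g \<alpha>) x))\<^sup>2)) \<partial>lborel)"
    using pw by (intro nn_integral_mono) (simp add: sum_ennreal ennreal_leI)
  also have "\<dots> = (\<Sum>\<alpha>\<in>?A. \<integral>\<^sup>+x. ennreal ((cmod (fourier (g \<alpha>) x))\<^sup>2) \<partial>lborel)"
    by (rule nn_integral_sum) simp
  also have "\<dots> \<le> (\<Sum>\<alpha>\<in>?A. ennreal (\<integral>y. (g \<alpha> y)\<^sup>2 \<partial>lborel))"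
    by (intro sum_mono plancherel_le gm gi) (auto simp: g_def)
  also have "\<dots> = ennreal (\<Sum>\<alpha>\<in>?A. \<integral>y. (g \<alpha> y)\<^sup>2 \<partial>lborel)"
    by (rule sum_ennreal) simp
  also have "(\<Sum>\<alpha>\<in>?A. \<integral>y. (g \<alpha> y)\<^sup>2 \<partial>lborel) = (\<Sum>\<alpha>\<in>?A. \<integral>y\<in>unit_cube. (weak_deriv \<alpha> f y)\<^sup>2 \<partial>lborel)"
    unfolding g2 set_lebesgue_integral_def ..
  also have "\<dots> = (Hmix_norm r f)\<^sup>2"
    unfolding Hmix_norm_def by (subst real_sqrt_pow2) (auto intro!: sum_nonneg simp: set_lebesgue_integral_def)
  finally show ?thesis .
qed

lemma ennreal_le_of_power2_le:
  fixes x :: ennreal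
  assumes "x\<^sup>2 \<le> ennreal (z\<^sup>2)" "z \<ge> 0"
  shows "x \<le> ennreal z"
proof (cases x)
  case (real y)
  then show ?thesis
    using assms by (auto simp: ennreal_power intro!: ennreal_leI power2_le_imp_le)
next
  case top
  then show ?thesis
    using assms(1) by (simp add: power2_eq_square top_unique ennreal_mult_eq_top_iff)
qed

lemma Hmix_norm_nonneg: "Hmix_norm r f \<ge> 0"
  unfolding Hmix_norm_def by (auto intro!: sum_nonneg simp: set_lebesgue_integral_def)

text \<open>The integrand is split as |F| / sqrt D times sqrt D. Squares are compared first, in
  [0, \<infinity>], because the left side is not known to be finite beforehand; the root halves the
  exponents of T and ln T.\<close>

lemma fourier_hyperbolic_tail:
  fixes f :: "real^'d \<Rightarrow> real" and T :: real
  assumes r: "r \<ge> 1" and f: "f \<in> Hmix0 r" and T: "T \<ge> 2"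
  shows "(\<integral>\<^sup>+x. ennreal (cmod (fourier f x)) * indicator {x. T \<le> (\<Prod>j\<in>UNIV. \<bar>x $ j\<bar>)} x \<partial>lborel)
    \<le> ennreal (sqrt (8 ^ CARD('d)) * T powr (1 / 2 - real r) * ln T powr ((real CARD('d) - 1) / 2) * Hmix_norm r f)"
    (is "?I \<le> ennreal ?z")
proof -
  have [measurable]: "fourier f \<in> borel_measurable borel"
    using Hmix0_D(1)[OF f] by (intro fourier_measurable borel_measurable_continuous_onI)
  define D where "D x = (\<Prod>j\<in>UNIV. decay_weight r (x $ j))" for x :: "real^'d"
  have D: "D x > 0" for x
    unfolding D_def by (rule prod_decay_weight_pos)
  have [measurable]: "D \<in> borel_measurable borel"
    unfolding D_def[abs_def] by measurable
  let ?H = "{x :: real^'d. T \<le> (\<Prod>j\<in>UNIV. \<bar>x $ j\<bar>)}"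
  have lnT: "ln T > 0" using T by simp
  have "?I = (\<integral>\<^sup>+x. ennreal (cmod (fourier f x) / sqrt (D x)) * (ennreal (sqrt (D x)) * indicator ?H x) \<partial>lborel)"
    using D by (intro nn_integral_cong) (simp add: less_imp_le less_imp_neq[symmetric] flip: mult.assoc ennreal_mult)
  then have "?I\<^sup>2 \<le> (\<integral>\<^sup>+x. (ennreal (cmod (fourier f x) / sqrt (D x)))\<^sup>2 \<partial>lborel) * (\<integral>\<^sup>+x. (ennreal (sqrt (D x)) * indicator ?H x)\<^sup>2 \<partial>lborel)"
    by (simp only:) (rule Cauchy_Schwarz_nn_integral; measurable)
  also have "(\<integral>\<^sup>+x. (ennreal (cmod (fourier f x) / sqrt (D x)))\<^sup>2 \<partial>lborel) = (\<integral>\<^sup>+x. ennreal ((cmod (fourier f x))\<^sup>2 / D x) \<partial>lborel)"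
    using D by (intro nn_integral_cong) (simp add: ennreal_power power_divide less_imp_le)
  also have "(\<integral>\<^sup>+x. (ennreal (sqrt (D x)) * indicator ?H x)\<^sup>2 \<partial>lborel) = (\<integral>\<^sup>+x. ennreal (D x) * indicator ?H x \<partial>lborel)"
    using D by (intro nn_integral_cong) (simp add: ennreal_power power_mult_distrib less_imp_le indicator_def)
  also have "(\<integral>\<^sup>+x. ennreal ((cmod (fourier f x))\<^sup>2 / D x) \<partial>lborel) * (\<integral>\<^sup>+x. ennreal (D x) * indicator ?H x \<partial>lborel) \<le>
    ennreal ((Hmix_norm r f)\<^sup>2) * ennreal (8 ^ CARD('d) * T powr (1 - 2 * real r) * ln T ^ (CARD('d) - 1))"
    unfolding D_def by (intro mult_mono weighted_plancherel[OF f] hyperbolic_tail[OF r T]) auto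
  also have "\<dots> = ennreal (?z\<^sup>2)"
  proof -
    have "(T powr (1 / 2 - real r))\<^sup>2 = T powr (1 - 2 * real r)"
      by (simp add: power2_eq_square powr_add[symmetric])
    moreover have "(ln T powr ((real CARD('d) - 1) / 2))\<^sup>2 = ln T ^ (CARD('d) - 1)"
    proof -
      have "(ln T powr ((real CARD('d) - 1) / 2))\<^sup>2 = ln T powr (real (CARD('d) - 1))"
        by (simp add: power2_eq_square powr_add[symmetric] of_nat_diff)
      then show ?thesis
        by (simp only: powr_realpow[OF lnT])
    qed
    ultimately have "?z\<^sup>2 = (Hmix_norm r f)\<^sup>2 * (8 ^ CARD('d) * T powr (1 - 2 * real r) * ln T ^ (CARD('d) - 1))"
      by (simp add: power_mult_distrib)
    then show ?thesis
      using lnT by (simp add: ennreal_mult)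
  qed
  finally show ?thesis
    by (rule ennreal_le_of_power2_le) (simp add: Hmix_norm_nonneg)
qed

section \<open>Diagonal dilations and counting Frolov lattice points\<close>

lemma det_diag_matrix: "det (diag_matrix y) = (\<Prod>j\<in>UNIV. y $ j)"
  by (subst det_diagonal) (auto simp: diag_matrix_def)

lemma diag_matrix_mult_vec: "diag_matrix y *v x = (\<chi> j. y $ j * x $ j)"
  by (simp add: diag_matrix_def matrix_vector_mult_def vec_eq_iff if_distrib[of "\<lambda>t. t * _"] cong: if_cong)

lemma nn_integral_lborel_stretch:
  fixes y :: "real^'d" and F :: "real^'d \<Rightarrow> ennreal"
  assumes "\<And>j. y $ j \<noteq> 0" and [measurable]: "F \<in> borel_measurable borel"
  shows "(\<integral>\<^sup>+x. F x \<partial>lborel) = ennreal \<bar>\<Prod>j\<in>UNIV. y $ j\<bar> * (\<integral>\<^sup>+u. F (\<chi> j. y $ j * u $ j) \<partial>lborel)"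
proof -
  have inv: "invertible (diag_matrix y)"
    using assms(1) by (simp add: invertible_det_nz det_diag_matrix)
  show ?thesis
    by (subst lborel_eq_density_linear[OF inv])
      (simp add: nn_integral_density nn_integral_distr nn_integral_cmult det_diag_matrix diag_matrix_mult_vec[symmetric])
qed

lemma dilation_cube_iff: "u \<in> dilation_cube \<longleftrightarrow> (\<forall>j. 1 \<le> u $ j \<and> u $ j \<le> 2 powr (1 / real CARD('d)))"
  for u :: "real^'d"
  by (simp add: dilation_cube_def mem_box_cart)

text \<open>The dilates \<open>u \<mapsto> c u \<odot> B m\<close> of the lattice points cover a point \<open>x\<close> at most \<open>2 \<Prod>\<bar>x\<^sub>j\<bar> / n\<close> times,
  and only if \<open>\<Prod>\<bar>x\<^sub>j\<bar> \<ge> n\<close>.\<close>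

lemma frolov_dilation_count:
  fixes B :: "real^'d^'d" and x :: "real^'d"
  assumes B: "frolov_matrix B" and n: "n > 0" and c: "c = n powr (1 / real CARD('d))"
  defines "A \<equiv> {m \<in> int_lattice - {0}. (\<chi> j. x $ j / (c * (B *v m) $ j)) \<in> dilation_cube}"
  shows "finite A" "A \<noteq> {} \<Longrightarrow> n \<le> (\<Prod>j\<in>UNIV. \<bar>x $ j\<bar>)" "A \<noteq> {} \<Longrightarrow> real (card A) \<le> 2 * (\<Prod>j\<in>UNIV. \<bar>x $ j\<bar>) / n"
proof -
  let ?b = "2 powr (1 / real CARD('d))"
  have cpos: "c > 0" using n by (simp add: c)
  have cd: "c ^ CARD('d) = n" and bd: "?b ^ CARD('d) = 2"
    using n by (simp_all add: c powr_powr flip: powr_realpow)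
  have b: "?b \<ge> 1" by (intro ge_one_powr_ge_zero) auto
  have prodB: "1 \<le> (\<Prod>j\<in>UNIV. \<bar>(B *v m) $ j\<bar>)" if "m \<in> int_lattice - {0}" for m
    using B that unfolding frolov_matrix_def abs_prod by blast
  have nz: "(B *v m) $ j \<noteq> 0" if "m \<in> int_lattice - {0}" for m j
  proof
    assume "(B *v m) $ j = 0"
    then have "(\<Prod>j\<in>UNIV. \<bar>(B *v m) $ j\<bar>) = 0"
      by (intro prod_zero) auto
    then show False using prodB[OF that] by linarith
  qed
  \<comment> \<open>If x is the dilate of B m by c u, then (B m)_j = x_j / (c u_j) with 1 \<le> u_j
    \<le> 2^(1/d); so \<open>p\<close> and \<open>q\<close> are opposite corners of a box containing
    B m. Their order depends on the sign of each coordinate.\<close>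
  define p where "p = (\<chi> j. x $ j / (c * ?b))"
  define q where "q = (\<chi> j. x $ j / c)"
  have inj: "inj ((*v) B)"
    using B by (simp add: frolov_matrix_def invertible_det_nz inj_matrix_vector_mult invertible_def[symmetric])
  have sub: "(*v) B ` A \<subseteq> (*v) B ` int_lattice \<inter> box_between p q"
  proof safe
    fix m assume m: "m \<in> A"
    then show "B *v m \<in> (*v) B ` int_lattice" by (auto simp: A_def)
    show "B *v m \<in> box_between p q"
      unfolding box_between_def
    proof (intro CollectI allI)
      fix j
      define u where "u = x $ j / (c * (B *v m) $ j)"
      have u: "1 \<le> u" "u \<le> ?b"
        using m by (auto simp: A_def dilation_cube_iff u_def)
      have z: "(B *v m) $ j \<noteq> 0" using nz m by (auto simp: A_def)
      define z where "z = (B *v m) $ j"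
      have x: "x $ j = c * u * z"
        using z cpos by (simp add: u_def z_def)
      have pj: "p $ j = u / ?b * z" and qj: "q $ j = u * z"
        using cpos by (simp_all add: p_def q_def x)
      have "u / ?b \<le> 1" using u b by (simp add: divide_le_eq)
      show "min (p $ j) (q $ j) \<le> (B *v m) $ j \<and> (B *v m) $ j \<le> max (p $ j) (q $ j)"
      proof (cases "z \<ge> 0")
        case True
        then have "u / ?b * z \<le> 1 * z" "1 * z \<le> u * z"
          using u \<open>u / ?b \<le> 1\<close> by (intro mult_right_mono; simp)+
        then show ?thesis
          unfolding pj qj z_def[symmetric] by auto
      next
        case False
        then have "1 * z \<le> u / ?b * z" "u * z \<le> 1 * z"
          using u \<open>u / ?b \<le> 1\<close> by (intro mult_right_mono_neg; simp)+
        then show ?thesis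
          unfolding pj qj z_def[symmetric] by auto
      qed
    qed
  qed
  have fin: "finite ((*v) B ` int_lattice \<inter> box_between p q)"
    and cnt: "real (card ((*v) B ` int_lattice \<inter> box_between p q)) \<le> (\<Prod>j\<in>UNIV. \<bar>p $ j - q $ j\<bar>) + 1"
    using B by (auto simp: frolov_matrix_def)
  have "finite ((*v) B ` A)"
    using sub fin by (rule finite_subset)
  then show finA: "finite A"
    using inj by (meson finite_imageD inj_on_subset subset_UNIV)
  {
    assume "A \<noteq> {}"
    then obtain m where m: "m \<in> A" by blast
    have "c * \<bar>(B *v m) $ j\<bar> \<le> \<bar>x $ j\<bar>" for j
    proof -
      have "1 \<le> x $ j / (c * (B *v m) $ j)"
        using m by (auto simp: A_def dilation_cube_iff)
      then have "1 \<le> \<bar>x $ j\<bar> / (c * \<bar>(B *v m) $ j\<bar>)"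
        using cpos by (metis abs_divide abs_ge_self abs_mult abs_of_pos order_trans)
      moreover have "c * \<bar>(B *v m) $ j\<bar> > 0"
        using cpos nz[of m j] m by (auto simp: A_def)
      ultimately show ?thesis by (simp add: le_divide_eq)
    qed
    then have "(\<Prod>j\<in>UNIV. c * \<bar>(B *v m) $ j\<bar>) \<le> (\<Prod>j\<in>UNIV. \<bar>x $ j\<bar>)"
      using cpos by (intro prod_mono) auto
    moreover have "n * 1 \<le> (\<Prod>j\<in>UNIV. c * \<bar>(B *v m) $ j\<bar>)"
      using prodB[of m] m n unfolding prod.distrib by (auto simp: cd A_def intro!: mult_left_mono)
    ultimately show nle: "n \<le> (\<Prod>j\<in>UNIV. \<bar>x $ j\<bar>)" by simp
    have "\<bar>p $ j - q $ j\<bar> \<le> \<bar>x $ j\<bar> / c" for j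
    proof -
      have "p $ j - q $ j = - (x $ j / c * (1 - 1 / ?b))"
        using b cpos by (simp add: p_def q_def field_simps)
      then have "\<bar>p $ j - q $ j\<bar> = \<bar>x $ j\<bar> / c * (1 - 1 / ?b)"
        using b cpos by (simp add: abs_mult)
      also have "\<dots> \<le> \<bar>x $ j\<bar> / c"
        using b cpos by (intro mult_left_le) auto
      finally show ?thesis .
    qed
    then have "(\<Prod>j\<in>UNIV. \<bar>p $ j - q $ j\<bar>) \<le> (\<Prod>j\<in>UNIV. \<bar>x $ j\<bar> / c)"
      by (intro prod_mono) auto
    also have "\<dots> = (\<Prod>j\<in>UNIV. \<bar>x $ j\<bar>) / n"
      by (simp add: prod_dividef cd)
    finally have "(\<Prod>j\<in>UNIV. \<bar>p $ j - q $ j\<bar>) \<le> (\<Prod>j\<in>UNIV. \<bar>x $ j\<bar>) / n" .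
    \<comment> \<open>Absorbs the additive 1 of the Frolov count, at the price of the factor
      2.\<close>
    moreover have "1 \<le> (\<Prod>j\<in>UNIV. \<bar>x $ j\<bar>) / n"
      using nle n by simp
    moreover have "card A \<le> card ((*v) B ` int_lattice \<inter> box_between p q)"
      using card_mono[OF fin sub] card_image[OF inj_on_subset[OF inj subset_UNIV], of A] by simp
    ultimately show "real (card A) \<le> 2 * (\<Prod>j\<in>UNIV. \<bar>x $ j\<bar>) / n"
      using cnt by simp
  }
qed


section \<open>Averaging over the dilations\<close>

lemma dilation_cube_sets [measurable]: "dilation_cube \<in> sets borel"
  by (simp add: dilation_cube_def)

lemma emeasure_dilation_cube:
  "emeasure lborel (dilation_cube :: (real^'d) set) = ennreal ((2 powr (1 / real CARD('d)) - 1) ^ CARD('d))"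
proof -
  have "2 powr (1 / real CARD('d)) \<ge> 1"
    by (intro ge_one_powr_ge_zero) auto
  then have "emeasure lborel (dilation_cube :: (real^'d) set) =
      ennreal (\<Prod>b\<in>Basis. ((\<chi> j. 2 powr (1 / real CARD('d))) - (\<chi> j. 1) :: real^'d) \<bullet> b)"
    unfolding dilation_cube_def by (intro emeasure_lborel_cbox) (auto simp: Basis_vec_def inner_axis)
  then show ?thesis
    unfolding prod_Basis_vec by simp
qed

text \<open>For fixed m, pulling back to x gives the density 1 / P with P = |\<Prod> c (B m)_j|. As
  \<Prod> u_j \<le> 2 on the dilation cube, this is at most 2 / \<Prod> |x_j|, which no longer
  depends on m. After exchanging sum and integral only the number of admissible m is left, and (2
  \<Prod> |x_j| / n) (2 / \<Prod> |x_j|) = 4 / n.\<close>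

lemma nn_integral_frolov_dilations_le:
  fixes B :: "real^'d^'d" and \<phi> :: "real^'d \<Rightarrow> ennreal"
  assumes B: "frolov_matrix B" and n: "n > 0" and c: "c = n powr (1 / real CARD('d))"
    and [measurable]: "\<phi> \<in> borel_measurable borel"
  shows "(\<integral>\<^sup>+u. (\<integral>\<^sup>+m. \<phi> (\<chi> j. c * (B *v m) $ j * u $ j) \<partial>count_space (int_lattice - {0})) * indicator dilation_cube u \<partial>lborel)
    \<le> ennreal (4 / n) * (\<integral>\<^sup>+x. \<phi> x * indicator {x. n \<le> (\<Prod>j\<in>UNIV. \<bar>x $ j\<bar>)} x \<partial>lborel)"
proof -
  let ?L = "int_lattice - {0} :: (real^'d) set"
  let ?V = "\<lambda>u m. (\<chi> j. c * (B *v m) $ j * u $ j) :: real^'d"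
  let ?W = "\<lambda>x m. (\<chi> j. x $ j / (c * (B *v m) $ j)) :: real^'d"
  have cpos: "c > 0" using n by (simp add: c)
  have bd: "(2 powr (1 / real CARD('d))) ^ CARD('d) = 2"
    by (simp add: powr_powr flip: powr_realpow)
  have cnt: "countable ?L"
    by (intro countable_Diff countable_int_lattice)
  have nz: "c * (B *v m) $ j \<noteq> 0" if "m \<in> ?L" for m j
  proof
    assume "c * (B *v m) $ j = 0"
    then have "(\<Prod>j\<in>UNIV. (B *v m) $ j) = 0"
      using cpos by (intro prod_zero) auto
    moreover have "1 \<le> \<bar>\<Prod>j\<in>UNIV. (B *v m) $ j\<bar>"
      using B that unfolding frolov_matrix_def by blast
    ultimately show False by linarith
  qed
  have [measurable]: "(\<lambda>u. ?V u m) \<in> borel \<rightarrow>\<^sub>M borel" "(\<lambda>x. ?W x m) \<in> borel \<rightarrow>\<^sub>M borel" for m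
    by (intro borel_measurable_vec_lambda; measurable)+
  have single: "(\<integral>\<^sup>+u. \<phi> (?V u m) * indicator dilation_cube u \<partial>lborel) \<le>
      (\<integral>\<^sup>+x. \<phi> x * ennreal (2 / (\<Prod>j\<in>UNIV. \<bar>x $ j\<bar>)) * indicator dilation_cube (?W x m) \<partial>lborel)"
    if m: "m \<in> ?L" for m
  proof -
    define y where "y = (\<chi> j. c * (B *v m) $ j)"
    have y: "y $ j \<noteq> 0" for j using nz[OF m] by (simp add: y_def)
    define P where "P = \<bar>\<Prod>j\<in>UNIV. y $ j\<bar>"
    have P: "P > 0" using y by (simp add: P_def)
    let ?F = "\<lambda>x. \<phi> x * indicator dilation_cube (?W x m)"
    have "(\<integral>\<^sup>+x. ?F x \<partial>lborel) = ennreal P * (\<integral>\<^sup>+u. ?F (\<chi> j. y $ j * u $ j) \<partial>lborel)"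
      unfolding P_def by (rule nn_integral_lborel_stretch[OF y]) measurable
    also have "(\<lambda>u. ?F (\<chi> j. y $ j * u $ j)) = (\<lambda>u. \<phi> (?V u m) * indicator dilation_cube u)"
      using nz[OF m] by (simp add: y_def)
    finally have eq: "(\<integral>\<^sup>+u. \<phi> (?V u m) * indicator dilation_cube u \<partial>lborel) = ennreal (1 / P) * (\<integral>\<^sup>+x. ?F x \<partial>lborel)"
      using P by (simp flip: mult.assoc ennreal_mult)
    also have "\<dots> = (\<integral>\<^sup>+x. ennreal (1 / P) * ?F x \<partial>lborel)"
      by (rule nn_integral_cmult[symmetric]) measurable
    also have "\<dots> \<le> (\<integral>\<^sup>+x. \<phi> x * ennreal (2 / (\<Prod>j\<in>UNIV. \<bar>x $ j\<bar>)) * indicator dilation_cube (?W x m) \<partial>lborel)"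
    proof (rule nn_integral_mono)
      fix x :: "real^'d"
      show "ennreal (1 / P) * ?F x \<le> \<phi> x * ennreal (2 / (\<Prod>j\<in>UNIV. \<bar>x $ j\<bar>)) * indicator dilation_cube (?W x m)"
      proof (cases "?W x m \<in> dilation_cube")
        case True
        then have u: "1 \<le> x $ j / y $ j" "x $ j / y $ j \<le> 2 powr (1 / real CARD('d))" for j
          by (auto simp: dilation_cube_iff y_def)
        have x0: "\<bar>x $ j\<bar> > 0" for j
          using u(1)[of j] by auto
        have "\<bar>x $ j\<bar> \<le> 2 powr (1 / real CARD('d)) * \<bar>y $ j\<bar>" for j
        proof -
          have "\<bar>x $ j\<bar> = (x $ j / y $ j) * \<bar>y $ j\<bar>"
          proof -
            have "\<bar>x $ j / y $ j\<bar> = x $ j / y $ j"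
              by (rule abs_of_nonneg) (use u(1)[of j] in linarith)
            then have "\<bar>x $ j\<bar> / \<bar>y $ j\<bar> = x $ j / y $ j"
              by (simp only: abs_divide)
            moreover have "\<bar>y $ j\<bar> \<noteq> 0" using y by simp
            ultimately show ?thesis
              by (metis nonzero_divide_eq_eq)
          qed
          then show ?thesis
            using mult_right_mono[OF u(2)[of j] abs_ge_zero[of "y $ j"]] by (simp only:)
        qed
        then have "(\<Prod>j\<in>UNIV. \<bar>x $ j\<bar>) \<le> (\<Prod>j\<in>UNIV. 2 powr (1 / real CARD('d)) * \<bar>y $ j\<bar>)"
          by (intro prod_mono) auto
        then have "(\<Prod>j\<in>UNIV. \<bar>x $ j\<bar>) \<le> 2 * P"
          by (simp add: prod.distrib bd P_def abs_prod)
        moreover have "(\<Prod>j\<in>UNIV. \<bar>x $ j\<bar>) > 0"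
          using x0 by (intro prod_pos) auto
        ultimately have "1 / P \<le> 2 / (\<Prod>j\<in>UNIV. \<bar>x $ j\<bar>)"
          using P by (simp add: field_simps)
        then show ?thesis
          using True by (simp add: mult.commute[of _ "\<phi> x"] mult_left_mono ennreal_leI)
      qed simp
    qed
    finally show ?thesis .
  qed
  have "(\<integral>\<^sup>+u. (\<integral>\<^sup>+m. \<phi> (?V u m) \<partial>count_space ?L) * indicator dilation_cube u \<partial>lborel)
      = (\<integral>\<^sup>+u. (\<integral>\<^sup>+m. \<phi> (?V u m) * indicator dilation_cube u \<partial>count_space ?L) \<partial>lborel)"
    by (simp add: nn_integral_multc)
  also have "\<dots> = (\<integral>\<^sup>+m. (\<integral>\<^sup>+u. \<phi> (?V u m) * indicator dilation_cube u \<partial>lborel) \<partial>count_space ?L)"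
    by (rule nn_integral_count_space_nn_integral[OF cnt]) measurable
  also have "\<dots> \<le> (\<integral>\<^sup>+m. (\<integral>\<^sup>+x. \<phi> x * ennreal (2 / (\<Prod>j\<in>UNIV. \<bar>x $ j\<bar>)) * indicator dilation_cube (?W x m) \<partial>lborel) \<partial>count_space ?L)"
    by (rule nn_integral_mono) (use single in simp)
  also have "\<dots> = (\<integral>\<^sup>+x. (\<integral>\<^sup>+m. \<phi> x * ennreal (2 / (\<Prod>j\<in>UNIV. \<bar>x $ j\<bar>)) * indicator dilation_cube (?W x m) \<partial>count_space ?L) \<partial>lborel)"
    by (rule nn_integral_count_space_nn_integral[OF cnt, symmetric]) measurable
  also have "\<dots> \<le> (\<integral>\<^sup>+x. ennreal (4 / n) * (\<phi> x * indicator {x. n \<le> (\<Prod>j\<in>UNIV. \<bar>x $ j\<bar>)} x) \<partial>lborel)"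
  proof (rule nn_integral_mono)
    fix x :: "real^'d"
    define A where "A = {m \<in> ?L. ?W x m \<in> dilation_cube}"
    note count = frolov_dilation_count[OF B n c, of x, folded A_def]
    let ?p = "\<Prod>j\<in>UNIV. \<bar>x $ j\<bar>"
    have "(\<integral>\<^sup>+m. \<phi> x * ennreal (2 / ?p) * indicator dilation_cube (?W x m) \<partial>count_space ?L) =
        (\<Sum>m\<in>A. \<phi> x * ennreal (2 / ?p) * indicator dilation_cube (?W x m))"
      by (rule nn_integral_count_space') (use count(1) in \<open>auto simp: A_def\<close>)
    also have "\<dots> = (\<Sum>m\<in>A. \<phi> x * ennreal (2 / ?p))"
      by (intro sum.cong) (auto simp: A_def)
    also have "\<dots> = of_nat (card A) * (\<phi> x * ennreal (2 / ?p))"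
      by simp
    also have "\<dots> \<le> ennreal (4 / n) * (\<phi> x * indicator {x. n \<le> (\<Prod>j\<in>UNIV. \<bar>x $ j\<bar>)} x)"
    proof (cases "A = {}")
      case False
      then have p: "n \<le> ?p" and card: "real (card A) \<le> 2 * ?p / n"
        using count by blast+
      have "?p > 0" using n p by linarith
      have "real (card A) * (2 / ?p) \<le> 2 * ?p / n * (2 / ?p)"
        using \<open>?p > 0\<close> by (intro mult_right_mono card) auto
      also have "\<dots> = 4 / n"
      proof -
        have "2 * p / n * (2 / p) = 4 / n" if "p > 0" for p
          using that by simp
        then show ?thesis using \<open>?p > 0\<close> by blast
      qed
      finally have "of_nat (card A) * ennreal (2 / ?p) \<le> ennreal (4 / n)"
        using \<open>?p > 0\<close> by (simp add: ennreal_of_nat_eq_real_of_nat ennreal_leI flip: ennreal_mult)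
      then have "of_nat (card A) * ennreal (2 / ?p) * \<phi> x \<le> ennreal (4 / n) * \<phi> x"
        by (rule mult_right_mono) simp
      then show ?thesis
        using p by (simp add: mult_ac)
    qed simp
    finally show "(\<integral>\<^sup>+m. \<phi> x * ennreal (2 / ?p) * indicator dilation_cube (?W x m) \<partial>count_space ?L) \<le>
        ennreal (4 / n) * (\<phi> x * indicator {x. n \<le> (\<Prod>j\<in>UNIV. \<bar>x $ j\<bar>)} x)" .
  qed
  also have "\<dots> = ennreal (4 / n) * (\<integral>\<^sup>+x. \<phi> x * indicator {x. n \<le> (\<Prod>j\<in>UNIV. \<bar>x $ j\<bar>)} x \<partial>lborel)"
    by (rule nn_integral_cmult) measurable
  finally show ?thesis .
qed

section \<open>The random quadrature rule and its measurability\<close>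

lemma dilated_matrix_eq: "c *\<^sub>R (diag_matrix u ** B) = diag_matrix (\<chi> j. c * u $ j) ** B"
  by (simp add: diag_matrix_def matrix_matrix_mult_def vec_eq_iff if_distrib[of "\<lambda>t. t * _"] cong: if_cong)

lemma dilated_matrix_mult_vec:
  fixes B :: "real^'d^'d"
  shows "(c *\<^sub>R (diag_matrix u ** B)) *v m = (\<chi> j. c * (B *v m) $ j * u $ j)"
  unfolding dilated_matrix_eq matrix_vector_mul_assoc[symmetric] diag_matrix_mult_vec by (simp add: mult_ac)

lemma dilated_matrix_invertible:
  fixes B :: "real^'d^'d"
  assumes "invertible B" "c > 0"
  shows "invertible (c *\<^sub>R (diag_matrix u ** B)) \<longleftrightarrow> (\<forall>j. u $ j \<noteq> 0)"
  using assms unfolding dilated_matrix_eq by (auto simp: invertible_det_nz det_mul det_diag_matrix)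

text \<open>Makes the nodes explicit functions of \<open>u\<close>, so that measurability in
  \<open>u\<close> does not have to be read off from a matrix inverse.\<close>

lemma dilated_matrix_inverse:
  fixes B :: "real^'d^'d"
  assumes B: "invertible B" and c: "c > 0" and u: "\<And>j. u $ j \<noteq> 0"
  shows "transpose (matrix_inv (c *\<^sub>R (diag_matrix u ** B))) *v y =
    (\<chi> j. (transpose (matrix_inv B) *v y) $ j / (c * u $ j))"
proof -
  let ?S = "c *\<^sub>R (diag_matrix u ** B)"
  have S: "invertible ?S"
    using dilated_matrix_invertible[OF B c] u by blast
  have T: "transpose ?S *v z = transpose B *v (\<chi> j. c * u $ j * z $ j)" for z
  proof -
    have "transpose (diag_matrix w) = diag_matrix w" for w :: "real^'d"
      by (simp add: transpose_def diag_matrix_def vec_eq_iff)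
    then have "transpose ?S = transpose B ** diag_matrix (\<chi> j. c * u $ j)"
      unfolding dilated_matrix_eq by (simp add: matrix_transpose_mul)
    then have "transpose ?S *v z = transpose B *v (diag_matrix (\<chi> j. c * u $ j) *v z)"
      by (simp only: matrix_vector_mul_assoc)
    also have "diag_matrix (\<chi> j. c * u $ j) *v z = (\<chi> j. c * u $ j * z $ j)"
      by (simp add: diag_matrix_mult_vec)
    finally show ?thesis .
  qed
  have "transpose ?S *v (\<chi> j. (transpose (matrix_inv B) *v y) $ j / (c * u $ j)) = y"
    unfolding T using u c transpose_matrix_inv_mult(1)[OF B, of y] by (simp del: transpose_matrix_vector)
  then show ?thesis
    using transpose_matrix_inv_mult(2)[OF S] by metis
qed

text \<open>The lattice sum is a pointwise limit of sums over balls, each a finite sum of measurable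
  functions of \<open>u\<close>. By compact support the sequence is eventually constant, but from an
  index that depends on \<open>u\<close>.\<close>

lemma quad_error_measurable:
  fixes B :: "real^'d^'d" and f :: "real^'d \<Rightarrow> real"
  assumes B: "invertible B" and n: "n \<ge> 1" and f: "continuous_on UNIV f" and supp: "\<And>y. y \<notin> unit_cube \<Longrightarrow> f y = 0"
  shows "quad_error B n v f \<in> borel_measurable borel"
proof -
  define c where "c = real n powr (1 / real CARD('d))"
  have c: "c > 0" using n by (simp add: c_def)
  have [measurable]: "f \<in> borel_measurable borel"
    using f by (rule borel_measurable_continuous_onI)
  let ?S = "\<lambda>u. c *\<^sub>R (diag_matrix u ** B)"
  define L where "L i = int_lattice \<inter> cball (0 :: real^'d) (real i)" for i
  have L: "finite (L i)" for i
    unfolding L_def by (intro finite_int_lattice_bounded bounded_cball)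
  define g where "g m u = f (\<chi> j. (transpose (matrix_inv B) *v (m + v)) $ j / (c * u $ j))" for m u :: "real^'d"
  have g [measurable]: "g m \<in> borel_measurable borel" for m
  proof -
    have [measurable]: "(\<lambda>u. (\<chi> j. (transpose (matrix_inv B) *v (m + v)) $ j / (c * u $ j)) :: real^'d) \<in> borel \<rightarrow>\<^sub>M borel"
      by (intro borel_measurable_vec_lambda; measurable)
    show ?thesis unfolding g_def[abs_def] by measurable
  qed
  \<comment> \<open>For \<open>u\<close> with a zero coordinate the matrix is singular and its
    inverse unspecified; any default will do, as the prefactor 1 / |det| is then 1 / 0 = 0.\<close>
  define h where "h i u = (if \<forall>j. u $ j \<noteq> 0 then \<Sum>m\<in>L i. g m u else 0)" for i and u :: "real^'d"
  have h [measurable]: "h i \<in> borel_measurable borel" for i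
    unfolding h_def[abs_def] by measurable
  define H where "H u = (if \<forall>j. u $ j \<noteq> 0 then \<Sum>\<^sub>\<infinity>m\<in>int_lattice. g m u else 0)" for u :: "real^'d"
  have "(\<lambda>i. h i u) \<longlonglongrightarrow> H u" for u
  proof (cases "\<forall>j. u $ j \<noteq> 0")
    case True
    then have S: "invertible (?S u)"
      using dilated_matrix_invertible[OF B c] by blast
    define M where "M = {m \<in> int_lattice. g m u \<noteq> 0}"
    have "M \<subseteq> {m \<in> int_lattice. \<exists>y\<in>centred_cube. transpose (matrix_inv (?S u)) *v (v + (m + y)) \<in> unit_cube}"
    proof
      fix m assume m: "m \<in> M"
      then have "transpose (matrix_inv (?S u)) *v (m + v) \<in> unit_cube"
        using supp by (subst dilated_matrix_inverse[OF B c]) (use True in \<open>auto simp: M_def g_def\<close>)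
      then show "m \<in> {m \<in> int_lattice. \<exists>y\<in>centred_cube. transpose (matrix_inv (?S u)) *v (v + (m + y)) \<in> unit_cube}"
        using m by (intro CollectI conjI bexI[of _ 0])
          (auto simp: M_def centred_cube_def add.commute simp del: transpose_matrix_vector)
    qed
    then have M: "finite M"
      using lattice_sum_finite_support[OF S] by (rule finite_subset)
    obtain b where b: "\<And>m. m \<in> M \<Longrightarrow> norm m \<le> b"
      using finite_imp_bounded[OF M] by (auto simp: bounded_iff)
    have "h i u = H u" if "i \<ge> nat \<lceil>b\<rceil>" for i
    proof -
      have "b \<le> real i" using that by linarith
      then have sub: "M \<subseteq> L i"
        using b by (fastforce simp: M_def L_def)
      have "(\<Sum>m\<in>L i. g m u) = (\<Sum>m\<in>M. g m u)"
        using sub L by (intro sum.mono_neutral_right) (auto simp: M_def L_def)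
      also have "\<dots> = (\<Sum>\<^sub>\<infinity>m\<in>M. g m u)"
        using M by simp
      also have "\<dots> = (\<Sum>\<^sub>\<infinity>m\<in>int_lattice. g m u)"
        by (rule infsum_cong_neutral) (auto simp: M_def)
      finally show ?thesis
        using True by (simp add: h_def H_def)
    qed
    then have "eventually (\<lambda>i. h i u = H u) sequentially"
      by (intro eventually_sequentiallyI[of "nat \<lceil>b\<rceil>"])
    then show ?thesis by (rule tendsto_eventually)
  next
    case False
    then show ?thesis by (simp only: h_def H_def if_False tendsto_const)
  qed
  then have [measurable]: "H \<in> borel_measurable borel"
    by (rule borel_measurable_LIMSEQ_real) measurable
  have [measurable]: "(\<lambda>u. det (?S u)) \<in> borel_measurable borel"
    unfolding dilated_matrix_eq det_mul det_diag_matrix vec_lambda_beta by measurable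
  have "quad_error B n v f u = \<bar>1 / \<bar>det (?S u)\<bar> * H u - (\<integral>x. f x \<partial>lborel)\<bar>" for u
  proof (cases "\<forall>j. u $ j \<noteq> 0")
    case True
    then show ?thesis
      unfolding quad_error_def quadrature_def c_def[symmetric] H_def g_def
      using dilated_matrix_inverse[OF B c, of u] by simp
  next
    case False
    then have "det (?S u) = 0"
      using dilated_matrix_invertible[OF B c, of u] unfolding invertible_det_nz by blast
    then show ?thesis
      unfolding quad_error_def quadrature_def c_def[symmetric] by simp
  qed
  then have "quad_error B n v f = (\<lambda>u. \<bar>1 / \<bar>det (?S u)\<bar> * H u - (\<integral>x. f x \<partial>lborel)\<bar>)"
    by blast
  then show ?thesis
    by simp
qed

lemma nn_integral_quad_error_le:
  fixes B :: "real^'d^'d"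
  assumes B: "frolov_matrix B" and r: "r \<ge> 1" and n: "n \<ge> 2" and f: "f \<in> Hmix0 r"
  shows "(\<integral>\<^sup>+u. ennreal (quad_error B n v f u) * indicator dilation_cube u \<partial>lborel) \<le>
    ennreal (4 * sqrt (8 ^ CARD('d)) * real n powr (- real r - 1 / 2) * ln (real n) powr ((real CARD('d) - 1) / 2) * Hmix_norm r f)"
proof -
  define c where "c = real n powr (1 / real CARD('d))"
  have c: "c > 0" using n by (simp add: c_def)
  note fD = Hmix0_D(1,2)[OF f]
  have invB: "invertible B" using B by (simp add: frolov_matrix_def)
  have [measurable]: "fourier f \<in> borel_measurable borel"
    using fD(1) by (intro fourier_measurable borel_measurable_continuous_onI)
  have "(\<integral>\<^sup>+u. ennreal (quad_error B n v f u) * indicator dilation_cube u \<partial>lborel) \<le>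
    (\<integral>\<^sup>+u. (\<integral>\<^sup>+m. ennreal (cmod (fourier f (\<chi> j. c * (B *v m) $ j * u $ j))) \<partial>count_space (int_lattice - {0})) * indicator dilation_cube u \<partial>lborel)"
  proof (rule nn_integral_mono)
    fix u :: "real^'d"
    show "ennreal (quad_error B n v f u) * indicator dilation_cube u \<le>
      (\<integral>\<^sup>+m. ennreal (cmod (fourier f (\<chi> j. c * (B *v m) $ j * u $ j))) \<partial>count_space (int_lattice - {0})) * indicator dilation_cube u"
    proof (cases "u \<in> dilation_cube")
      case True
      then have "u $ j \<noteq> 0" for j
        by (metis dilation_cube_iff not_one_le_zero)
      then have "invertible (c *\<^sub>R (diag_matrix u ** B))"
        using dilated_matrix_invertible[OF invB c] by blast
      from quadrature_error_le_fourier[OF this fD] True show ?thesis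
        by (simp add: quad_error_def c_def[symmetric] dilated_matrix_mult_vec)
    qed simp
  qed
  also have "\<dots> \<le> ennreal (4 / real n) * (\<integral>\<^sup>+x. ennreal (cmod (fourier f x)) * indicator {x. real n \<le> (\<Prod>j\<in>UNIV. \<bar>x $ j\<bar>)} x \<partial>lborel)"
    using n by (intro nn_integral_frolov_dilations_le[OF B _ c_def]) auto
  also have "\<dots> \<le> ennreal (4 / real n) * ennreal (sqrt (8 ^ CARD('d)) * real n powr (1 / 2 - real r) * ln (real n) powr ((real CARD('d) - 1) / 2) * Hmix_norm r f)"
    using n by (intro mult_left_mono fourier_hyperbolic_tail r f) auto
  also have "\<dots> = ennreal (4 * sqrt (8 ^ CARD('d)) * real n powr (- real r - 1 / 2) * ln (real n) powr ((real CARD('d) - 1) / 2) * Hmix_norm r f)"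
  proof -
    \<comment> \<open>The covering factor 1 / n lowers the exponent 1/2 - r of the Fourier tail by
      one.\<close>
    have "real n powr (- real r - 1 / 2) = real n powr ((1 / 2 - real r) - 1)"
      by (rule arg_cong[of _ _ "\<lambda>t. real n powr t"]) simp
    also have "\<dots> = real n powr (1 / 2 - real r) / real n powr 1"
      by (rule powr_diff)
    also have "\<dots> = real n powr (1 / 2 - real r) / real n"
      using n by simp
    finally show ?thesis
      by (simp add: Hmix_norm_nonneg mult_ac flip: ennreal_mult)
  qed
  finally show ?thesis .
qed

theorem theorem6:
  fixes B :: "real^'d^'d" and r :: nat
  assumes "r \<ge> 1" and "frolov_matrix B"
  shows "\<exists>c>0. \<forall>(M :: 'a measure) (U :: 'a \<Rightarrow> real^'d). prob_space M \<longrightarrow> uniform_dilation M U \<longrightarrow>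
    (\<forall>n\<ge>2. \<forall>v. \<forall>f\<in>Hmix0 r.
      integrable M (\<lambda>\<omega>. quad_error B n v f (U \<omega>)) \<and>
      prob_space.expectation M (\<lambda>\<omega>. quad_error B n v f (U \<omega>))
        \<le> c * real n powr (- real r - 1 / 2) * ln (real n) powr ((real CARD('d) - 1) / 2)
          * Hmix_norm r f)"
proof -
  define vol where "vol = (2 powr (1 / real CARD('d)) - 1) ^ CARD('d)"
  have "2 powr (1 / real CARD('d)) > 1"
    by (intro gr_one_powr) auto
  then have vol: "vol > 0"
    by (simp add: vol_def)
  \<comment> \<open>Division by the volume of the dilation cube turns the Lebesgue integral into the
    expectation.\<close>
  define c where "c = 4 * sqrt (8 ^ CARD('d)) / vol"
  have "c > 0" using vol by (simp add: c_def)
  moreover have "integrable M (\<lambda>\<omega>. quad_error B n v f (U \<omega>)) \<and>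
      prob_space.expectation M (\<lambda>\<omega>. quad_error B n v f (U \<omega>))
        \<le> c * real n powr (- real r - 1 / 2) * ln (real n) powr ((real CARD('d) - 1) / 2) * Hmix_norm r f"
    if M: "prob_space M" and U: "uniform_dilation M U" and n: "n \<ge> 2" and f: "f \<in> Hmix0 r"
    for M :: "'a measure" and U :: "'a \<Rightarrow> real^'d" and n v f
  proof -
    let ?z = "c * real n powr (- real r - 1 / 2) * ln (real n) powr ((real CARD('d) - 1) / 2) * Hmix_norm r f"
    have invB: "invertible B" using assms(2) by (simp add: frolov_matrix_def)
    have [measurable]: "U \<in> borel_measurable M"
      and distr: "distr M lborel U = uniform_measure lborel dilation_cube"
      using U by (auto simp: uniform_dilation_def)
    have qm [measurable]: "quad_error B n v f \<in> borel_measurable borel"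
      using n Hmix0_D(1,2)[OF f] by (intro quad_error_measurable invB) auto
    have nonneg: "0 \<le> quad_error B n v f u" for u
      by (simp add: quad_error_def)
    have z: "0 \<le> ?z"
      using \<open>c > 0\<close> Hmix_norm_nonneg[of r f] by simp
    have "(\<integral>\<^sup>+\<omega>. ennreal (quad_error B n v f (U \<omega>)) \<partial>M) = (\<integral>\<^sup>+u. ennreal (quad_error B n v f u) \<partial>distr M lborel U)"
      by (subst nn_integral_distr) auto
    also have "\<dots> = (\<integral>\<^sup>+u. ennreal (quad_error B n v f u) * indicator dilation_cube u \<partial>lborel) / ennreal vol"
      unfolding distr by (subst nn_integral_uniform_measure) (auto simp: emeasure_dilation_cube vol_def)
    also have "\<dots> \<le> ennreal (4 * sqrt (8 ^ CARD('d)) * real n powr (- real r - 1 / 2) * ln (real n) powr ((real CARD('d) - 1) / 2) * Hmix_norm r f) / ennreal vol"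
      by (intro divide_right_mono_ennreal nn_integral_quad_error_le assms n f)
    also have "\<dots> = ennreal ?z"
      using vol Hmix_norm_nonneg[of r f] by (subst divide_ennreal) (auto simp: c_def)
    finally have bound: "(\<integral>\<^sup>+\<omega>. ennreal (quad_error B n v f (U \<omega>)) \<partial>M) \<le> ennreal ?z" .
    \<comment> \<open>The bound is obtained in [0, \<infinity>] before integrability, which it then
      implies because the error is nonnegative and measurable.\<close>
    have int: "integrable M (\<lambda>\<omega>. quad_error B n v f (U \<omega>))"
      by (rule integrableI_nonneg) (use bound nonneg in \<open>auto simp: le_less_trans\<close>)
    have "ennreal (\<integral>\<omega>. quad_error B n v f (U \<omega>) \<partial>M) \<le> ennreal ?z"
      using bound nn_integral_eq_integral[OF int] nonneg by simp
    then show ?thesis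
      using int z by (simp add: ennreal_le_iff)
  qed
  ultimately show ?thesis
    by blast
qed

end
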